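(* The transformations $\widehat{\mathbf T}$ and $\widetilde{\mathbf T}$ are inverses of each other in the following sense. (1) If $(q,f,F)\in\widehat{\mathcal S}$ and $(\widehat q,\widehat f,\widehat F)=\widehat{\mathbf T}(q,f,F)$, then $$\widetilde{\mathbf T}\left(\mathring\lambda(q,f,F),\ \mathring\gamma(q,f,F),\ \widehat q,\ \widehat f,\ \widehat F\right)=(q,f,F).$$ (2) Conversely, if $(\mu,\nu,q,f,F)\in\widetilde{\mathcal S}$, then $\widehat{\mathbf T}\,\widetilde{\mathbf T}(\mu,\nu,q,f,F)=(q,f,F)$.
   Context: $\mathscr R$ is the set consisting of the symbol $\infty$ together with all rational functions $f(\lambda)=h_0\lambda+h+\sum_{k=1}^d\frac{\delta_k}{h_k-\lambda}$ ($d\ge 0$) with real coefficients, $h_0\ge 0$, $\delta_k>0$, $h_1<\dots<h_d$. The index is $\operatorname{ind} f=2d+1$ if $h_0>0$, $\operatorname{ind} f=2d$ if $h_0=0$, and $\operatorname{ind}\infty=-1$; $\mathscr R_n=\{f\in\mathscr R:\operatorname{ind} f=n\}$ (so $\mathscr R_0$ is the set of real constants). For $f\neq\infty$ put $f_\downarrow(\lambda)=h_0'\prod_{k=1}^d(h_k-\lambda)$ with $h_0'=1/h_0$ if $h_0>0$ and $h_0'=1$ if $h_0=0$, and $f_\uparrow=f\cdot f_\downarrow$ (a polynomial); for $f=\infty$ put $f_\uparrow=-1$, $f_\downarrow=0$. $\mathring{\pi}(f)$ denotes the smallest pole of $f$, and $\mathring\pi(f)=+\infty$ if $\operatorname{ind}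 f\le 1$. All potentials $q\in L_1(0,\pi)$ are real-valued. $\mathscr P(q,f,F)$ is the boundary value problem $-y''+q(x)y=\lambda y$ on $(0,\pi)$, $\frac{y'(0)}{y(0)}=-f(\lambda)$, $\frac{y'(\pi)}{y(\pi)}=F(\lambda)$, i.e. $f_\downarrow(\lambda)y'(0)+f_\uparrow(\lambda)y(0)=0$ and $F_\downarrow(\lambda)y'(\pi)-F_\uparrow(\lambda)y(\pi)=0$ (so $\infty$ means a Dirichlet condition). $\varphi(x,\lambda)$, $\psi(x,\lambda)$ are the solutions of the equation with $\varphi(0,\lambda)=f_\downarrow(\lambda)$, $\varphi'(0,\lambda)=-f_\uparrow(\lambda)$, $\psi(\pi,\lambda)=F_\downarrow(\lambda)$, $\psi'(\pi,\lambda)=F_\uparrow(\lambda)$. The eigenvalues are real and simple, numbered $\lambda_0<\lambda_1<\dots$, and for each there is a unique $\beta_n\ne0$ with $\psi(x,\lambda_n)=\beta_n\varphi(x,\lambda_n)$. The norming constants are $\gamma_n=\int_0^\pi\varphi^2(x,\lambda_n)\,dx+f'(\lambda_n)f_\downarrow^2(\lambda_n)+\frac{1}{\beta_n^2}F'(\lambda_n)F_\downarrow^2(\lambda_n)$, where $f'f_\downarrow^2$ means the polynomial $f_\uparrow'f_\downarrow-f_\uparrow f_\downarrow'$ (so it is $0$ if $f$ is constant or $\infty$), and similarly for $F$. $\mathring\lambda(q,f,F)=\lambda_0$ and $\mathring\gamma(q,f,F)=\gamma_0$ denote the smallest eigenvalue and the corresponding norming constant. Transformation $\boldsymbol\Theta$: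 for $\mu,\tau\in\mathbb R$ and $f\in\mathscr R$ with $\mu<\mathring\pi(f)$ and $\tau\ge f(\mu)$ if $f\neq\infty$, $\boldsymbol\Theta(\mu,\tau,f)(\lambda):=\frac{\mu-\lambda}{f(\lambda)-\tau}-\tau$; if $f\equiv\tau$ this means $\infty$, and if $f=\infty$ it means the constant $-\tau$. Transformation $\widehat{\mathbf T}$: its domain $\widehat{\mathcal S}$ is the set of $(q,f,F)$ with $q\in L_1(0,\pi)$, $f,F\in\mathscr R$ not both $\infty$. Put $\Lambda=\lambda_0$ if $f,F\neq\infty$ and $\Lambda=\lambda_0-2$ otherwise ($\lambda_0=\mathring\lambda(q,f,F)$), $v(x)=\varphi(x,\Lambda)$ if $f\ne\infty$ and $v(x)=\psi(x,\Lambda)$ if $f=\infty$ ($v$ has no zeros on $[0,\pi]$). Then $\widehat{\mathbf T}(q,f,F)=(\widehat q,\widehat f,\widehat F)$ with $\widehat q=q-2\left(\frac{v'}{v}\right)'$, $\widehat f=\boldsymbol\Theta\left(\Lambda,-\frac{v'(0)}{v(0)},f\right)$, $\widehat F=\boldsymbol\Theta\left(\Lambda,\frac{v'(\pi)}{v(\pi)},F\right)$. Transformation $\widetilde{\mathbf T}$: its domain is $\widetilde{\mathcal S}=\widetilde{\mathcal S}_1\cup\widetilde{\mathcal S}_2\cup\widetilde{\mathcal S}_3$, consisting of tuples $(\mu,\nu,q,f,F)$ with $q\in L_1(0,\pi)$, $f,F\in\mathscr R$ and, respectively: ($\widetilde{\mathcal S}_1$) $\mu<\mathring\lambda(q,f,F)$,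 $\nu>0$; ($\widetilde{\mathcal S}_2$) $f\in\mathscr R_0$, $\mu=\mathring\lambda(q,f,F)$, $\nu=\mathring\gamma(q,f,F)/2$; ($\widetilde{\mathcal S}_3$) $F\in\mathscr R_0$, $\mu=\mathring\lambda(q,f,F)$, $\nu=2\mathring\gamma(q,f,F)$. A number $\Lambda$ and a zero-free function $u$ on $[0,\pi]$ are chosen as follows. On $\widetilde{\mathcal S}_1$: $\Lambda=\mu$; let $C,S$ be the solutions of $-y''+qy=\mu y$ with $C(0)=S'(0)=1$, $S(0)=C'(0)=0$, and $\varkappa=\frac{C'(\pi)-C(\pi)F(\mu)}{S'(\pi)-S(\pi)F(\mu)}$ (if $F=\infty$, $\varkappa=C(\pi)/S(\pi)$). The function $\gamma(t)=\left(f_\uparrow(\mu)-\varkappa f_\downarrow(\mu)\right)\frac{f_\uparrow(\mu)+tf_\downarrow(\mu)}{\varkappa+t}$ decreases strictly from $+\infty$ to $0$ on $(-\varkappa,-f(\mu))$ (with $-f(\mu)$ read as $+\infty$ if $f=\infty$), so there is a unique $\tau$ in this interval with $\gamma(\tau)=\nu$; $u$ is the solution of $-y''+qy=\mu y$ with $u(0)=1$, $u'(0)=\tau$. On $\widetilde{\mathcal S}_2$: $\Lambda=\mu-2$, $u(x)=\varphi(x,\mu-2)$. On $\widetilde{\mathcal S}_3$: $\Lambda=\mu-2$, $u(x)=\psi(x,\mu-2)$ (with $\varphi,\psi$ those of $\mathscr P(q,f,F)$). Finally $\widetilde{\mathbf T}(\mu,\nu,q,f,F)=(\widetilde q,\widetilde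 f,\widetilde F)$ with $\widetilde q=q-2\left(\frac{u'}{u}\right)'$, $\widetilde f=\boldsymbol\Theta\left(\Lambda,-\frac{u'(0)}{u(0)},f\right)$, $\widetilde F=\boldsymbol\Theta\left(\Lambda,\frac{u'(\pi)}{u(\pi)},F\right)$. *)

theory Defs
  imports
    "HOL-Analysis.Analysis"
    "HOL-Computational_Algebra.Polynomial_Factorial"
begin

text \<open>
  A boundary coefficient is either the symbol \<open>\<infinity>\<close>, encoded as \<open>None\<close>, or an element of the
  field of rational functions in one variable over the reals. Working in this field, rather
  than with functions on the reals, keeps the removable values at the poles out of the way.
\<close>

type_synonym coeff = "real poly fract option"

abbreviation ratc :: "real \<Rightarrow> real poly fract" where
  "ratc c \<equiv> to_fract [:c:]"

text \<open>
  \<open>f(\<lambda>) = h0 \<lambda> + h + (\<Sum>p\<in>P. \<delta> p / (p - \<lambda>))\<close>. The increasing sequence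
  \<open>h\<^sub>1 < \<dots> < h\<^sub>d\<close> of poles is given by the finite set \<open>P\<close>, and \<open>d\<close> is \<open>card P\<close>.
\<close>

definition hn_rep :: "real poly fract \<Rightarrow> real \<Rightarrow> real \<Rightarrow> real set \<Rightarrow> (real \<Rightarrow> real) \<Rightarrow> bool" where
  "hn_rep f h0 h P \<delta> \<longleftrightarrow>
     h0 \<ge> 0 \<and> finite P \<and> (\<forall>p\<in>P. \<delta> p > 0) \<and>
     f = to_fract [:h, h0:] + (\<Sum>p\<in>P. ratc (\<delta> p) / to_fract [:p, -1:])"

definition RR :: "coeff set" where
  "RR = insert None {Some f | f. \<exists>h0 h P \<delta>. hn_rep f h0 h P \<delta>}"

text \<open>
  Slope and pole set are determined by \<open>f\<close>, since partial fraction decompositions are unique.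
\<close>

definition slope :: "real poly fract \<Rightarrow> real" where
  "slope f = (THE h0. \<exists>h P \<delta>. hn_rep f h0 h P \<delta>)"

definition poles :: "real poly fract \<Rightarrow> real set" where
  "poles f = (THE P. \<exists>h0 h \<delta>. hn_rep f h0 h P \<delta>)"

definition ind :: "coeff \<Rightarrow> int" where
  "ind f = (case f of
      None \<Rightarrow> -1
    | Some g \<Rightarrow> 2 * int (card (poles g)) + (if slope g > 0 then 1 else 0))"

definition RR_ind :: "int \<Rightarrow> coeff set" where
  "RR_ind n = {f \<in> RR. ind f = n}"

definition down :: "coeff \<Rightarrow> real poly" where
  "down f = (case f of
      None \<Rightarrow> 0
    | Some g \<Rightarrow> smult (if slope g > 0 then 1 / slope g else 1) (\<Prod>p\<in>poles g. [:p, -1:]))"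

definition up :: "coeff \<Rightarrow> real poly" where
  "up f = (case f of
      None \<Rightarrow> -1
    | Some g \<Rightarrow> (THE p. to_fract p = g * to_fract (down f)))"

text \<open>The value of a rational function at a point that is not a pole.\<close>

definition val :: "real poly fract \<Rightarrow> real \<Rightarrow> real" where
  "val g x = poly (up (Some g)) x / poly (down (Some g)) x"

text \<open>
  The polynomial \<open>f' f\<^sub>\<down>\<^sup>2\<close>, i.e. \<open>f\<^sub>\<up>' f\<^sub>\<down> - f\<^sub>\<up> f\<^sub>\<down>'\<close>.
\<close>

definition deriv_down_sq :: "coeff \<Rightarrow> real poly" where
  "deriv_down_sq f = pderiv (up f) * down f - up f * pderiv (down f)"

text \<open>
  The defining formula of \<open>\<Theta>\<close> makes sense without its side conditions that \<open>\<mu>\<close> lies below the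
  smallest pole of \<open>f\<close> and \<open>\<tau> \<ge> f(\<mu>)\<close>; these hold whenever \<open>\<Theta>\<close> is applied below. The quotient
  is taken in the field of rational functions.
\<close>

definition Theta :: "real \<Rightarrow> real \<Rightarrow> coeff \<Rightarrow> coeff" where
  "Theta \<mu> \<tau> f = (case f of
      None \<Rightarrow> Some (ratc (- \<tau>))
    | Some g \<Rightarrow> if g = ratc \<tau> then None
                else Some (to_fract [:\<mu>, -1:] / (g - ratc \<tau>) - ratc \<tau>))"

text \<open>
  \<open>w\<close> is absolutely continuous on \<open>[0, \<pi>]\<close> and \<open>g\<close> is its derivative almost everywhere.
\<close>

definition has_ac_derivative :: "(real \<Rightarrow> real) \<Rightarrow> (real \<Rightarrow> real) \<Rightarrow> bool" where
  "has_ac_derivative w g \<longleftrightarrow>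
     g absolutely_integrable_on {0..pi} \<and> (\<forall>x\<in>{0..pi}. w x = w 0 + integral {0..x} g)"

text \<open>
  Solutions of \<open>-y'' + q y = \<lambda> y\<close> for integrable \<open>q\<close>: \<open>y\<close> is differentiable on \<open>[0, \<pi>]\<close>
  (one-sidedly at the end points) with absolutely continuous derivative \<open>dy\<close>, and the equation
  holds almost everywhere. Solutions are handled as pairs \<open>(y, dy)\<close>.
\<close>

definition is_solution :: "(real \<Rightarrow> real) \<Rightarrow> real \<Rightarrow> (real \<Rightarrow> real) \<times> (real \<Rightarrow> real) \<Rightarrow> bool" where
  "is_solution q l = (\<lambda>(y, dy).
     (\<forall>x\<in>{0..pi}. (y has_real_derivative dy x) (at x within {0..pi})) \<and>
     (\<exists>ddy. has_ac_derivative dy ddy \<and>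
        (AE x in lebesgue_on {0<..<pi}. - ddy x + q x * y x = l * y x)))"

text \<open>
  The solution with initial values \<open>a\<close>, \<open>b\<close> at \<open>x0 \<in> [0, \<pi>]\<close>. It is unique on \<open>[0, \<pi>]\<close>; the
  choice operator only fixes irrelevant values outside this interval.
\<close>

definition solution_at ::
  "real \<Rightarrow> real \<Rightarrow> real \<Rightarrow> (real \<Rightarrow> real) \<Rightarrow> real \<Rightarrow> (real \<Rightarrow> real) \<times> (real \<Rightarrow> real)" where
  "solution_at x0 a b q l = (SOME s. is_solution q l s \<and> fst s x0 = a \<and> snd s x0 = b)"

definition phi :: "(real \<Rightarrow> real) \<Rightarrow> coeff \<Rightarrow> real \<Rightarrow> (real \<Rightarrow> real) \<times> (real \<Rightarrow> real)" where
  "phi q f l = solution_at 0 (poly (down f) l) (- poly (up f) l) q l"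

definition psi :: "(real \<Rightarrow> real) \<Rightarrow> coeff \<Rightarrow> real \<Rightarrow> (real \<Rightarrow> real) \<times> (real \<Rightarrow> real)" where
  "psi q F l = solution_at pi (poly (down F) l) (poly (up F) l) q l"

type_synonym problem = "(real \<Rightarrow> real) \<times> coeff \<times> coeff"

definition eigenvalue :: "problem \<Rightarrow> real \<Rightarrow> bool" where
  "eigenvalue = (\<lambda>(q, f, F) l.
     \<exists>y dy. is_solution q l (y, dy) \<and> (\<exists>x\<in>{0..pi}. y x \<noteq> 0) \<and>
       poly (down f) l * dy 0 + poly (up f) l * y 0 = 0 \<and>
       poly (down F) l * dy pi - poly (up F) l * y pi = 0)"

definition lowest_ev :: "problem \<Rightarrow> real" where
  "lowest_ev P = (LEAST l. eigenvalue P l)"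

definition beta :: "problem \<Rightarrow> real \<Rightarrow> real" where
  "beta = (\<lambda>(q, f, F) l.
     THE b. b \<noteq> 0 \<and> (\<forall>x\<in>{0..pi}. fst (psi q F l) x = b * fst (phi q f l) x))"

definition norming_const :: "problem \<Rightarrow> real \<Rightarrow> real" where
  "norming_const = (\<lambda>(q, f, F) l.
     integral {0..pi} (\<lambda>x. (fst (phi q f l) x)\<^sup>2)
     + poly (deriv_down_sq f) l
     + 1 / (beta (q, f, F) l)\<^sup>2 * poly (deriv_down_sq F) l)"

definition lowest_nc :: "problem \<Rightarrow> real" where
  "lowest_nc P = norming_const P (lowest_ev P)"

text \<open>
  The common form of both transformations. For zero-free \<open>u\<close> the quotient \<open>du/u\<close> is absolutely
  continuous on \<open>[0, \<pi>]\<close>, so its derivative exists almost everywhere and the new potential is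
  well defined as an element of \<open>L\<^sub>1(0, \<pi>)\<close>.
\<close>

definition darboux :: "real \<Rightarrow> (real \<Rightarrow> real) \<times> (real \<Rightarrow> real) \<Rightarrow> problem \<Rightarrow> problem" where
  "darboux \<Lambda> = (\<lambda>(u, du) (q, f, F).
     (\<lambda>x. q x - 2 * deriv (\<lambda>t. du t / u t) x,
      Theta \<Lambda> (- du 0 / u 0) f,
      Theta \<Lambda> (du pi / u pi) F))"

definition S_hat :: "problem set" where
  "S_hat = {(q, f, F). q absolutely_integrable_on {0<..<pi} \<and> f \<in> RR \<and> F \<in> RR \<and>
              \<not> (f = None \<and> F = None)}"

definition T_hat :: "problem \<Rightarrow> problem" where
  "T_hat = (\<lambda>(q, f, F).
     let \<Lambda> = (if f \<noteq> None \<and> F \<noteq> None then lowest_ev (q, f, F) else lowest_ev (q, f, F) - 2);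
         v = (if f \<noteq> None then phi q f \<Lambda> else psi q F \<Lambda>)
     in darboux \<Lambda> v (q, f, F))"

definition S_tilde1 :: "(real \<times> real \<times> problem) set" where
  "S_tilde1 = {(\<mu>, \<nu>, q, f, F). q absolutely_integrable_on {0<..<pi} \<and> f \<in> RR \<and> F \<in> RR \<and>
                 \<mu> < lowest_ev (q, f, F) \<and> \<nu> > 0}"

definition S_tilde2 :: "(real \<times> real \<times> problem) set" where
  "S_tilde2 = {(\<mu>, \<nu>, q, f, F). q absolutely_integrable_on {0<..<pi} \<and> f \<in> RR \<and> F \<in> RR \<and>
                 f \<in> RR_ind 0 \<and> \<mu> = lowest_ev (q, f, F) \<and> \<nu> = lowest_nc (q, f, F) / 2}"

definition S_tilde3 :: "(real \<times> real \<times> problem) set" where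
  "S_tilde3 = {(\<mu>, \<nu>, q, f, F). q absolutely_integrable_on {0<..<pi} \<and> f \<in> RR \<and> F \<in> RR \<and>
                 F \<in> RR_ind 0 \<and> \<mu> = lowest_ev (q, f, F) \<and> \<nu> = 2 * lowest_nc (q, f, F)}"

definition S_tilde :: "(real \<times> real \<times> problem) set" where
  "S_tilde = S_tilde1 \<union> S_tilde2 \<union> S_tilde3"

definition kappa :: "real \<Rightarrow> (real \<Rightarrow> real) \<Rightarrow> coeff \<Rightarrow> real" where
  "kappa \<mu> q F =
     (let (C, dC) = solution_at 0 1 0 q \<mu>;
          (S, dS) = solution_at 0 0 1 q \<mu>
      in case F of
           None \<Rightarrow> C pi / S pi
         | Some G \<Rightarrow> (dC pi - C pi * val G \<mu>) / (dS pi - S pi * val G \<mu>))"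

definition gamma_fun :: "real \<Rightarrow> problem \<Rightarrow> real \<Rightarrow> real" where
  "gamma_fun \<mu> = (\<lambda>(q, f, F) t.
     (poly (up f) \<mu> - kappa \<mu> q F * poly (down f) \<mu>) *
     ((poly (up f) \<mu> + t * poly (down f) \<mu>) / (kappa \<mu> q F + t)))"

definition tau :: "real \<Rightarrow> real \<Rightarrow> problem \<Rightarrow> real" where
  "tau \<mu> \<nu> = (\<lambda>(q, f, F).
     THE t. - kappa \<mu> q F < t \<and> (case f of None \<Rightarrow> True | Some g \<Rightarrow> t < - val g \<mu>) \<and>
            gamma_fun \<mu> (q, f, F) t = \<nu>)"

text \<open>
  The three parts of the domain are disjoint (norming constants are positive), so the order of
  the cases below is immaterial.
\<close>

definition T_tilde :: "real \<times> real \<times> problem \<Rightarrow> problem" where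
  "T_tilde = (\<lambda>(\<mu>, \<nu>, q, f, F).
     if (\<mu>, \<nu>, q, f, F) \<in> S_tilde1 then
       darboux \<mu> (solution_at 0 1 (tau \<mu> \<nu> (q, f, F)) q \<mu>) (q, f, F)
     else if (\<mu>, \<nu>, q, f, F) \<in> S_tilde2 then
       darboux (\<mu> - 2) (phi q f (\<mu> - 2)) (q, f, F)
     else
       darboux (\<mu> - 2) (psi q F (\<mu> - 2)) (q, f, F))"

text \<open>Equality of triples, with potentials compared as elements of \<open>L\<^sub>1(0, \<pi>)\<close>.\<close>

definition same_problem :: "problem \<Rightarrow> problem \<Rightarrow> bool" where
  "same_problem = (\<lambda>(q1, f1, F1) (q2, f2, F2).
     (AE x in lebesgue_on {0<..<pi}. q1 x = q2 x) \<and> f1 = f2 \<and> F1 = F2)"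

end

theory Submission
  imports Defs "HOL-Computational_Algebra.Fundamental_Theorem_Algebra"
begin

text \<open>
  Both transformations are Darboux transformations \<open>q \<mapsto> q - 2 (u'/u)'\<close> with a zero-free solution
  \<open>u\<close>, and \<open>1/u\<close> solves the transformed equation, so that the transformation generated by \<open>1/u\<close>
  leads back; on the boundary coefficients, \<open>\<Theta>(\<Lambda>, -\<tau>, \<cdot>)\<close> inverts \<open>\<Theta>(\<Lambda>, \<tau>, \<cdot>)\<close>. It remains to
  recognise in each case the function that generates the second transformation as a multiple of \<open>1/u\<close>,
  i.e. to find the lowest eigenvalue and norming constant of the transformed problem. Below the poles
  of the coefficients the lowest eigenvalue is characterised by an eigenfunction without interior
  zeros. If \<open>\<Lambda>\<close> lies below it, \<open>W(y, u)/u\<close> is such an eigenfunction of the transformed problem,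
  and the norming constant is multiplied or divided by \<open>\<lambda>\<^sub>0 - \<Lambda>\<close>. If \<open>\<Lambda> = \<lambda>\<^sub>0\<close>, the solutions at
  \<open>\<Lambda>\<close> of the transformed equation are \<open>(c + \<integral> u\<^sup>2)/u\<close>, from which \<open>\<tau>\<close> is computed.
\<close>

section \<open>Rational functions of Herglotz type\<close>

text \<open>The obstacle is that \<open>q\<close> is merely integrable and \<open>f\<close>,
  \<open>F\<close> may have poles, so even the existence of the minimum behind
  \<open>lowest_ev\<close> has to be produced. It is obtained as the supremum of the parameters at
  which \<phi> is positive on (0, \<pi>] and the right boundary form is positive; this supremum is
  shown to lie left of all poles. On the normalised pair (\<open>up\<close>, \<open>down\<close>)
  the transformation \<Theta> acts by exact formulas: \<tau> > f(\<mu>) raises the index by one,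
  \<tau> = f(\<mu>) lowers it by one, and no unknown scaling factor enters the norming constants.
  The number 2 comes from the Dirichlet case: there the eigenfunction vanishes at an end point, so
  the transformation is made at \<lambda>_0 - 2 instead and \<lambda>_0 survives as an eigenvalue.
  The norming constant then doubles if the left condition was Dirichlet and is halved if the right
  one was, which is the mark by which \<open>S_tilde2\<close> and \<open>S_tilde3\<close> are
  recognised on the way back.\<close>

definition node_poly :: "real set \<Rightarrow> real poly" where
  "node_poly P = (\<Prod>p\<in>P. [:p, -1:])"

text \<open>The numerator of h0 \<lambda> + h + \<Sum> \<delta>_p / (p - \<lambda>) over the
  denominator \<open>smult c (node_poly P)\<close>. The factor \<open>c\<close> is carried along
  because \<open>down\<close> is normalised by 1/h0; with that \<open>c\<close> this polynomial is
  \<open>up\<close>.\<close>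

definition num_poly :: "real \<Rightarrow> real \<Rightarrow> real \<Rightarrow> real set \<Rightarrow> (real \<Rightarrow> real) \<Rightarrow> real poly" where
  "num_poly c h0 h P \<delta> =
     [:h, h0:] * smult c (node_poly P) + (\<Sum>p\<in>P. smult (c * \<delta> p) (node_poly (P - {p})))"

lemma poly_node_poly: "poly (node_poly P) x = (\<Prod>p\<in>P. p - x)"
  by (simp add: node_poly_def poly_prod)

lemma node_poly_nz: "finite P \<Longrightarrow> node_poly P \<noteq> 0"
  by (simp add: node_poly_def)

lemma poly_node_poly_eq_0_iff: "finite P \<Longrightarrow> poly (node_poly P) x = 0 \<longleftrightarrow> x \<in> P"
  by (auto simp: poly_node_poly)

lemma node_poly_remove: "finite P \<Longrightarrow> p \<in> P \<Longrightarrow> node_poly P = [:p, -1:] * node_poly (P - {p})"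
  unfolding node_poly_def by (simp add: prod.remove)

lemma poly_pderiv_node_poly:
  assumes "finite P" "p \<in> P"
  shows "poly (pderiv (node_poly P)) p = - poly (node_poly (P - {p})) p"
  by (subst node_poly_remove[OF assms]) (simp add: pderiv_mult pderiv_pCons del: mult_pCons_left)

lemma poly_node_poly_pos: "(\<And>p. p \<in> P \<Longrightarrow> x < p) \<Longrightarrow> poly (node_poly P) x > 0"
  by (auto simp: poly_node_poly intro!: prod_pos)

lemma degree_node_poly: "finite P \<Longrightarrow> degree (node_poly P) = card P"
  unfolding node_poly_def by (subst degree_prod_eq_sum_degree) auto

lemma lead_coeff_node_poly: "finite P \<Longrightarrow> coeff (node_poly P) (card P) = (- 1) ^ card P"
proof -
  assume "finite P"
  have "lead_coeff (node_poly P) = (- 1) ^ card P"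
    unfolding node_poly_def lead_coeff_prod by simp
  then show ?thesis using degree_node_poly[OF \<open>finite P\<close>] by simp
qed

lemma hn_rep_mult_node_poly:
  assumes "hn_rep g h0 h P \<delta>"
  shows "g * to_fract (smult c (node_poly P)) = to_fract (num_poly c h0 h P \<delta>)"
proof -
  have fin: "finite P" and g: "g = to_fract [:h, h0:] + (\<Sum>p\<in>P. ratc (\<delta> p) / to_fract [:p, -1:])"
    using assms by (auto simp: hn_rep_def)
  have "ratc (\<delta> p) / to_fract [:p, -1:] * to_fract (smult c (node_poly P))
        = to_fract (smult (c * \<delta> p) (node_poly (P - {p})))" if "p \<in> P" for p
  proof -
    have "smult c (node_poly P) = [:p, -1:] * smult c (node_poly (P - {p}))"
      using node_poly_remove[OF fin that] by simp
    then have "ratc (\<delta> p) / to_fract [:p, -1:] * to_fract (smult c (node_poly P))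
       = ratc (\<delta> p) * to_fract (smult c (node_poly (P - {p})))"
      by (simp only: to_fract_mult) simp
    also have "\<dots> = to_fract ([:\<delta> p:] * smult c (node_poly (P - {p})))"
      by (simp only: to_fract_mult)
    finally show ?thesis by (simp add: mult.commute)
  qed
  then have "(\<Sum>p\<in>P. ratc (\<delta> p) / to_fract [:p, -1:]) * to_fract (smult c (node_poly P))
        = (\<Sum>p\<in>P. to_fract (smult (c * \<delta> p) (node_poly (P - {p}))))"
    by (simp add: sum_distrib_right)
  then show ?thesis
    unfolding g num_poly_def by (simp only: distrib_right to_fract_add to_fract_mult to_fract_sum)
qed

lemma poly_num_poly_node:
  assumes "finite P" "p \<in> P"
  shows "poly (num_poly c h0 h P \<delta>) p = c * \<delta> p * poly (node_poly (P - {p})) p"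
proof -
  have "(\<Sum>r\<in>P. c * \<delta> r * poly (node_poly (P - {r})) p) = (\<Sum>r\<in>P. if r = p then c * \<delta> p * poly (node_poly (P - {p})) p else 0)"
    using assms by (intro sum.cong) (auto simp: poly_node_poly_eq_0_iff)
  moreover have "poly (node_poly P) p = 0" using assms by (simp add: poly_node_poly_eq_0_iff)
  ultimately show ?thesis using assms by (simp add: num_poly_def poly_sum)
qed

lemma coeff_num_poly_Suc:
  assumes "finite P"
  shows "coeff (num_poly c h0 h P \<delta>) (Suc (card P)) = c * h0 * (- 1) ^ card P"
proof -
  have 1: "coeff (node_poly P) (Suc (card P)) = 0"
    using assms by (intro coeff_eq_0) (simp add: degree_node_poly)
  have 2: "coeff (node_poly (P - {p})) (Suc (card P)) = 0" if "p \<in> P" for p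
    using assms that by (intro coeff_eq_0) (auto simp: degree_node_poly)
  show ?thesis
    using assms by (simp add: num_poly_def coeff_sum 1 2 lead_coeff_node_poly)
qed

lemma coeff_num_poly_card:
  assumes "finite P"
  shows "coeff (num_poly c 0 h P \<delta>) (card P) = c * h * (- 1) ^ card P"
proof -
  have 2: "coeff (node_poly (P - {p})) (card P) = 0" if "p \<in> P" for p
  proof -
    have "card P > 0" using that assms by (metis card_gt_0_iff empty_iff)
    then show ?thesis using assms that by (intro coeff_eq_0) (auto simp: degree_node_poly)
  qed
  show ?thesis
    using assms by (simp add: num_poly_def coeff_sum 2 lead_coeff_node_poly)
qed

lemma degree_num_poly:
  assumes "finite P"
  shows "degree (num_poly c h0 h P \<delta>) \<le> Suc (card P)"
proof -
  have "degree ([:h, h0:] * smult c (node_poly P)) \<le> degree [:h, h0:] + degree (smult c (node_poly P))"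
    by (rule degree_mult_le)
  also have "\<dots> \<le> Suc (card P)"
    using degree_smult_le[of c "node_poly P"] assms
    by (auto simp: degree_node_poly degree_pCons_eq_if split: if_splits)
  finally have 1: "degree ([:h, h0:] * smult c (node_poly P)) \<le> Suc (card P)" .
  have 2: "degree (\<Sum>p\<in>P. smult (c * \<delta> p) (node_poly (P - {p}))) \<le> Suc (card P)"
  proof (rule degree_sum_le[OF assms])
    fix p assume "p \<in> P"
    have "degree (smult (c * \<delta> p) (node_poly (P - {p}))) \<le> card (P - {p})"
      using degree_smult_le[of "c * \<delta> p" "node_poly (P - {p})"] assms by (simp add: degree_node_poly)
    also have "\<dots> \<le> Suc (card P)" by (simp add: card_Diff1_le le_SucI)
    finally show "degree (smult (c * \<delta> p) (node_poly (P - {p}))) \<le> Suc (card P)" .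
  qed
  show ?thesis unfolding num_poly_def using 1 2 by (rule degree_add_le)
qed

text \<open>The right-hand side does not mention the representation: it collects the points where
  every denominator of \<open>g\<close> vanishes. At a node the numerator is \<delta>_p times a
  nonzero product, so nothing cancels; elsewhere \<open>node_poly P\<close> itself is a denominator
  without zero.\<close>

lemma hn_rep_poles:
  assumes "hn_rep g h0 h P \<delta>"
  shows "P = {x. \<forall>a b. b \<noteq> 0 \<longrightarrow> g * to_fract b = to_fract a \<longrightarrow> poly b x = 0}"
proof (rule set_eqI)
  fix x
  have fin: "finite P" and \<delta>: "\<And>p. p \<in> P \<Longrightarrow> \<delta> p > 0" using assms by (auto simp: hn_rep_def)
  have gD: "g * to_fract (node_poly P) = to_fract (num_poly 1 h0 h P \<delta>)"
    using hn_rep_mult_node_poly[OF assms, of 1] by simp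
  show "x \<in> P \<longleftrightarrow> x \<in> {x. \<forall>a b. b \<noteq> 0 \<longrightarrow> g * to_fract b = to_fract a \<longrightarrow> poly b x = 0}"
  proof (cases "x \<in> P")
    case True
    have "poly b x = 0" if "g * to_fract b = to_fract a" for a b
    proof -
      have "to_fract (num_poly 1 h0 h P \<delta> * b) = to_fract (a * node_poly P)"
        using gD that by (simp flip: gD that)
      then have "poly (num_poly 1 h0 h P \<delta>) x * poly b x = poly a x * poly (node_poly P) x"
        by (metis to_fract_eq_iff poly_mult)
      then show ?thesis
        using True fin \<delta>[OF True] poly_node_poly_eq_0_iff[OF fin, of x]
          poly_node_poly_eq_0_iff[of "P - {x}" x]
        by (auto simp: poly_num_poly_node)
    qed
    then show ?thesis using True by blast
  next
    case False
    then show ?thesis using gD node_poly_nz[OF fin] poly_node_poly_eq_0_iff[OF fin] by blast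
  qed
qed

text \<open>The pole set has an intrinsic description, and the slope is read off from the
  coefficient of degree \<open>card P + 1\<close> of the numerator. This makes the definite
  descriptions \<open>slope\<close> and \<open>poles\<close> computable.\<close>

lemma hn_rep_unique:
  assumes "hn_rep g h0 h P \<delta>" "hn_rep g h0' h' P' \<delta>'"
  shows "P' = P" "h0' = h0"
proof -
  show P: "P' = P" using hn_rep_poles[OF assms(1)] hn_rep_poles[OF assms(2)] by simp
  have fin: "finite P" using assms by (simp add: hn_rep_def)
  have "num_poly 1 h0 h P \<delta> = num_poly 1 h0' h' P \<delta>'"
    using hn_rep_mult_node_poly[OF assms(1), of 1] hn_rep_mult_node_poly[OF assms(2), of 1] P by simp
  from arg_cong[OF this, of "\<lambda>p. coeff p (Suc (card P))"] show "h0' = h0"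
    by (simp add: coeff_num_poly_Suc fin)
qed

lemma hn_rep_slope: "hn_rep g h0 h P \<delta> \<Longrightarrow> slope g = h0"
  unfolding slope_def by (rule the_equality) (use hn_rep_unique in \<open>blast+\<close>)

lemma hn_rep_poles_eq: "hn_rep g h0 h P \<delta> \<Longrightarrow> poles g = P"
  unfolding poles_def by (rule the_equality) (use hn_rep_unique in \<open>blast+\<close>)

lemma up_Some_eqI:
  assumes "g * to_fract (down (Some g)) = to_fract u"
  shows "up (Some g) = u"
  unfolding up_def by (simp add: assms)

lemma hn_rep_down_up:
  assumes "hn_rep g h0 h P \<delta>" "c = (if h0 > 0 then 1 / h0 else 1)"
  shows "down (Some g) = smult c (node_poly P)" "up (Some g) = num_poly c h0 h P \<delta>"
proof -
  show d: "down (Some g) = smult c (node_poly P)"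
    using assms by (simp add: down_def hn_rep_slope hn_rep_poles_eq node_poly_def)
  show "up (Some g) = num_poly c h0 h P \<delta>"
    using hn_rep_mult_node_poly[OF assms(1), of c] by (intro up_Some_eqI) (simp add: d)
qed

lemma RR_SomeE:
  assumes "Some g \<in> RR"
  obtains c h0 h P \<delta> where "hn_rep g h0 h P \<delta>" "finite P" "h0 \<ge> 0" "\<And>p. p \<in> P \<Longrightarrow> \<delta> p > 0"
    "c > 0" "c = (if h0 > 0 then 1 / h0 else 1)" "poles g = P" "slope g = h0"
    "down (Some g) = smult c (node_poly P)" "up (Some g) = num_poly c h0 h P \<delta>"
proof -
  obtain h0 h P \<delta> where r: "hn_rep g h0 h P \<delta>" using assms by (auto simp: RR_def)
  have a: "finite P" "h0 \<ge> 0" "\<And>p. p \<in> P \<Longrightarrow> \<delta> p > 0" using r by (auto simp: hn_rep_def)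
  have c: "(if h0 > 0 then 1 / h0 else 1) > 0" by simp
  show thesis
    by (rule that[OF r a c refl hn_rep_poles_eq[OF r] hn_rep_slope[OF r] hn_rep_down_up[OF r refl]])
qed

text \<open>Partial fractions: D = \<open>smult c (node_poly Z)\<close> has simple zeros, so the
  coefficient at p is -U(p)/D'(p), positive by \<open>pos\<close>. The alternatives in
  \<open>norm\<close> say that the slope is 0 with c = 1, or that it is 1/c; then U and D are
  exactly \<open>up\<close> and \<open>down\<close>.\<close>

lemma RR_SomeI:
  assumes Z: "finite Z" and c: "c > 0" and deg: "degree U \<le> Suc (card Z)"
    and norm: "coeff U (Suc (card Z)) = 0 \<and> c = 1 \<or> (- 1) ^ card Z * coeff U (Suc (card Z)) = 1"
    and pos: "\<And>p. p \<in> Z \<Longrightarrow> poly U p * poly (pderiv (smult c (node_poly Z))) p < 0"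
    and g: "g = to_fract U / to_fract (smult c (node_poly Z))"
  shows "Some g \<in> RR" "up (Some g) = U" "down (Some g) = smult c (node_poly Z)" "poles g = Z"
proof -
  define D where "D = smult c (node_poly Z)"
  define n where "n = card Z"
  \<comment> \<open>\<open>h0\<close> and \<open>h\<close> are chosen to remove the coefficients of
    degree n + 1 and n from \<open>U\<close>, so that the remainder \<open>R\<close> has degree
    below n.\<close>
  define h0 where "h0 = coeff U (Suc n) * (- 1) ^ n / c"
  define U1 where "U1 = U - [:0, h0:] * D"
  define h where "h = coeff U1 n * (- 1) ^ n / c"
  define R where "R = U - [:h, h0:] * D"
  define \<delta> where "\<delta> p = poly U p / (c * poly (node_poly (Z - {p})) p)" for p
  have sgn1: "(- 1) ^ n * (- 1) ^ n = (1::real)" by (metis mult_minus1 neg_equal_iff_equal power_mult_distrib power_one minus_mult_minus mult_1)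
  have Dn: "coeff D n = c * (- 1) ^ n" and degD: "degree D = n" and Dz: "D \<noteq> 0"
    using Z c by (simp_all add: D_def n_def lead_coeff_node_poly degree_node_poly node_poly_nz)
  have DSn: "coeff D k = 0" if "k > n" for k using degD that by (simp add: coeff_eq_0)
  have nZ: "poly (node_poly (Z - {p})) p \<noteq> 0" if "p \<in> Z" for p
    using Z by (simp add: poly_node_poly_eq_0_iff)
  have h0c: "h0 * coeff D n = coeff U (Suc n)" using c sgn1 by (simp add: h0_def Dn)
  have hc: "h * coeff D n = coeff U1 n" using c sgn1 by (simp add: h_def Dn)
  have U1S: "coeff U1 (Suc n) = 0" unfolding U1_def using h0c by simp
  have RU1: "R = U1 - smult h D" by (simp add: R_def U1_def algebra_simps)
  have Rk: "coeff R k = 0" if "k \<ge> n" for k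
  proof -
    consider "k = n" | "k = Suc n" | "k > Suc n" using \<open>k \<ge> n\<close> by linarith
    then show ?thesis
    proof cases
      case 1 then show ?thesis using hc by (simp add: RU1)
    next
      case 2 then show ?thesis using U1S by (simp add: RU1 DSn)
    next
      case 3
      then obtain j where j: "k = Suc j" "j > n" by (metis Suc_less_eq2)
      have "coeff U k = 0" using deg 3 by (intro coeff_eq_0) (simp add: n_def)
      then show ?thesis using j by (simp add: R_def DSn)
    qed
  qed
  have Dp: "poly (pderiv D) p = - (c * poly (node_poly (Z - {p})) p)" if "p \<in> Z" for p
    unfolding D_def by (simp add: pderiv_smult poly_pderiv_node_poly[OF Z that])
  have \<delta>pos: "\<delta> p > 0" if "p \<in> Z" for p
    using pos[OF that] Dp[OF that] by (simp add: \<delta>_def D_def zero_less_mult_iff zero_less_divide_iff)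
  have R: "R = (\<Sum>p\<in>Z. smult (c * \<delta> p) (node_poly (Z - {p})))" (is "R = ?S")
  proof (cases "n = 0")
    case True
    then have "Z = {}" using Z by (simp add: n_def)
    then show ?thesis using Rk True by (simp add: poly_eq_iff)
  next
    case False
    \<comment> \<open>Both sides have degree below n and agree at the n nodes.\<close>
    show ?thesis
    proof (rule poly_eqI_degree[where A = Z])
      fix x assume x: "x \<in> Z"
      have "poly ?S x = poly (num_poly c 0 0 Z \<delta>) x" by (simp add: num_poly_def)
      also have "\<dots> = c * \<delta> x * poly (node_poly (Z - {x})) x" by (rule poly_num_poly_node[OF Z x])
      also have "\<dots> = poly U x" using nZ[OF x] c by (simp add: \<delta>_def)
      finally show "poly R x = poly ?S x"
        using poly_node_poly_eq_0_iff[OF Z, of x] x by (simp add: R_def D_def)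
    next
      have "degree R \<le> n - 1" using Rk False by (intro degree_le) auto
      then show "degree R < card Z" using False by (simp add: n_def)
      have "degree ?S \<le> n - 1"
      proof (rule degree_sum_le[OF Z])
        fix p assume "p \<in> Z"
        have "degree (smult (c * \<delta> p) (node_poly (Z - {p}))) \<le> degree (node_poly (Z - {p}))"
          by (rule degree_smult_le)
        then show "degree (smult (c * \<delta> p) (node_poly (Z - {p}))) \<le> n - 1"
          using \<open>p \<in> Z\<close> Z by (simp add: degree_node_poly n_def)
      qed
      then show "degree ?S < card Z" using False by (simp add: n_def)
    qed
  qed
  have U: "U = num_poly c h0 h Z \<delta>" using R unfolding num_poly_def R_def D_def by (simp add: algebra_simps)
  have h0nn: "h0 \<ge> 0" and h0n: "c = (if h0 > 0 then 1 / h0 else 1)"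
    using norm c by (auto simp: h0_def n_def field_simps)
  define g' where "g' = to_fract [:h, h0:] + (\<Sum>p\<in>Z. ratc (\<delta> p) / to_fract [:p, -1:])"
  have r: "hn_rep g' h0 h Z \<delta>" using h0nn Z \<delta>pos by (simp add: hn_rep_def g'_def)
  have "g' * to_fract D = to_fract U" using hn_rep_mult_node_poly[OF r, of c] U by (simp add: D_def)
  then have "g' = g" using g Dz unfolding D_def by (metis nonzero_eq_divide_eq to_fract_eq_0_iff)
  with r have r: "hn_rep g h0 h Z \<delta>" by simp
  show "Some g \<in> RR" using r by (auto simp: RR_def)
  show "up (Some g) = U" "down (Some g) = smult c (node_poly Z)"
    using hn_rep_down_up[OF r h0n] U by auto
  show "poles g = Z" using hn_rep_poles_eq[OF r] .
qed


section \<open>Complex evaluation, kernel identities and polynomials with real zeros\<close>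

definition cev :: "real poly \<Rightarrow> complex \<Rightarrow> complex" where
  "cev p z = poly (map_poly complex_of_real p) z"

lemma cev_0 [simp]: "cev 0 z = 0"
  by (simp add: cev_def)

lemma cev_pCons [simp]: "cev (pCons a p) z = of_real a + z * cev p z"
  by (simp add: cev_def map_poly_pCons)

lemma cev_add [simp]: "cev (p + q) z = cev p z + cev q z"
  by (induction p q rule: poly_induct2) (simp_all add: algebra_simps)

lemma cev_smult [simp]: "cev (smult a p) z = of_real a * cev p z"
  by (induction p) (simp_all add: algebra_simps)

lemma cev_minus [simp]: "cev (- p) z = - cev p z"
  using cev_smult[of "-1" p z] by simp

lemma cev_diff [simp]: "cev (p - q) z = cev p z - cev q z"
  using cev_add[of p "- q" z] by simp

lemma cev_mult [simp]: "cev (p * q) z = cev p z * cev q z"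
  by (induction p) (simp_all add: algebra_simps)

lemma cev_sum [simp]: "cev (\<Sum>i\<in>A. f i) z = (\<Sum>i\<in>A. cev (f i) z)"
  by (induction A rule: infinite_finite_induct) simp_all

lemma cev_cnj: "cev p (cnj z) = cnj (cev p z)"
  by (induction p) simp_all

lemma cev_of_real: "cev p (of_real x) = of_real (poly p x)"
  by (induction p) simp_all

text \<open>Cleared of denominators this is (f(z) - f(w)) / (z - w) = h0 + \<Sum> \<delta>_p / ((p -
  z) (p - w)). For w conjugate to z the bracket is a sum of nonnegative terms, and likewise for real
  arguments left of all poles: hence both the reality of zeros and the monotonicity of f.\<close>

lemma kernel_identity_complex:
  fixes P :: "real set" and c h0 h :: real and \<delta> :: "real \<Rightarrow> real"
  assumes "finite P"
  defines "D \<equiv> smult c (node_poly P)" and "U \<equiv> num_poly c h0 h P \<delta>"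
  shows "cev U z * cev D w - cev U w * cev D z = (z - w) * (of_real h0 * cev D z * cev D w
    + (\<Sum>p\<in>P. of_real (c\<^sup>2 * \<delta> p) * cev (node_poly (P - {p})) z * cev (node_poly (P - {p})) w))"
proof -
  define N where "N p = node_poly (P - {p})" for p
  have D: "cev D v = of_real c * (of_real p - v) * cev (N p) v" if "p \<in> P" for p v
    unfolding D_def N_def using node_poly_remove[OF assms(1) that] by (simp add: algebra_simps)
  have U: "cev U v = (of_real h + v * of_real h0) * cev D v + (\<Sum>p\<in>P. of_real (c * \<delta> p) * cev (N p) v)" for v
    unfolding U_def num_poly_def D_def[symmetric] N_def by (simp add: algebra_simps)
  have "(\<Sum>p\<in>P. of_real (c * \<delta> p) * cev (N p) z) * cev D w - (\<Sum>p\<in>P. of_real (c * \<delta> p) * cev (N p) w) * cev D z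
     = (\<Sum>p\<in>P. (z - w) * (of_real (c\<^sup>2 * \<delta> p) * cev (N p) z * cev (N p) w))"
    unfolding sum_distrib_right sum_subtractf[symmetric]
    by (intro sum.cong refl) (simp add: D power2_eq_square algebra_simps)
  also have "\<dots> = (z - w) * (\<Sum>p\<in>P. of_real (c\<^sup>2 * \<delta> p) * cev (N p) z * cev (N p) w)"
    by (simp add: sum_distrib_left)
  finally have S: "(\<Sum>p\<in>P. of_real (c * \<delta> p) * cev (N p) z) * cev D w = (\<Sum>p\<in>P. of_real (c * \<delta> p) * cev (N p) w) * cev D z
     + (z - w) * (\<Sum>p\<in>P. of_real (c\<^sup>2 * \<delta> p) * cev (N p) z * cev (N p) w)" by (simp add: algebra_simps)
  show ?thesis unfolding N_def[symmetric] U distrib_right S by (simp add: algebra_simps)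
qed

lemma kernel_identity:
  fixes P :: "real set" and c h0 h :: real and \<delta> :: "real \<Rightarrow> real"
  assumes "finite P"
  defines "D \<equiv> smult c (node_poly P)" and "U \<equiv> num_poly c h0 h P \<delta>"
  shows "poly U x * poly D y - poly U y * poly D x = (x - y) * (h0 * poly D x * poly D y
    + (\<Sum>p\<in>P. c\<^sup>2 * \<delta> p * poly (node_poly (P - {p})) x * poly (node_poly (P - {p})) y))"
proof -
  have "complex_of_real (poly U x * poly D y - poly U y * poly D x) = of_real ((x - y) * (h0 * poly D x * poly D y
    + (\<Sum>p\<in>P. c\<^sup>2 * \<delta> p * poly (node_poly (P - {p})) x * poly (node_poly (P - {p})) y)))"
    using kernel_identity_complex[OF assms(1), of c h0 h \<delta> "of_real x" "of_real y"]
    by (simp add: cev_of_real flip: D_def U_def)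
  then show ?thesis using of_real_eq_iff by blast
qed

text \<open>The diagonal case of the kernel identity: f' = h0 + \<Sum> \<delta>_p / (p -
  \<lambda>)^2, multiplied by the square of \<open>D\<close>. As an identity of polynomials it also
  holds at the poles.\<close>

lemma wronskian_identity:
  fixes P :: "real set" and c h0 h :: real and \<delta> :: "real \<Rightarrow> real"
  assumes "finite P"
  defines "D \<equiv> smult c (node_poly P)" and "U \<equiv> num_poly c h0 h P \<delta>"
  shows "pderiv U * D - U * pderiv D =
    smult h0 (D\<^sup>2) + (\<Sum>p\<in>P. smult (c\<^sup>2 * \<delta> p) ((node_poly (P - {p}))\<^sup>2))"
proof -
  define N where "N p = node_poly (P - {p})" for p
  have D: "D = [:p, -1:] * smult c (N p)" if "p \<in> P" for p
    unfolding D_def N_def using node_poly_remove[OF assms(1) that] by simp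
  have U: "U = [:h, h0:] * D + (\<Sum>p\<in>P. smult (c * \<delta> p) (N p))"
    by (simp add: U_def num_poly_def D_def N_def)
  have pderiv_sum: "pderiv (\<Sum>i\<in>A. f i) = (\<Sum>i\<in>A. pderiv (f i))" for A :: "real set" and f :: "real \<Rightarrow> real poly"
    by (induction A rule: infinite_finite_induct) (simp_all add: pderiv_add)
  have U': "pderiv U = smult h0 D + [:h, h0:] * pderiv D + (\<Sum>p\<in>P. smult (c * \<delta> p) (pderiv (N p)))"
    unfolding U pderiv_add pderiv_mult pderiv_sum by (simp add: pderiv_smult pderiv_pCons)
  have "smult (c * \<delta> p) (pderiv (N p)) * D - smult (c * \<delta> p) (N p) * pderiv D = smult (c\<^sup>2 * \<delta> p) ((N p)\<^sup>2)"
    if p: "p \<in> P" for p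
  proof -
    have D': "pderiv D = [:p, -1:] * smult c (pderiv (N p)) - smult c (N p)"
      unfolding D[OF p] pderiv_mult by (simp add: pderiv_smult pderiv_pCons)
    have Dx: "poly D x = (p - x) * (c * poly (N p) x)" for x
      by (subst D[OF p]) (simp add: algebra_simps)
    have Dx': "poly (pderiv D) x = (p - x) * (c * poly (pderiv (N p)) x) - c * poly (N p) x" for x
      by (subst D') (simp add: algebra_simps)
    show ?thesis
      unfolding poly_eq_poly_eq_iff[symmetric]
      by (rule ext) (simp add: Dx Dx' power2_eq_square algebra_simps)
  qed
  then have "(\<Sum>p\<in>P. smult (c * \<delta> p) (pderiv (N p))) * D - (\<Sum>p\<in>P. smult (c * \<delta> p) (N p)) * pderiv D
    = (\<Sum>p\<in>P. smult (c\<^sup>2 * \<delta> p) ((N p)\<^sup>2))"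
    by (simp add: sum_distrib_right flip: sum_subtractf del: mult_smult_left mult_smult_right)
  then have S: "(\<Sum>p\<in>P. smult (c * \<delta> p) (pderiv (N p))) * D = (\<Sum>p\<in>P. smult (c * \<delta> p) (N p)) * pderiv D
    + (\<Sum>p\<in>P. smult (c\<^sup>2 * \<delta> p) ((N p)\<^sup>2))" by (simp add: algebra_simps)
  show ?thesis unfolding N_def[symmetric] U' distrib_right S
    by (subst U) (simp only: power2_eq_square algebra_simps mult_smult_left mult_smult_right)
qed

lemma node_poly_dvd:
  assumes "finite Z" "\<And>x. x \<in> Z \<Longrightarrow> poly p x = 0"
  shows "node_poly Z dvd p"
  using assms
proof (induction Z arbitrary: p rule: finite_induct)
  case empty then show ?case by (simp add: node_poly_def)
next
  case (insert z Z)
  have "[:-z, 1:] dvd p" using insert.prems by (simp add: poly_eq_0_iff_dvd[symmetric])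
  moreover have "[:z, -1:] = - [:-z, 1:]" by simp
  ultimately have "[:z, -1:] dvd p" by (simp only: minus_dvd_iff)
  then obtain q where q: "p = [:z, -1:] * q" by (auto simp: dvd_def)
  have "poly q x = 0" if "x \<in> Z" for x
    using insert.prems[of x] insert.hyps that by (auto simp: q)
  then have "node_poly Z dvd q" by (rule insert.IH)
  moreover have "node_poly (insert z Z) = [:z, -1:] * node_poly Z"
    using insert.hyps by (simp add: node_poly_def)
  ultimately show ?case by (simp add: q mult_dvd_mono del: mult_pCons_left)
qed

text \<open>Dividing out the distinct real zeros leaves a factor \<open>r\<close> without real
  zeros, because such a zero would be a double zero of \<open>p\<close>. A nonconstant
  \<open>r\<close> would have a complex zero, which is real by assumption.\<close>

lemma real_simple_roots_split:
  assumes nz: "p \<noteq> 0" and re: "\<And>z. cev p z = 0 \<Longrightarrow> Im z = 0"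
    and simple: "\<And>x. poly p x = 0 \<Longrightarrow> poly (pderiv p) x \<noteq> 0"
  obtains k where "k \<noteq> 0" "p = smult k (node_poly {x. poly p x = 0})"
proof -
  define Z where "Z = {x. poly p x = 0}"
  have fin: "finite Z" unfolding Z_def by (rule poly_roots_finite[OF nz])
  have "node_poly Z dvd p" by (rule node_poly_dvd[OF fin]) (simp add: Z_def)
  then obtain r where r: "p = node_poly Z * r" by (auto simp: dvd_def)
  have no_real: "poly r x \<noteq> 0" for x
  proof
    assume rx: "poly r x = 0"
    have "poly p x = poly (node_poly Z) x * poly r x" by (metis r poly_mult)
    then have "x \<in> Z" using rx unfolding Z_def by simp
    then have "poly (node_poly Z) x = 0" using poly_node_poly_eq_0_iff[OF fin] by blast
    then have "poly (pderiv p) x = 0" using rx by (simp add: r pderiv_mult)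
    moreover have "poly p x = 0" using rx by (simp add: r)
    ultimately show False using simple by blast
  qed
  have "degree r = 0"
  proof (rule ccontr)
    assume "degree r \<noteq> 0"
    then have "\<not> constant (poly (map_poly complex_of_real r))"
      by (simp add: constant_degree degree_map_poly)
    then obtain z where z: "cev r z = 0"
      using fundamental_theorem_of_algebra by (auto simp: cev_def)
    then have "cev p z = 0" by (simp add: r)
    then have "Im z = 0" by (rule re)
    then obtain x where "z = of_real x" by (metis complex_is_Real_iff Reals_cases)
    then have "poly r x = 0" using z by (simp add: cev_of_real)
    then show False using no_real by blast
  qed
  then obtain k where k: "r = [:k:]" by (auto elim: degree_eq_zeroE)
  have "p = smult k (node_poly Z)" using r unfolding k by simp
  moreover from this have "k \<noteq> 0" using nz by auto
  ultimately show thesis using that unfolding Z_def by blast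
qed

section \<open>The transformation \<open>\<Theta>\<close>\<close>

text \<open>The condition on the smallest pole, in a form that covers \<open>None\<close> and
  coefficients without poles, for which the smallest pole is +\<infinity>.\<close>

definition below :: "real \<Rightarrow> coeff \<Rightarrow> bool" where
  "below m f \<longleftrightarrow> (\<forall>g. f = Some g \<longrightarrow> (\<forall>p\<in>poles g. m < p))"

lemma below_None [simp]: "below m None"
  by (simp add: below_def)

lemma below_mono: "below m f \<Longrightarrow> l \<le> m \<Longrightarrow> below l f"
  by (force simp: below_def)

lemma up_None [simp]: "up None = -1" and down_None [simp]: "down None = 0"
  by (simp_all add: up_def down_def)

lemma finite_poles: "Some g \<in> RR \<Longrightarrow> finite (poles g)"
  by (erule RR_SomeE) simp

lemma below_open:
  assumes "f \<in> RR" "below m f"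
  obtains e where "e > 0" "\<And>l. l < m + e \<Longrightarrow> below l f"
proof (cases f)
  case None then show thesis using that[of 1] by simp
next
  case (Some g)
  show thesis
  proof (cases "poles g = {}")
    case True then show thesis using that[of 1] Some by (simp add: below_def)
  next
    case False
    have "finite (poles g)" using assms Some by (simp add: finite_poles)
    then have "\<forall>p\<in>poles g. Min (poles g) \<le> p" "m < Min (poles g)"
      using False assms(2) Some by (auto simp: below_def)
    then show thesis using that[of "Min (poles g) - m"] Some by (fastforce simp: below_def)
  qed
qed

lemma below_exists:
  assumes "f \<in> RR"
  obtains m where "below m f"
proof (cases f)
  case None then show thesis using that by simp
next
  case (Some g)
  have "finite (poles g)" using assms Some by (simp add: finite_poles)
  then have "\<forall>p\<in>poles g. Min (insert 0 (poles g)) \<le> p" by simp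
  then show thesis using that[of "Min (insert 0 (poles g)) - 1"] Some by (fastforce simp: below_def)
qed

lemma down_pos:
  assumes "f \<in> RR" "below m f" "f \<noteq> None"
  shows "poly (down f) m > 0"
proof -
  obtain g where f: "f = Some g" using assms by auto
  show ?thesis using assms(1) unfolding f
  proof (rule RR_SomeE)
    fix c h0 h P \<delta>
    assume "c > 0" "poles g = P" "down (Some g) = smult c (node_poly P)"
    then show "poly (down (Some g)) m > 0"
      using assms(2) f by (auto simp: below_def intro!: mult_pos_pos poly_node_poly_pos)
  qed
qed

lemma down_nonneg: "f \<in> RR \<Longrightarrow> below m f \<Longrightarrow> poly (down f) m \<ge> 0"
  using down_pos[of f m] by (cases "f = None") auto

text \<open>Monotonicity of f left of its poles, from the kernel identity. Cross-multiplication
  includes \<open>None\<close>, where both sides vanish, and is the form in which it enters the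
  Wronskian estimates.\<close>

lemma up_down_mono:
  assumes "f \<in> RR" "below m f" "l \<le> m"
  shows "poly (up f) l * poly (down f) m \<le> poly (up f) m * poly (down f) l"
proof (cases f)
  case None then show ?thesis by simp
next
  case (Some g)
  show ?thesis using assms(1) unfolding Some
  proof (rule RR_SomeE)
    fix c h0 h P \<delta>
    assume a: "finite P" "h0 \<ge> 0" "\<And>p. p \<in> P \<Longrightarrow> \<delta> p > 0" "c > 0" "poles g = P"
      and d: "down (Some g) = smult c (node_poly P)" and u: "up (Some g) = num_poly c h0 h P \<delta>"
    have b: "\<And>p. p \<in> P \<Longrightarrow> m < p" "\<And>p. p \<in> P \<Longrightarrow> l < p"
      using assms(2,3) Some a(5) by (auto simp: below_def)
    have "0 \<le> (m - l) * (h0 * poly (smult c (node_poly P)) m * poly (smult c (node_poly P)) l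
      + (\<Sum>p\<in>P. c\<^sup>2 * \<delta> p * poly (node_poly (P - {p})) m * poly (node_poly (P - {p})) l))"
      using a b assms(3)
      by (intro mult_nonneg_nonneg add_nonneg_nonneg sum_nonneg)
         (auto intro!: mult_nonneg_nonneg less_imp_le[OF poly_node_poly_pos] less_imp_le[of 0 "\<delta> _"])
    then show "poly (up (Some g)) l * poly (down (Some g)) m \<le> poly (up (Some g)) m * poly (down (Some g)) l"
      using kernel_identity[OF a(1), of c h0 h \<delta> m l] unfolding d u by linarith
  qed
qed

text \<open>The hypotheses single out \<open>m\<close> as the smallest pole. There \<open>up\<close>
  is a positive coefficient times \<Prod> (p - m) over the other poles, all of them larger. This
  sign later shows that the lowest eigenvalue cannot sit at a pole.\<close>

lemma at_smallest_pole:
  assumes "f \<in> RR" "\<And>l. l < m \<Longrightarrow> below l f" "\<not> below m f"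
  shows "poly (down f) m = 0" "poly (up f) m > 0"
proof -
  obtain g where f: "f = Some g" using assms(3) by (cases f) auto
  have "poly (down f) m = 0 \<and> poly (up f) m > 0" using assms(1) unfolding f
  proof (rule RR_SomeE)
    fix c h0 h P \<delta>
    assume a: "finite P" "h0 \<ge> 0" "\<And>p. p \<in> P \<Longrightarrow> \<delta> p > 0" "c > 0" "poles g = P"
      and d: "down (Some g) = smult c (node_poly P)" and u: "up (Some g) = num_poly c h0 h P \<delta>"
    obtain p where p: "p \<in> P" "p \<le> m" using assms(3) f a(5) by (force simp: below_def)
    have le: "m \<le> r" if "r \<in> P" for r
    proof (rule ccontr)
      assume "\<not> m \<le> r"
      then have "below r f" using assms(2) by simp
      then show False using that f a(5) by (auto simp: below_def)
    qed
    then have mP: "m \<in> P" using p by fastforce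
    have "poly (node_poly (P - {m})) m > 0"
      using le by (intro poly_node_poly_pos) force
    then show "poly (down (Some g)) m = 0 \<and> poly (up (Some g)) m > 0"
      using a mP poly_node_poly_eq_0_iff[OF a(1), of m]
      by (simp add: d u poly_num_poly_node)
  qed
  then show "poly (down f) m = 0" "poly (up f) m > 0" by auto
qed

text \<open>The derivative is a sum of squares. At a pole the square belonging to that pole
  survives; elsewhere the slope term or any pole term is positive. So it vanishes only when there is
  neither slope nor pole.\<close>

lemma deriv_down_sq_cases:
  assumes "f \<in> RR"
  shows "(\<exists>t. f = Some (ratc t)) \<or> f = None \<or> (\<forall>x. poly (deriv_down_sq f) x > 0)"
proof (cases f)
  case None then show ?thesis by simp
next
  case (Some g)
  show ?thesis using assms unfolding Some
  proof (rule RR_SomeE)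
    fix c h0 h P \<delta>
    assume a: "finite P" "h0 \<ge> 0" "\<And>p. p \<in> P \<Longrightarrow> \<delta> p > 0" "c > 0" and r: "hn_rep g h0 h P \<delta>"
      and d: "down (Some g) = smult c (node_poly P)" and u: "up (Some g) = num_poly c h0 h P \<delta>"
    have dd: "poly (deriv_down_sq (Some g)) x = h0 * (poly (smult c (node_poly P)) x)\<^sup>2
        + (\<Sum>p\<in>P. c\<^sup>2 * \<delta> p * (poly (node_poly (P - {p})) x)\<^sup>2)" for x
      unfolding deriv_down_sq_def d u wronskian_identity[OF a(1)] by (simp add: poly_sum)
    have nn: "0 \<le> c\<^sup>2 * \<delta> p * (poly (node_poly (P - {p})) x)\<^sup>2" if "p \<in> P" for p x
      using a(3)[OF that] by (intro mult_nonneg_nonneg) auto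
    show "(\<exists>t. Some g = Some (ratc t)) \<or> Some g = None \<or> (\<forall>x. poly (deriv_down_sq (Some g)) x > 0)"
    proof (cases "P = {} \<and> h0 = 0")
      case True
      then have "g = ratc h" using r by (simp add: hn_rep_def)
      then show ?thesis by blast
    next
      case False
      have "poly (deriv_down_sq (Some g)) x > 0" for x
      proof (cases "P = {} \<or> (x \<notin> P \<and> h0 > 0)")
        case True
        then have "h0 > 0" "poly (node_poly P) x \<noteq> 0"
          using False a poly_node_poly_eq_0_iff[OF a(1), of x] by auto
        then have "h0 * (poly (smult c (node_poly P)) x)\<^sup>2 > 0" using a by simp
        then show ?thesis unfolding dd using nn by (intro add_pos_nonneg sum_nonneg)
      next
        case 2: False
        then obtain p where p: "p \<in> P" "x \<in> P \<longrightarrow> p = x" by blast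
        then have "poly (node_poly (P - {p})) x \<noteq> 0"
          using poly_node_poly_eq_0_iff[of "P - {p}" x] a(1) by auto
        then have "c\<^sup>2 * \<delta> p * (poly (node_poly (P - {p})) x)\<^sup>2 > 0" using a p by simp
        then have "(\<Sum>p\<in>P. c\<^sup>2 * \<delta> p * (poly (node_poly (P - {p})) x)\<^sup>2) > 0"
          using nn p(1) a(1) by (intro sum_pos2[of P p]) auto
        then show ?thesis unfolding dd using a(2) by (intro add_nonneg_pos) auto
      qed
      then show ?thesis by blast
    qed
  qed
qed

lemma ratc_RR: "Some (ratc t) \<in> RR" "down (Some (ratc t)) = 1" "up (Some (ratc t)) = [:t:]"
  "poles (ratc t) = {}" "slope (ratc t) = 0"
proof -
  have r: "hn_rep (ratc t) 0 t {} (\<lambda>_. 0)" by (simp add: hn_rep_def)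
  show "Some (ratc t) \<in> RR" using r by (auto simp: RR_def)
  show "down (Some (ratc t)) = 1" "up (Some (ratc t)) = [:t:]"
    using hn_rep_down_up[OF r refl] by (simp_all add: num_poly_def node_poly_def)
  show "poles (ratc t) = {}" "slope (ratc t) = 0"
    using hn_rep_poles_eq[OF r] hn_rep_slope[OF r] by auto
qed

lemma below_ratc [simp]: "below m (Some (ratc t))"
  by (simp add: below_def ratc_RR)

lemma ratc_RR_ind_0: "Some (ratc t) \<in> RR_ind 0"
  by (simp add: RR_ind_def ratc_RR ind_def)

lemma RR_ind_0E:
  assumes "f \<in> RR_ind 0"
  obtains t where "f = Some (ratc t)"
proof -
  have f: "f \<in> RR" "ind f = 0" using assms by (auto simp: RR_ind_def)
  then obtain g where g: "f = Some g" by (cases f) (auto simp: ind_def)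
  show thesis using f(1) unfolding g
  proof (rule RR_SomeE)
    fix c h0 h P \<delta>
    assume a: "finite P" "h0 \<ge> 0" "poles g = P" "slope g = h0" and r: "hn_rep g h0 h P \<delta>"
    have "P = {}" "h0 = 0" using f(2) a by (auto simp: g ind_def split: if_splits)
    then have "g = ratc h" using r by (simp add: hn_rep_def)
    then show thesis using that g by blast
  qed
qed

lemma deriv_down_sq_nonneg: "f \<in> RR \<Longrightarrow> poly (deriv_down_sq f) x \<ge> 0"
  using deriv_down_sq_cases[of f]
  by (force simp: deriv_down_sq_def ratc_RR pderiv_pCons less_imp_le)

lemma Some_eq_up_div_down:
  assumes "Some g \<in> RR"
  shows "g = to_fract (up (Some g)) / to_fract (down (Some g))" "down (Some g) \<noteq> 0"
proof -
  have "g = to_fract (up (Some g)) / to_fract (down (Some g)) \<and> down (Some g) \<noteq> 0" using assms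
  proof (rule RR_SomeE)
    fix c h0 h P \<delta>
    assume a: "finite P" "c > 0" and r: "hn_rep g h0 h P \<delta>"
      and d: "down (Some g) = smult c (node_poly P)" and u: "up (Some g) = num_poly c h0 h P \<delta>"
    have "down (Some g) \<noteq> 0" using a by (simp add: d node_poly_nz)
    then show ?thesis using hn_rep_mult_node_poly[OF r, of c] unfolding u[symmetric] d[symmetric]
      by (metis nonzero_eq_divide_eq to_fract_eq_0_iff)
  qed
  then show "g = to_fract (up (Some g)) / to_fract (down (Some g))" "down (Some g) \<noteq> 0" by auto
qed

text \<open>The zeros of \<open>f - t\<close> are real by the kernel identity, which plays the role of
  \<open>Im f(z) / Im z > 0\<close>, and simple since \<open>f' > 0\<close>.\<close>

lemma shifted_down_split:
  assumes f: "f \<in> RR" "below m f" and le: "poly (up f) m \<le> t * poly (down f) m" and nz: "f \<noteq> Some (ratc t)"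
  defines "p \<equiv> smult t (down f) - up f"
  obtains k Z where "finite Z" "p = smult k (node_poly Z)" "k > 0" "\<And>x. x \<in> Z \<Longrightarrow> m \<le> x"
    "Z = {x. poly p x = 0}"
    "\<And>x. x \<in> Z \<Longrightarrow> poly (down f) x * poly (pderiv p) x < 0"
    "(coeff (down f) (card Z) = 0 \<and> k = 1 \<or> coeff (down f) (card Z) = (- 1) ^ card Z)"
    "\<And>j. j > card Z \<Longrightarrow> coeff (down f) j = 0"
proof -
  consider "f = None" | s where "f = Some (ratc s)" | g where "f = Some g" "\<And>x. poly (deriv_down_sq f) x > 0"
    using deriv_down_sq_cases[OF f(1)] by (cases f) auto
  then show thesis
  proof cases
    case 1
    then show thesis by (intro that[of "{}" 1]) (auto simp: p_def node_poly_def)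
  next
    case 2
    have "s < t" using le nz 2 by (simp add: ratc_RR)
    have p: "p = [:t - s:]" using 2 by (simp add: p_def ratc_RR)
    show thesis
      by (rule that[of "{}" "t - s"]) (use \<open>s < t\<close> in \<open>auto simp: p 2 ratc_RR node_poly_def\<close>)
  next
    case (3 g)
    show thesis using f(1) unfolding 3(1)
    proof (rule RR_SomeE)
      fix c h0 h P \<delta>
      assume a: "finite P" "h0 \<ge> 0" "\<And>p. p \<in> P \<Longrightarrow> \<delta> p > 0" "c > 0" "poles g = P"
        and c: "c = (if h0 > 0 then 1 / h0 else 1)"
        and d: "down (Some g) = smult c (node_poly P)" and u: "up (Some g) = num_poly c h0 h P \<delta>"
        and r: "hn_rep g h0 h P \<delta>"
      define D U n where "D = down f" and "U = up f" and "n = card P"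
      note D = D_def[unfolded 3(1) d] and U = U_def[unfolded 3(1) u]
      have pDU: "p = smult t D - U" by (simp add: p_def D_def U_def)
      have W: "poly (pderiv U) x * poly D x - poly U x * poly (pderiv D) x > 0" for x
        using 3(2)[of x] by (simp add: deriv_down_sq_def D_def U_def)
      have Dj: "coeff D j = 0" if "j > n" for j
        using that a by (intro coeff_eq_0) (simp add: D degree_node_poly n_def)
      have Dn: "coeff D n = c * (- 1) ^ n" using a by (simp add: D n_def lead_coeff_node_poly)
      have "P = {} \<and> h0 = 0 \<Longrightarrow> g = ratc h" using r by (simp add: hn_rep_def)
      then have nc: "P \<noteq> {} \<or> h0 > 0"
        using 3 a(2) by (force simp: deriv_down_sq_def ratc_RR pderiv_pCons)
      have cp: "coeff p (Suc n) = c * h0 * (- 1) ^ Suc n"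
        using a(1) Dj[of "Suc n"] by (simp add: pDU U n_def coeff_num_poly_Suc)
      have ch: "c * h0 = 1" if "h0 > 0" using c that by simp
      have c1: "c = 1" if "h0 = 0" using c that by simp
      have cp0: "coeff p n = (t - h) * (- 1) ^ n" if "h0 = 0"
        using that a(1) Dn c1 by (simp add: pDU U n_def coeff_num_poly_card algebra_simps)
      \<comment> \<open>Without slope, f(m) exceeds the limit \<open>h\<close> of f at infinity
        because every \<delta>_p / (p - m) is positive; so t \<ge> f(m) > h fixes the sign of the
        leading coefficient.\<close>
      have th: "t > h" if "h0 = 0"
      proof -
        have P: "P \<noteq> {}" using nc that by simp
        have D0: "poly D m > 0" using down_pos[OF f] 3(1) by (simp add: D_def)
        have "poly (\<Sum>p\<in>P. smult (c * \<delta> p) (node_poly (P - {p}))) m > 0"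
          unfolding poly_sum
        proof (rule sum_pos[OF a(1) P])
          fix q assume "q \<in> P"
          moreover have "poly (node_poly (P - {q})) m > 0"
            using f(2) 3(1) a(5) by (intro poly_node_poly_pos) (auto simp: below_def)
          ultimately show "0 < poly (smult (c * \<delta> q) (node_poly (P - {q}))) m" using a by simp
        qed
        then have "poly U m > h * poly D m" using that by (simp add: U D num_poly_def)
        then have "h * poly D m < t * poly D m" using le by (simp add: U_def D_def)
        then show ?thesis using D0 by simp
      qed
      have pnz: "p \<noteq> 0"
      proof (cases "h0 = 0")
        case True
        then have "coeff p n \<noteq> 0" using cp0 th by simp
        then show ?thesis by auto
      next
        case False then show ?thesis using cp a by auto
      qed
      have re: "Im z = 0" if z: "cev p z = 0" for z
      proof (rule ccontr)
        assume nr: "Im z \<noteq> 0"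
        \<comment> \<open>A zero z of \<open>p\<close> gives f(z) = t, so for nonreal z the kernel
          at z and its conjugate vanishes, although it is a sum of nonnegative terms, one of them
          positive.\<close>
        have "cev U z = of_real t * cev D z" using z by (simp add: pDU)
        then have "cev U z * cev D (cnj z) - cev U (cnj z) * cev D z = 0" by (simp add: cev_cnj)
        then have "(z - cnj z) * (of_real h0 * cev D z * cev D (cnj z)
          + (\<Sum>p\<in>P. of_real (c\<^sup>2 * \<delta> p) * cev (node_poly (P - {p})) z * cev (node_poly (P - {p})) (cnj z))) = 0"
          unfolding U D by (simp only: kernel_identity_complex[OF a(1)])
        moreover have "z - cnj z \<noteq> 0" using nr by (simp add: complex_eq_iff)
        ultimately have "of_real h0 * (cev D z * cnj (cev D z))
          + (\<Sum>p\<in>P. of_real (c\<^sup>2 * \<delta> p) * (cev (node_poly (P - {p})) z * cnj (cev (node_poly (P - {p})) z))) = 0"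
          by (simp add: cev_cnj mult.assoc)
        then have "complex_of_real (h0 * (cmod (cev D z))\<^sup>2 + (\<Sum>p\<in>P. c\<^sup>2 * \<delta> p * (cmod (cev (node_poly (P - {p})) z))\<^sup>2)) = 0"
          by (simp only: of_real_add of_real_mult of_real_sum complex_norm_square of_real_0)
        then have E: "h0 * (cmod (cev D z))\<^sup>2 + (\<Sum>p\<in>P. c\<^sup>2 * \<delta> p * (cmod (cev (node_poly (P - {p})) z))\<^sup>2) = 0"
          using of_real_eq_0_iff by blast
        have nz: "cev (node_poly Q) z \<noteq> 0" if "finite Q" for Q
          using that
        proof (induction Q rule: finite_induct)
          case (insert q Q)
          have "of_real q - z \<noteq> 0" using nr by (auto simp: complex_eq_iff)
          then show ?case using insert by (simp add: node_poly_def)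
        qed (simp add: node_poly_def one_pCons)
        have nn: "0 \<le> c\<^sup>2 * \<delta> p * (cmod (cev (node_poly (P - {p})) z))\<^sup>2" if "p \<in> P" for p
          using a(3)[OF that] by (intro mult_nonneg_nonneg) auto
        show False
        proof (cases "h0 > 0")
          case True
          then have "h0 * (cmod (cev D z))\<^sup>2 > 0" using nz[OF a(1)] a(4) by (simp add: D)
          moreover have "(\<Sum>p\<in>P. c\<^sup>2 * \<delta> p * (cmod (cev (node_poly (P - {p})) z))\<^sup>2) \<ge> 0"
            using nn by (rule sum_nonneg)
          ultimately show False using E by linarith
        next
          case False
          have "(\<Sum>p\<in>P. c\<^sup>2 * \<delta> p * (cmod (cev (node_poly (P - {p})) z))\<^sup>2) > 0"
            using nc False a nz by (intro sum_pos) auto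
          then show False using E a(2) False by simp
        qed
      qed
      have root: "poly D x * poly (pderiv p) x < 0" if "poly p x = 0" for x
      proof -
        have "poly U x = t * poly D x" using that by (simp add: pDU)
        then show ?thesis using W[of x] by (simp add: pDU pderiv_diff pderiv_smult algebra_simps)
      qed
      then have "\<And>x. poly p x = 0 \<Longrightarrow> poly (pderiv p) x \<noteq> 0" by force
      from real_simple_roots_split[OF pnz re this] obtain k where
        k: "k \<noteq> 0" "p = smult k (node_poly {x. poly p x = 0})" by blast
      define Z where "Z = {x. poly p x = 0}"
      have fZ: "finite Z" unfolding Z_def by (rule poly_roots_finite[OF pnz])
      have pZ: "p = smult k (node_poly Z)" using k(2) unfolding Z_def .
      have D0: "poly D x > 0" if "x \<le> m" for x
        using down_pos[OF f(1) below_mono[OF f(2) that]] 3(1) by (simp add: D_def)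
      have pge: "poly p x \<ge> 0" if "x \<le> m" for x
      proof -
        have "poly U x * poly D m \<le> poly U m * poly D x"
          unfolding U_def D_def by (rule up_down_mono[OF f that])
        also have "\<dots> \<le> (t * poly D m) * poly D x"
          using le D0[OF that] by (intro mult_right_mono) (auto simp: U_def D_def)
        finally have "poly U x * poly D m \<le> (t * poly D x) * poly D m" by (simp add: mult_ac)
        then have "poly U x \<le> t * poly D x" using D0[of m] by (simp add: mult_le_cancel_right)
        then show ?thesis by (simp add: pDU)
      qed
      \<comment> \<open>At a zero left of \<open>m\<close> the polynomial would decrease, as D > 0
        there, and be negative just to the right, against \<open>pge\<close>.\<close>
      have Zge: "m \<le> x" if "x \<in> Z" for x
      proof (rule ccontr)
        assume "\<not> m \<le> x"
        then have xm: "x < m" by simp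
        have "poly p x = 0" using that by (simp add: Z_def)
        then have "poly (pderiv p) x < 0"
          using root[of x] D0[of x] xm by (simp add: mult_less_0_iff)
        then obtain d where d: "d > 0" "\<And>h. h > 0 \<Longrightarrow> h < d \<Longrightarrow> poly p (x + h) < poly p x"
          using DERIV_neg_dec_right[OF poly_DERIV] by blast
        define e where "e = min (d / 2) (m - x)"
        have "poly p (x + e) < 0" using d xm \<open>poly p x = 0\<close> by (simp add: e_def)
        moreover have "poly p (x + e) \<ge> 0" using xm by (intro pge) (simp add: e_def)
        ultimately show False by simp
      qed
      have kpos: "k > 0"
      proof -
        have "poly (node_poly Z) (m - 1) > 0" using Zge by (intro poly_node_poly_pos) force
        moreover have "poly p (m - 1) \<ge> 0" by (rule pge) simp
        then have "k * poly (node_poly Z) (m - 1) \<ge> 0" unfolding pZ by simp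
        ultimately show ?thesis using k(1) by (simp add: zero_le_mult_iff)
      qed
      have degp: "degree p = card Z" using fZ k(1) by (subst pZ) (simp add: degree_node_poly)
      have lp: "coeff p (card Z) = k * (- 1) ^ card Z" using fZ by (subst pZ) (simp add: lead_coeff_node_poly)
      have pj: "coeff p j = 0" if "j > Suc n" for j
      proof -
        have "degree U < j" using degree_num_poly[OF a(1), of c h0 h \<delta>] that by (simp add: U n_def)
        then show ?thesis using that by (simp add: pDU Dj coeff_eq_0)
      qed
      \<comment> \<open>With slope, c h0 = 1 makes the leading coefficient of \<open>p\<close> equal
        to (-1)^(n+1), so \<open>p\<close> has n + 1 zeros and k = 1. Without slope, c = 1,
        \<open>p\<close> has n zeros, and D has leading coefficient (-1)^n. These become the two
        normalisations of the new \<open>down\<close>.\<close>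
      have fin: "(coeff D (card Z) = 0 \<and> k = 1 \<or> coeff D (card Z) = (- 1) ^ card Z) \<and> (\<forall>j. j > card Z \<longrightarrow> coeff D j = 0)"
      proof (cases "h0 > 0")
        case True
        have "degree p = Suc n"
          using cp ch[OF True] pj by (intro antisym degree_le le_degree) auto
        then have cz: "card Z = Suc n" using degp by simp
        then have "k = 1" using lp cp ch[OF True] by simp
        then show ?thesis using cz Dj by simp
      next
        case False
        then have h0: "h0 = 0" using a by simp
        have "coeff p j = 0" if "j > n" for j
          using that cp h0 pj by (cases "j = Suc n") auto
        then have "degree p = n"
          using cp0[OF h0] th[OF h0] by (intro antisym degree_le le_degree) auto
        then have cz: "card Z = n" using degp by simp
        then show ?thesis using Dn c1[OF h0] Dj by simp
      qed
      have root': "poly (down f) x * poly (pderiv p) x < 0" if "x \<in> Z" for x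
        using root[of x] that unfolding Z_def D_def by simp
      have fin': "coeff (down f) j = 0" if "j > card Z" for j
        using fin that unfolding D_def by blast
      show thesis
        by (rule that[OF fZ pZ kpos Zge Z_def root' fin[THEN conjunct1, unfolded D_def] fin'])
    qed
  qed
qed


text \<open>With p = t D - U the fraction (m - \<lambda>) / (U/D - t) - t equals ((\<lambda> - m) D
  - t p) / p. Numerator and denominator are linear in \<open>up\<close> and \<open>down\<close>, and
  in this form \<open>None\<close>, with U = -1 and D = 0, is no exception.\<close>

lemma RR_cases_quotient:
  assumes "f \<in> RR" "f \<noteq> Some (ratc t)"
  shows "Theta m t f = Some ((to_fract ([:-m, 1:] * down f - smult t (smult t (down f) - up f)))
    / to_fract (smult t (down f) - up f))"
proof (cases f)
  case None
  then show ?thesis by (simp add: Theta_def)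
next
  case (Some g)
  define U D where "U = up f" and "D = down f"
  have g: "g = to_fract U / to_fract D" and D: "D \<noteq> 0"
    using Some_eq_up_div_down[of g] assms(1) Some by (auto simp: U_def D_def)
  have gt: "g \<noteq> ratc t" using assms(2) Some by simp
  have st: "to_fract (smult t D) = ratc t * to_fract D"
    by (simp flip: to_fract_mult)
  define p where "p = smult t D - U"
  have tp: "to_fract p = (ratc t - g) * to_fract D"
    using D by (simp add: p_def st g field_simps)
  then have p0: "to_fract p \<noteq> 0" using gt D by simp
  have "to_fract [:m, -1:] / (g - ratc t) - ratc t = to_fract ([:-m, 1:] * D - smult t p) / to_fract p"
  proof -
    have m: "to_fract [:m, -1:] = - to_fract [:-m, 1:]" by (simp flip: to_fract_uminus)
    have sp: "to_fract (smult t p) = ratc t * to_fract p" by (simp flip: to_fract_mult)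
    have "to_fract ([:-m, 1:] * D - smult t p) = to_fract [:-m, 1:] * to_fract D - ratc t * to_fract p"
      by (simp only: to_fract_diff to_fract_mult sp)
    then have "to_fract ([:-m, 1:] * D - smult t p) / to_fract p = to_fract [:-m, 1:] * to_fract D / to_fract p - ratc t"
      using p0 by (simp add: diff_divide_distrib)
    also have "to_fract [:-m, 1:] * to_fract D / to_fract p = to_fract [:m, -1:] / (g - ratc t)"
      unfolding tp m using D gt by (simp add: field_simps)
    finally show ?thesis by simp
  qed
  then show ?thesis using Some gt by (simp add: Theta_def p_def U_def D_def)
qed

text \<open>For t > f(m) the new poles are the zeros of t - f, all right of \<open>m\<close>, and
  the index grows by one (from \<open>None\<close> to a constant, from a constant to a slope without
  poles). The leading coefficients are such that the quotient is already normalised.\<close>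

lemma Theta_increasing:
  assumes f: "f \<in> RR" "below m f" and less: "poly (up f) m < t * poly (down f) m"
  obtains g where "Theta m t f = Some g" "Some g \<in> RR" "below m (Some g)"
    "down (Some g) = smult t (down f) - up f"
    "up (Some g) = [:-m, 1:] * down f - smult t (smult t (down f) - up f)"
proof -
  define p where "p = smult t (down f) - up f"
  define U where "U = [:-m, 1:] * down f - smult t p"
  have nz: "f \<noteq> Some (ratc t)" using less by (auto simp: ratc_RR)
  have pm: "poly p m > 0" using less by (simp add: p_def)
  obtain k Z where Z: "finite Z" "p = smult k (node_poly Z)" "k > 0" "\<And>x. x \<in> Z \<Longrightarrow> m \<le> x"
    "Z = {x. poly p x = 0}" "\<And>x. x \<in> Z \<Longrightarrow> poly (down f) x * poly (pderiv p) x < 0"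
    "(coeff (down f) (card Z) = 0 \<and> k = 1 \<or> coeff (down f) (card Z) = (- 1) ^ card Z)"
    "\<And>j. j > card Z \<Longrightarrow> coeff (down f) j = 0"
    by (rule shifted_down_split[OF f less_imp_le[OF less] nz, folded p_def], rule that, assumption+)
  define n where "n = card Z"
  have dp: "degree p = n" using Z(1,3) by (subst Z(2)) (simp add: degree_node_poly n_def)
  have Uj: "coeff U (Suc j) = coeff (down f) j - m * coeff (down f) (Suc j) - t * coeff p (Suc j)" for j
    by (simp add: U_def)
  have USn: "coeff U (Suc n) = coeff (down f) n"
    unfolding Uj using Z(8)[of "Suc n"] dp by (simp add: n_def coeff_eq_0)
  have degU: "degree U \<le> Suc n"
  proof (rule degree_le, intro allI impI)
    fix i assume "i > Suc n"
    then obtain j where "i = Suc j" "j > n" by (metis Suc_less_eq2)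
    then show "coeff U i = 0" using Z(8)[of j] Z(8)[of "Suc j"] dp by (simp add: Uj n_def coeff_eq_0)
  qed
  have sg: "(- 1) ^ n * (- 1) ^ n = (1::real)"
    by (simp flip: power_mult_distrib)
  have mZ: "m < x" if "x \<in> Z" for x
  proof -
    have "x \<noteq> m" using that pm Z(5) by auto
    then show ?thesis using Z(4)[OF that] by simp
  qed
  \<comment> \<open>At a zero of \<open>p\<close> the numerator is (x - m) D(x) with D =
    \<open>down f\<close>, so the residue condition reduces to the sign of D p'.\<close>
  have neg: "poly U x * poly (pderiv (smult k (node_poly Z))) x < 0" if "x \<in> Z" for x
  proof -
    have "poly p x = 0" using that Z(5) by auto
    then have "poly U x * poly (pderiv p) x = (x - m) * (poly (down f) x * poly (pderiv p) x)"
      by (simp add: U_def algebra_simps)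
    also have "\<dots> < 0" using mZ[OF that] Z(6)[OF that] by (simp add: mult_pos_neg)
    finally show ?thesis unfolding Z(2)[symmetric] .
  qed
  have norm: "coeff U (Suc (card Z)) = 0 \<and> k = 1 \<or> (- 1) ^ card Z * coeff U (Suc (card Z)) = 1"
    using Z(7) USn sg by (auto simp: n_def)
  define g where "g = to_fract U / to_fract (smult k (node_poly Z))"
  note R = RR_SomeI[OF Z(1,3) degU[unfolded n_def] norm neg g_def]
  show thesis
  proof (rule that[OF _ R(1)])
    show "Theta m t f = Some g" using RR_cases_quotient[OF f(1) nz, of m]
      by (simp only: g_def U_def p_def flip: Z(2))
    show "below m (Some g)" using mZ R(4) by (simp add: below_def)
    show "down (Some g) = smult t (down f) - up f" using R(3) Z(2) by (simp only: p_def)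
    show "up (Some g) = [:-m, 1:] * down f - smult t (smult t (down f) - up f)"
      using R(2) by (simp only: U_def p_def)
  qed
qed

lemma Theta_const: "Theta m t (Some (ratc t)) = None"
  by (simp add: Theta_def)

text \<open>For t = f(m) numerator and denominator share the factor m - \<lambda>; cancelling it
  removes one zero and the index drops by one, a constant becoming \<open>None\<close>. The equation
  for \<open>down\<close> keeps the factor on the left to stay free of division.\<close>

lemma Theta_decreasing:
  assumes f: "f \<in> RR" "below m f" "f \<noteq> None" and eq: "poly (up f) m = t * poly (down f) m"
  shows "Theta m t f \<in> RR" "below m (Theta m t f)"
    "[:-m, 1:] * down (Theta m t f) = up f - smult t (down f)"
    "up (Theta m t f) = - down f - smult t (down (Theta m t f))"
proof -
  have "Theta m t f \<in> RR \<and> below m (Theta m t f) \<and>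
    [:-m, 1:] * down (Theta m t f) = up f - smult t (down f) \<and>
    up (Theta m t f) = - down f - smult t (down (Theta m t f))"
  proof (cases "f = Some (ratc t)")
    case True
    then show ?thesis by (simp add: Theta_const ratc_RR RR_def one_pCons)
  next
    case nz: False
    define p where "p = smult t (down f) - up f"
    have pm: "poly p m = 0" using eq by (simp add: p_def)
    obtain k Z where Z: "finite Z" "p = smult k (node_poly Z)" "k > 0" "\<And>x. x \<in> Z \<Longrightarrow> m \<le> x"
      "Z = {x. poly p x = 0}" "\<And>x. x \<in> Z \<Longrightarrow> poly (down f) x * poly (pderiv p) x < 0"
      "(coeff (down f) (card Z) = 0 \<and> k = 1 \<or> coeff (down f) (card Z) = (- 1) ^ card Z)"
      "\<And>j. j > card Z \<Longrightarrow> coeff (down f) j = 0"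
      by (rule shifted_down_split[OF f(1,2) eq_refl[OF eq] nz, folded p_def], rule that, assumption+)
    define Y D U n where "Y = Z - {m}" and "D = smult k (node_poly Y)" and "U = - down f - smult t D" and "n = card Y"
    have mZ: "m \<in> Z" using pm Z(5) by auto
    have fY: "finite Y" using Z(1) by (simp add: Y_def)
    have cZ: "card Z = Suc n" using mZ Z(1) by (metis Y_def n_def card.remove)
    have pD: "p = [:m, -1:] * D"
      unfolding Z(2) D_def Y_def using node_poly_remove[OF Z(1) mZ] by simp
    have dD: "degree D = n" using fY Z(3) by (simp add: D_def degree_node_poly n_def)
    have USn: "coeff U (Suc n) = - coeff (down f) (Suc n)"
      using dD by (simp add: U_def coeff_eq_0)
    have degU: "degree U \<le> Suc n"
      using Z(8) dD cZ by (intro degree_le) (simp add: U_def coeff_eq_0)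
    have sg: "(- 1) ^ n * (- 1) ^ n = (1::real)"
      by (simp flip: power_mult_distrib)
    have neg: "poly U x * poly (pderiv (smult k (node_poly Y))) x < 0" if x: "x \<in> Y" for x
    proof -
      have xm: "m < x" using x Z(4) by (force simp: Y_def)
      have Dx: "poly D x = 0" using x poly_node_poly_eq_0_iff[OF fY] by (simp add: D_def)
      have "poly (pderiv p) x = (m - x) * poly (pderiv D) x"
        unfolding pD pderiv_mult by (simp add: Dx pderiv_pCons del: mult_pCons_left)
      then have "poly (pderiv D) x = - poly (pderiv p) x / (x - m)" using xm by (simp add: field_simps)
      then have "poly U x * poly (pderiv D) x = poly (down f) x * poly (pderiv p) x / (x - m)"
        by (simp add: U_def Dx)
      also have "\<dots> < 0" using Z(6)[of x] x xm by (simp add: Y_def divide_neg_pos)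
      finally show ?thesis unfolding D_def .
    qed
    have norm: "coeff U (Suc (card Y)) = 0 \<and> k = 1 \<or> (- 1) ^ card Y * coeff U (Suc (card Y)) = 1"
      using Z(7) USn sg cZ by (auto simp: n_def)
    define g where "g = to_fract U / to_fract (smult k (node_poly Y))"
    note R = RR_SomeI[OF fY Z(3) degU[unfolded n_def] norm neg g_def]
    have D0: "to_fract D \<noteq> 0" using fY Z(3) by (simp add: D_def node_poly_nz)
    have "smult t p = [:m, -1:] * smult t D" unfolding pD by (simp only: mult_smult_right)
    moreover have "[:-m, 1:] * down f = [:m, -1:] * (- down f)" by simp
    ultimately have "[:-m, 1:] * down f - smult t p = [:m, -1:] * U"
      by (simp only: U_def right_diff_distrib)
    then have "to_fract ([:-m, 1:] * down f - smult t p) / to_fract p = (to_fract [:m, -1:] * to_fract U) / (to_fract [:m, -1:] * to_fract D)"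
      unfolding pD by (simp only: to_fract_mult)
    also have "\<dots> = g" by (simp add: g_def D_def)
    finally have T: "Theta m t f = Some g" using RR_cases_quotient[OF f(1) nz, of m] by (simp only: p_def)
    have "below m (Some g)" using R(4) Z(4) by (force simp: below_def Y_def)
    moreover have "[:-m, 1:] * D = up f - smult t (down f)"
    proof -
      have "[:-m, 1:] * D = - p" unfolding pD by simp
      then show ?thesis by (simp add: p_def)
    qed
    moreover have "down (Some g) = D" "up (Some g) = U" using R(2,3) by (simp_all add: D_def)
    ultimately show ?thesis unfolding T using R(1) by (simp only: U_def)
  qed
  then show "Theta m t f \<in> RR" "below m (Theta m t f)"
    "[:-m, 1:] * down (Theta m t f) = up f - smult t (down f)"
    "up (Theta m t f) = - down f - smult t (down (Theta m t f))" by auto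
qed

text \<open>Undoing the shift by t exposes (m - \<lambda>) / (g - t), and dividing m - \<lambda> by
  it returns g - t. The exceptional values match up: the constant \<open>t\<close> goes to
  \<open>None\<close> and back, \<open>None\<close> to the constant -t and back.\<close>

lemma Theta_inverse: "Theta m (- t) (Theta m t f) = f"
proof (cases f)
  case None
  then show ?thesis by (simp add: Theta_def)
next
  case (Some g)
  show ?thesis
  proof (cases "g = ratc t")
    case True then show ?thesis using Some by (simp add: Theta_def)
  next
    case False
    have m: "ratc (- t) = - ratc t" by (simp flip: to_fract_uminus)
    define X A where "X = to_fract [:m, -1:]" and "A = g - ratc t"
    have X: "X \<noteq> 0" and A: "A \<noteq> 0" using False by (simp_all add: X_def A_def)
    have T: "Theta m t f = Some (X / A - ratc t)"
      using False Some by (simp add: Theta_def X_def A_def)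
    have ne: "X / A - ratc t \<noteq> ratc (- t)" using X A by (simp add: m)
    have "X / (X / A - ratc t - ratc (- t)) - ratc (- t) = X / (X / A) + ratc t"
      by (simp add: m)
    also have "\<dots> = g" using X A by (simp add: A_def)
    finally show ?thesis unfolding T using ne Some by (simp add: Theta_def flip: X_def)
  qed
qed

section \<open>Linear equations with integrable coefficients\<close>

text \<open>The Lipschitz constant is uniform on the whole interval, so the differences of
  successive Picard iterates are bounded by M (K (x - a))^n / n! and their series converges on all
  of it at once, without continuation of local solutions.\<close>

lemma global_picard:
  fixes G :: "real \<Rightarrow> 'a \<Rightarrow> 'a::euclidean_space"
  assumes K: "K \<ge> 0"
    and lip: "\<And>x u v. x \<in> {a..b} \<Longrightarrow> norm (G x u - G x v) \<le> K * norm (u - v)"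
    and cont: "\<And>Y. continuous_on {a..b} Y \<Longrightarrow> continuous_on {a..b} (\<lambda>x. G x (Y x))"
  obtains Y where "Y a = y0" "\<And>x. x \<in> {a..b} \<Longrightarrow> (Y has_vector_derivative G x (Y x)) (at x within {a..b})"
proof -
  define X where "X = rec_nat (\<lambda>_. y0) (\<lambda>_ Y x. y0 + integral {a..x} (\<lambda>t. G t (Y t)))"
  have X0: "X 0 = (\<lambda>_. y0)" and XS: "X (Suc n) = (\<lambda>x. y0 + integral {a..x} (\<lambda>t. G t (X n t)))" for n
    by (simp_all add: X_def)
  have Xc: "continuous_on {a..b} (X n)" for n
  proof (induction n)
    case (Suc n)
    then show ?case unfolding XS
      by (intro continuous_intros indefinite_integral_continuous_1 integrable_continuous_real cont)
  qed (simp add: X0)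
  have Gc: "continuous_on {a..x} (\<lambda>t. G t (X n t))" if "x \<in> {a..b}" for n x
    using cont[OF Xc[of n]] by (rule continuous_on_subset) (use that in auto)
  obtain M where M: "\<And>x. x \<in> {a..b} \<Longrightarrow> norm (X 1 x - X 0 x) \<le> M" "M \<ge> 0"
  proof -
    have "bounded ((\<lambda>x. X 1 x - X 0 x) ` {a..b})"
      by (intro compact_imp_bounded compact_continuous_image continuous_intros Xc compact_Icc)
    then obtain M where M: "\<And>x. x \<in> {a..b} \<Longrightarrow> norm (X 1 x - X 0 x) \<le> M"
      unfolding bounded_iff by blast
    show thesis by (rule that[of "max M 0"]) (use M in \<open>force simp: le_max_iff_disj\<close>)+
  qed
  have bound: "norm (X (Suc n) x - X n x) \<le> M * (K * (x - a)) ^ n / fact n" if "x \<in> {a..b}" for n x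
    using that
  proof (induction n arbitrary: x)
    case 0 then show ?case using M(1)[of x] by simp
  next
    case (Suc n)
    define F where "F t = M * (K * (t - a)) ^ Suc n / fact (Suc n)" for t
    define F' where "F' t = K * (M * (K * (t - a)) ^ n / fact n)" for t
    have "(F has_real_derivative F' t) (at t within {a..x})" for t
    proof -
      have "((\<lambda>t. K * (t - a)) has_real_derivative K) (at t within {a..x})"
        by (auto intro!: derivative_eq_intros)
      from DERIV_cmult[OF DERIV_power_Suc[OF this, of n], of "M / fact (Suc n)"]
      have "(F has_real_derivative M / fact (Suc n) * ((1 + real n) * (K * (K * (t - a)) ^ n))) (at t within {a..x})"
        unfolding F_def by (simp add: mult.commute)
      also have "M / fact (Suc n) * ((1 + real n) * (K * (K * (t - a)) ^ n)) = F' t"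
        by (simp add: F'_def add_nonneg_eq_0_iff)
      finally show ?thesis .
    qed
    then have "(F' has_integral F x - F a) {a..x}"
      using Suc.prems by (intro fundamental_theorem_of_calculus)
        (auto simp flip: has_real_derivative_iff_has_vector_derivative)
    then have FI: "integral {a..x} F' = F x" "F' integrable_on {a..x}"
      by (auto simp: F_def integral_unique intro: has_integral_integrable)
    have Gi: "(\<lambda>t. G t (X k t)) integrable_on {a..x}" for k
      by (intro integrable_continuous_real Gc Suc.prems)
    have "X (Suc (Suc n)) x - X (Suc n) x = integral {a..x} (\<lambda>t. G t (X (Suc n) t)) - integral {a..x} (\<lambda>t. G t (X n t))"
      using fun_cong[OF XS[of "Suc n"], of x] fun_cong[OF XS[of n], of x] by simp
    also have "\<dots> = integral {a..x} (\<lambda>t. G t (X (Suc n) t) - G t (X n t))"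
      by (rule Henstock_Kurzweil_Integration.integral_diff[OF Gi Gi, symmetric])
    also have "norm \<dots> \<le> integral {a..x} F'"
    proof (rule Henstock_Kurzweil_Integration.integral_norm_bound_integral[OF integrable_diff[OF Gi Gi] FI(2)])
      fix t assume t: "t \<in> {a..x}"
      have "norm (G t (X (Suc n) t) - G t (X n t)) \<le> K * norm (X (Suc n) t - X n t)"
        using t Suc.prems by (intro lip) auto
      also have "\<dots> \<le> F' t" unfolding F'_def using t Suc.prems K by (intro mult_left_mono Suc.IH) auto
      finally show "norm (G t (X (Suc n) t) - G t (X n t)) \<le> F' t" .
    qed
    finally show ?case by (simp add: FI F_def)
  qed
  define B where "B n = M * (K * (b - a)) ^ n / fact n" for n
  have sB: "summable B"
    unfolding B_def using summable_mult[OF summable_exp[of "K * (b - a)"], of M]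
    by (simp add: field_simps)
  have nb: "norm (X (Suc n) x - X n x) \<le> B n" if "x \<in> {a..b}" for n x
  proof -
    have "M * (K * (x - a)) ^ n / fact n \<le> B n"
      unfolding B_def using that K M(2) by (intro divide_right_mono mult_left_mono power_mono) auto
    then show ?thesis using bound[OF that, of n] by linarith
  qed
  define Y where "Y x = y0 + (\<Sum>n. X (Suc n) x - X n x)" for x
  have "uniform_limit {a..b} (\<lambda>n x. \<Sum>i<n. X (Suc i) x - X i x) (\<lambda>x. \<Sum>n. X (Suc n) x - X n x) sequentially"
    by (rule Weierstrass_m_test[OF nb sB])
  then have "uniform_limit {a..b} (\<lambda>n x. y0 + (\<Sum>i<n. X (Suc i) x - X i x)) Y sequentially"
    unfolding Y_def by (intro uniform_limit_intros)
  then have UL: "uniform_limit {a..b} X Y sequentially"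
    using sum_lessThan_telescope[of "\<lambda>i. X i x" n for x n] by (simp add: X0)
  have Yc: "continuous_on {a..b} Y"
    by (rule uniform_limit_theorem[OF _ UL]) (auto simp: Xc)
  have ULG: "uniform_limit {a..b} (\<lambda>n t. G t (X n t)) (\<lambda>t. G t (Y t)) sequentially"
  proof (rule uniform_limitI)
    fix e :: real assume "e > 0"
    then have "e / (K + 1) > 0" using K by simp
    from uniform_limitD[OF UL this]
    show "\<forall>\<^sub>F n in sequentially. \<forall>x\<in>{a..b}. dist (G x (X n x)) (G x (Y x)) < e"
    proof eventually_elim
      case (elim n)
      show ?case
      proof
        fix x assume x: "x \<in> {a..b}"
        have "norm (G x (X n x) - G x (Y x)) \<le> K * norm (X n x - Y x)" by (rule lip[OF x])
        also have "\<dots> \<le> (K + 1) * norm (X n x - Y x)" by (simp add: mult_right_mono)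
        also have "\<dots> < (K + 1) * (e / (K + 1))"
          using elim x K by (intro mult_strict_left_mono) (auto simp: dist_norm)
        finally show "dist (G x (X n x)) (G x (Y x)) < e" using K by (simp add: dist_norm)
      qed
    qed
  qed
  have Yi: "Y x = y0 + integral {a..x} (\<lambda>t. G t (Y t))" if x: "x \<in> {a..b}" for x
  proof -
    have "uniform_limit {a..x} (\<lambda>n t. G t (X n t)) (\<lambda>t. G t (Y t)) sequentially"
      using x by (intro uniform_limit_on_subset[OF ULG]) auto
    then obtain I J where IJ: "\<And>n. ((\<lambda>t. G t (X n t)) has_integral I n) {a..x}"
      "((\<lambda>t. G t (Y t)) has_integral J) {a..x}" "I \<longlonglongrightarrow> J"
      by (rule uniform_limit_integral[OF _ Gc[OF x]]) auto
    have "(\<lambda>n. X (Suc n) x) \<longlonglongrightarrow> y0 + J"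
      unfolding XS using IJ(1,3) by (auto intro!: tendsto_intros simp: integral_unique[OF IJ(1)])
    moreover have "(\<lambda>n. X (Suc n) x) \<longlonglongrightarrow> Y x"
      using tendsto_uniform_limitI[OF UL x] by (rule LIMSEQ_Suc)
    ultimately have "Y x = y0 + J" by (rule LIMSEQ_unique[rotated])
    then show ?thesis using IJ(2) by (simp add: integral_unique)
  qed
  show thesis
  proof (cases "a \<le> b")
    case True
    show thesis
    proof (rule that)
      show "Y a = y0" using Yi[of a] True by simp
      fix x assume x: "x \<in> {a..b}"
      have "((\<lambda>x. y0 + integral {a..x} (\<lambda>t. G t (Y t))) has_vector_derivative G x (Y x)) (at x within {a..b})"
        using integral_has_vector_derivative[OF cont[OF Yc] x] by (auto intro!: derivative_eq_intros)
      then show "(Y has_vector_derivative G x (Y x)) (at x within {a..b})"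
        by (rule has_vector_derivative_transform[OF x, rotated]) (rule Yi)
    qed
  next
    case False
    then show thesis using that[of "\<lambda>_. y0"] by simp
  qed
qed

section \<open>Integration by parts and differentiation of indefinite integrals\<close>

lemma continuous_bound:
  fixes f :: "real \<Rightarrow> real"
  assumes "continuous_on {a..b} f"
  obtains B where "B > 0" "\<And>x. x \<in> {a..b} \<Longrightarrow> \<bar>f x\<bar> \<le> B"
proof -
  have "bounded (f ` {a..b})" using assms by (intro compact_imp_bounded compact_continuous_image) auto
  then obtain B where "\<forall>v\<in>f ` {a..b}. norm v \<le> B" "B > 0" unfolding bounded_pos by blast
  then show thesis using that by auto
qed

lemma AE_lebesgue_on_iff_negligible:
  fixes S :: "'a::euclidean_space set"
  assumes "S \<in> sets lebesgue"
  shows "(AE x in lebesgue_on S. P x) \<longleftrightarrow> (\<exists>N. negligible N \<and> (\<forall>x\<in>S - N. P x))"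
proof -
  have "(AE x in lebesgue_on S. P x) \<longleftrightarrow> (AE x in lebesgue. x \<in> S \<longrightarrow> P x)"
    using assms by (subst AE_restrict_space_iff) auto
  also have "\<dots> \<longleftrightarrow> (\<exists>N. negligible N \<and> (\<forall>x\<in>S - N. P x))"
    unfolding eventually_ae_filter negligible_iff_null_sets by (auto simp: subset_iff)
  finally show ?thesis .
qed

lemma absolutely_integrable_mult_continuous:
  fixes g v :: "real \<Rightarrow> real"
  assumes "g absolutely_integrable_on {a..b}" "continuous_on {a..b} v"
  shows "(\<lambda>x. g x * v x) absolutely_integrable_on {a..b}"
proof -
  have "(\<lambda>x. v x * g x) absolutely_integrable_on {a..b}"
  proof (rule absolutely_integrable_bounded_measurable_product_real)
    show "v \<in> borel_measurable (lebesgue_on {a..b})"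
      using assms(2) by (intro continuous_imp_measurable_on_sets_lebesgue) auto
    show "bounded (v ` {a..b})"
      using assms(2) by (intro compact_imp_bounded compact_continuous_image) auto
  qed (use assms in auto)
  then show ?thesis by (simp add: mult.commute)
qed

text \<open>For \<open>b\<close> close to \<open>a\<close> the error in the product rule is a product of two small factors.\<close>

lemma integral_by_parts_C1:
  fixes g v dv :: "real \<Rightarrow> real"
  assumes g: "g absolutely_integrable_on {a..b}"
    and v: "\<And>x. x \<in> {a..b} \<Longrightarrow> (v has_real_derivative dv x) (at x within {a..b})"
    and dv: "continuous_on {a..b} dv"
    and u: "\<And>x. x \<in> {a..b} \<Longrightarrow> u x = u a + integral {a..x} g"
    and x: "x \<in> {a..b}"
  shows "integral {a..x} (\<lambda>t. g t * v t + u t * dv t) = u x * v x - u a * v a"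
proof -
  have gi: "g integrable_on {a..b}" using g by (simp add: absolutely_integrable_on_def)
  have ai: "(\<lambda>t. \<bar>g t\<bar>) integrable_on {a..b}" using g by (simp add: absolutely_integrable_on_def)
  have "continuous_on {a..b} (\<lambda>x. u a + integral {a..x} g)"
    by (intro continuous_intros indefinite_integral_continuous_1 gi)
  then have uc: "continuous_on {a..b} u" by (rule continuous_on_eq) (rule u[symmetric])
  have vc: "continuous_on {a..b} v" by (rule DERIV_continuous_on[OF v])
  obtain L where L0: "L > 0" and L: "\<And>t. t \<in> {a..b} \<Longrightarrow> \<bar>dv t\<bar> \<le> L"
    using continuous_bound[OF dv] by blast
  note L = L L0
  define k where "k t = g t * v t + u t * dv t" for t
  have gvi: "(\<lambda>t. g t * v t) integrable_on {a..b}"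
    using absolutely_integrable_mult_continuous[OF g vc] by (simp add: absolutely_integrable_on_def)
  have udi: "(\<lambda>t. u t * dv t) integrable_on {a..b}"
    by (intro integrable_continuous_real continuous_intros uc dv)
  have ki: "k integrable_on {a..b}" unfolding k_def by (intro integrable_add gvi udi)
  \<comment> \<open>\<open>h\<close> is the defect of the product rule; the aim is h' = 0 at every
    point, although \<open>g\<close> is only an almost everywhere derivative of
    \<open>u\<close>.\<close>
  define h where "h t = u t * v t - integral {a..t} k" for t
  define W where "W t = integral {a..t} (\<lambda>s. \<bar>g s\<bar>)" for t
  have Wc: "continuous_on {a..b} W" unfolding W_def by (rule indefinite_integral_continuous_1[OF ai])
  have sub: "f integrable_on {c..d}" if "f integrable_on {a..b}" "a \<le> c" "d \<le> b" for f :: "real \<Rightarrow> real" and c d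
    using that by (intro integrable_on_subinterval[OF that(1)]) auto
  have comb: "integral {a..d} f = integral {a..c} f + integral {c..d} f"
    if "f integrable_on {a..b}" "a \<le> c" "c \<le> d" "d \<le> b" for f :: "real \<Rightarrow> real" and c d
    by (rule Henstock_Kurzweil_Integration.integral_combine[symmetric, OF that(2,3) sub[OF that(1)]])
      (use that in auto)
  have key: "\<bar>h d - h c\<bar> \<le> 2 * L * \<bar>W d - W c\<bar> * \<bar>d - c\<bar>" if cd: "a \<le> c" "c \<le> d" "d \<le> b" for c d
  proof -
    have Wcd: "W d - W c = integral {c..d} (\<lambda>s. \<bar>g s\<bar>)" unfolding W_def using comb[OF ai cd] by simp
    have ud: "u s - u c = integral {c..s} g" if s: "c \<le> s" "s \<le> d" for s
    proof -
      have "integral {a..s} g = integral {a..c} g + integral {c..s} g"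
        using s cd by (intro comb[OF gi]) linarith+
      moreover have "u s = u a + integral {a..s} g" "u c = u a + integral {a..c} g"
        using s cd by (auto intro!: u simp del: order_refl)
      ultimately show ?thesis by linarith
    qed
    have "(dv has_integral v d - v c) {c..d}"
    proof (rule fundamental_theorem_of_calculus[OF cd(2)])
      fix t assume "t \<in> {c..d}"
      then have "(v has_real_derivative dv t) (at t within {c..d})"
        using cd by (intro DERIV_subset[OF v]) auto
      then show "(v has_vector_derivative dv t) (at t within {c..d})"
        by (simp only: has_real_derivative_iff_has_vector_derivative)
    qed
    then have vd: "integral {c..d} dv = v d - v c" by (rule integral_unique)
    have "h d - h c = u d * v d - u c * v c - integral {c..d} k"
      unfolding h_def using comb[OF ki cd] by simp
    \<comment> \<open>Freezing v at the right and u at the left end point splits the increment of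
      the product exactly; the remaining integrand g (v(d) - v) + (u(c) - u) v' is what has to be
      small.\<close>
    also have "u d * v d - u c * v c = integral {c..d} (\<lambda>s. g s * v d + u c * dv s)"
    proof -
      have "integral {c..d} (\<lambda>s. g s * v d + u c * dv s) = integral {c..d} g * v d + u c * integral {c..d} dv"
        using sub[OF gi cd(1,3)] sub[OF integrable_continuous_real[OF dv] cd(1,3)]
        by (subst integral_add) (auto intro: integrable_on_mult_left integrable_on_mult_right)
      then show ?thesis using ud[of d] vd cd by (simp add: algebra_simps)
    qed
    also have "\<dots> - integral {c..d} k = integral {c..d} (\<lambda>s. g s * v d + u c * dv s - k s)"
      using sub[OF gi cd(1,3)] sub[OF integrable_continuous_real[OF dv] cd(1,3)] sub[OF ki cd(1,3)]
      by (intro Henstock_Kurzweil_Integration.integral_diff[symmetric] integrable_add) (auto intro: integrable_on_mult_left integrable_on_mult_right)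
    also have "\<bar>\<dots>\<bar> \<le> integral {c..d} (\<lambda>s. \<bar>g s\<bar> * (L * (d - c)) + (W d - W c) * L)"
      unfolding real_norm_def[symmetric]
    proof (rule Henstock_Kurzweil_Integration.integral_norm_bound_integral)
      show "(\<lambda>s. g s * v d + u c * dv s - k s) integrable_on {c..d}"
        using sub[OF gi cd(1,3)] sub[OF integrable_continuous_real[OF dv] cd(1,3)] sub[OF ki cd(1,3)]
        by (intro integrable_diff integrable_add) (auto intro: integrable_on_mult_left integrable_on_mult_right)
      show "(\<lambda>s. norm (g s) * (L * (d - c)) + (W d - W c) * L) integrable_on {c..d}"
        using sub[OF ai cd(1,3)] by (intro integrable_add) (auto intro: integrable_on_mult_left)
      fix s assume s: "s \<in> {c..d}"
      have "\<bar>v d - v s\<bar> \<le> L * (d - c)"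
      proof -
        have "norm (v d - v s) \<le> L * norm (d - s)"
        proof (rule field_differentiable_bound[where S = "{a..b}" and f' = dv])
          show "\<And>z. z \<in> {a..b} \<Longrightarrow> (v has_field_derivative dv z) (at z within {a..b})" by (rule v)
        qed (use L(1) s cd in auto)
        also have "\<dots> \<le> L * (d - c)" using s L(2) by auto
        finally show ?thesis by simp
      qed
      then have 1: "\<bar>g s * (v d - v s)\<bar> \<le> \<bar>g s\<bar> * (L * (d - c))"
        unfolding abs_mult by (rule mult_left_mono) simp
      have "\<bar>u s - u c\<bar> \<le> W d - W c"
      proof -
        have "\<bar>u s - u c\<bar> \<le> integral {c..s} (\<lambda>s. \<bar>g s\<bar>)"
        proof -
          have "norm (integral {c..s} g) \<le> integral {c..s} (\<lambda>s. \<bar>g s\<bar>)"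
            by (rule Henstock_Kurzweil_Integration.integral_norm_bound_integral[OF sub[OF gi] sub[OF ai]])
              (use s cd in auto)
          moreover have "u s - u c = integral {c..s} g" using s by (intro ud) auto
          ultimately show ?thesis by simp
        qed
        also have "\<dots> \<le> W d - W c" unfolding Wcd
          using s cd by (intro integral_subset_le sub[OF ai]) auto
        finally show ?thesis .
      qed
      then have 2: "\<bar>(u c - u s) * dv s\<bar> \<le> (W d - W c) * L"
        unfolding abs_mult using L(1)[of s] s cd
        by (intro mult_mono) (simp_all add: abs_minus_commute)
      have "g s * v d + u c * dv s - k s = g s * (v d - v s) + (u c - u s) * dv s"
        by (simp add: k_def algebra_simps)
      then show "norm (g s * v d + u c * dv s - k s) \<le> norm (g s) * (L * (d - c)) + (W d - W c) * L"
        using 1 2 by simp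
    qed
    also have "\<dots> = (W d - W c) * (L * (d - c)) + (W d - W c) * L * (d - c)"
    proof -
      have "integral {c..d} (\<lambda>s. \<bar>g s\<bar> * (L * (d - c)) + (W d - W c) * L)
        = integral {c..d} (\<lambda>s. \<bar>g s\<bar> * (L * (d - c))) + integral {c..d} (\<lambda>s. (W d - W c) * L)"
        using sub[OF ai cd(1,3)] by (intro Henstock_Kurzweil_Integration.integral_add) (auto intro: integrable_on_mult_left)
      then show ?thesis using cd by (simp add: Wcd)
    qed
    also have "\<dots> = 2 * L * \<bar>W d - W c\<bar> * \<bar>d - c\<bar>"
    proof -
      have "W d - W c \<ge> 0" unfolding Wcd by (intro Henstock_Kurzweil_Integration.integral_nonneg sub[OF ai]) (use cd in auto)
      then show ?thesis using cd by (simp add: algebra_simps)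
    qed
    finally show ?thesis by simp
  qed
  have key': "\<bar>h d - h c\<bar> \<le> 2 * L * \<bar>W d - W c\<bar> * \<bar>d - c\<bar>" if "c \<in> {a..b}" "d \<in> {a..b}" for c d
  proof (cases "c \<le> d")
    case True then show ?thesis using that by (intro key) auto
  next
    case False
    then have "\<bar>h c - h d\<bar> \<le> 2 * L * \<bar>W c - W d\<bar> * \<bar>c - d\<bar>" using that by (intro key) auto
    then show ?thesis by (simp only: abs_minus_commute)
  qed
  \<comment> \<open>Dividing the estimate by the step leaves a multiple of the increment of
    \<open>W\<close>, the integral of |g|, which tends to 0 by continuity.\<close>
  have "(h has_real_derivative 0) (at t within {a..b})" if t: "t \<in> {a..b}" for t
  proof -
    have "((\<lambda>s. 2 * L * \<bar>W s - W t\<bar>) \<longlongrightarrow> 2 * L * \<bar>W t - W t\<bar>) (at t within {a..b})"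
      using Wc t by (intro tendsto_intros) (auto simp: continuous_on_def)
    then have "((\<lambda>s. 2 * L * \<bar>W s - W t\<bar>) \<longlongrightarrow> 0) (at t within {a..b})" by simp
    then have "((\<lambda>s. (h s - h t) / (s - t)) \<longlongrightarrow> 0) (at t within {a..b})"
    proof (rule Lim_null_comparison[rotated])
      show "\<forall>\<^sub>F s in at t within {a..b}. norm ((h s - h t) / (s - t)) \<le> 2 * L * \<bar>W s - W t\<bar>"
      proof (unfold eventually_at_filter, intro always_eventually allI impI)
        fix s assume "s \<noteq> t" "s \<in> {a..b}"
        then show "norm ((h s - h t) / (s - t)) \<le> 2 * L * \<bar>W s - W t\<bar>"
          using key'[OF t, of s] by (simp add: abs_divide pos_divide_le_eq)
      qed
    qed
    then show ?thesis by (simp add: has_field_derivative_iff)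
  qed
  then have "\<exists>c. \<forall>t\<in>{a..b}. h t = c"
    by (intro has_field_derivative_zero_constant) auto
  then obtain c where c: "\<forall>t\<in>{a..b}. h t = c" by blast
  have "h x = h a" using bspec[OF c, of x] bspec[OF c, of a] x by simp
  then have "integral {a..x} k = u x * v x - u a * v a" by (simp add: h_def)
  then show ?thesis unfolding k_def[abs_def] .
qed

text \<open>Averages over [x, x + h] with h > 0 give the right-hand difference quotient almost
  everywhere. The left-hand one is the right-hand one of the reflected function, whose exceptional
  set is reflected back into \<open>N\<close>.\<close>

lemma lebesgue_differentiation_interval:
  fixes g :: "real \<Rightarrow> real"
  assumes g: "g absolutely_integrable_on {a..b}"
  obtains N where "negligible N"
    "\<And>x. x \<in> {a<..<b} - N \<Longrightarrow> ((\<lambda>t. integral {a..t} g) has_real_derivative g x) (at x)"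
proof -
  define G where "G t = integral {a..t} g" for t
  define f where "f x = (if x \<in> {a..b} then g x else 0)" for x
  have gi: "g integrable_on {a..b}" using g by (simp add: absolutely_integrable_on_def)
  have fU: "f integrable_on UNIV"
    unfolding f_def integrable_restrict_UNIV using gi by simp
  then have fi: "f integrable_on {c..d}" for c d
    by (rule integrable_on_subinterval) simp
  have rfi: "(\<lambda>x. f (- x)) integrable_on {c..d}" for c d
    using fi[of "-d" "-c"] Henstock_Kurzweil_Integration.integrable_reflect_real[where f=f and a="-d" and b="-c"] by simp
  obtain N1 where N1: "negligible N1" "\<And>x e. x \<notin> N1 \<Longrightarrow> 0 < e \<Longrightarrow>
      \<exists>d>0. \<forall>h. 0 < h \<and> h < d \<longrightarrow> norm (integral (cbox x (x + h *\<^sub>R One)) f /\<^sub>R h ^ DIM(real) - f x) < e"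
    using integrable_ccontinuous_explicit[of f] fi by (metis box_real(2))
  obtain N2 where N2: "negligible N2" "\<And>x e. x \<notin> N2 \<Longrightarrow> 0 < e \<Longrightarrow>
      \<exists>d>0. \<forall>h. 0 < h \<and> h < d \<longrightarrow> norm (integral (cbox x (x + h *\<^sub>R One)) (\<lambda>x. f (- x)) /\<^sub>R h ^ DIM(real) - f (- x)) < e"
    using integrable_ccontinuous_explicit[of "\<lambda>x. f (- x)"] rfi by (metis box_real(2))
  define N where "N = N1 \<union> uminus ` N2"
  have "negligible (uminus ` N2)"
    by (rule negligible_differentiable_image_negligible[OF _ N2(1)]) (auto intro!: derivative_intros)
  then have N: "negligible N" using N1(1) by (simp add: N_def)
  have Gd: "G d - G c = integral {c..d} f" if "a \<le> c" "c \<le> d" "d \<le> b" for c d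
  proof -
    have "integral {a..d} g = integral {a..c} g + integral {c..d} g"
      by (rule Henstock_Kurzweil_Integration.integral_combine[symmetric, OF that(1,2)])
        (use that in \<open>auto intro: integrable_on_subinterval[OF gi]\<close>)
    moreover have "integral {c..d} g = integral {c..d} f"
      by (rule Henstock_Kurzweil_Integration.integral_cong) (use that in \<open>auto simp: f_def\<close>)
    ultimately show ?thesis by (simp add: G_def)
  qed
  have "(G has_real_derivative g x) (at x)" if x: "x \<in> {a<..<b} - N" for x
  proof -
    have fx: "f x = g x" using x by (simp add: f_def)
    have x1: "x \<notin> N1" using x by (simp add: N_def)
    have x2: "- x \<notin> N2"
    proof
      assume "- x \<in> N2"
      then have "- (- x) \<in> uminus ` N2" by (rule imageI)
      then show False using x by (simp add: N_def)
    qed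
    have "\<exists>d>0. \<forall>h. h \<noteq> 0 \<and> \<bar>h\<bar> < d \<longrightarrow> \<bar>(G (x + h) - G x) / h - g x\<bar> < e" if e: "e > 0" for e
    proof -
      obtain d1 where d1: "d1 > 0" "\<And>h. 0 < h \<Longrightarrow> h < d1 \<Longrightarrow> \<bar>integral {x..x + h} f / h - f x\<bar> < e"
        using N1(2)[OF x1 e] by (auto simp: divide_inverse_commute)
      obtain d2 where d2: "d2 > 0" "\<And>h. 0 < h \<Longrightarrow> h < d2 \<Longrightarrow> \<bar>integral {- x..- x + h} (\<lambda>x. f (- x)) / h - f x\<bar> < e"
        using N2(2)[OF x2 e] by (auto simp: divide_inverse_commute)
      define d where "d = min (min d1 d2) (min (x - a) (b - x))"
      have "d > 0" using d1 d2 x by (simp add: d_def)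
      moreover have "\<bar>(G (x + h) - G x) / h - g x\<bar> < e" if h: "h \<noteq> 0" "\<bar>h\<bar> < d" for h
      proof (cases "h > 0")
        case True
        then have "G (x + h) - G x = integral {x..x + h} f"
          using h x by (intro Gd) (auto simp: d_def)
        then show ?thesis using d1(2)[of h] True h fx by (simp add: d_def)
      next
        case False
        then have "G x - G (x + h) = integral {x + h..x} f"
          using h x by (intro Gd) (auto simp: d_def)
        also have "\<dots> = integral {- x..- x + - h} (\<lambda>x. f (- x))"
          using Henstock_Kurzweil_Integration.integral_reflect_real[where f=f and a="x + h" and b=x] by simp
        finally have "(G (x + h) - G x) / h = integral {- x..- x + - h} (\<lambda>x. f (- x)) / (- h)"
          by (simp add: field_simps)
        then show ?thesis using d2(2)[of "- h"] False h fx by (simp add: d_def)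
      qed
      ultimately show ?thesis by blast
    qed
    then show ?thesis
      unfolding DERIV_def LIM_def by (simp add: dist_norm)
  qed
  then show thesis using that[OF N] by (simp add: G_def[abs_def])
qed

text \<open>The quasi-derivative \<open>z = y' - Q y\<close>, with \<open>Q\<close> an antiderivative of the potential, turns the
  equation into a system with continuous coefficients.\<close>

definition qsys :: "(real \<Rightarrow> real) \<Rightarrow> real \<Rightarrow> (real \<Rightarrow> real) \<Rightarrow> (real \<Rightarrow> real) \<Rightarrow> bool" where
  "qsys Q l y z \<longleftrightarrow> (\<forall>x\<in>{0..pi}.
     (y has_real_derivative z x + Q x * y x) (at x within {0..pi}) \<and>
     (z has_real_derivative - (l + (Q x)\<^sup>2) * y x - Q x * z x) (at x within {0..pi}))"

lemma qsysD:
  assumes "qsys Q l y z" "x \<in> {0..pi}"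
  shows "(y has_real_derivative z x + Q x * y x) (at x within {0..pi})"
    "(z has_real_derivative - (l + (Q x)\<^sup>2) * y x - Q x * z x) (at x within {0..pi})"
  using assms by (auto simp: qsys_def)

lemma qsys_exists:
  assumes Q: "continuous_on {0..pi} Q"
  obtains y z where "qsys Q l y z" "y 0 = a" "z 0 = b"
proof -
  obtain B where B0: "B > 0" and B: "\<And>x. x \<in> {0..pi} \<Longrightarrow> \<bar>Q x\<bar> \<le> B"
    using continuous_bound[OF Q] by blast
  define G where "G x v = (snd v + Q x * fst v, - (l + (Q x)\<^sup>2) * fst v - Q x * snd v)" for x and v :: "real \<times> real"
  define K where "K = (1 + B) + (\<bar>l\<bar> + B\<^sup>2 + B)"
  have lip: "norm (G x u - G x v) \<le> K * norm (u - v)" if x: "x \<in> {0..pi}" for x u v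
  proof -
    define s t where "s = fst (u - v)" and "t = snd (u - v)"
    have st: "\<bar>s\<bar> \<le> norm (u - v)" "\<bar>t\<bar> \<le> norm (u - v)"
      unfolding s_def t_def by (metis norm_fst_le norm_snd_le prod.collapse real_norm_def)+
    have q: "\<bar>Q x\<bar> \<le> B" by (rule B[OF x])
    have q2: "(Q x)\<^sup>2 \<le> B\<^sup>2" using q B0 by (metis abs_le_square_iff abs_of_pos)
    have "G x u - G x v = (t + Q x * s, - (l + (Q x)\<^sup>2) * s - Q x * t)"
      by (simp add: G_def s_def t_def algebra_simps)
    then have "norm (G x u - G x v) \<le> \<bar>t + Q x * s\<bar> + \<bar>- (l + (Q x)\<^sup>2) * s - Q x * t\<bar>"
      using norm_Pair_le by (metis real_norm_def)
    also have "\<bar>t + Q x * s\<bar> \<le> \<bar>t\<bar> + \<bar>Q x\<bar> * \<bar>s\<bar>"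
      by (metis abs_mult abs_triangle_ineq)
    also have "\<dots> \<le> norm (u - v) + B * norm (u - v)"
      using st q B0 by (intro add_mono mult_mono) auto
    also have "\<bar>- (l + (Q x)\<^sup>2) * s - Q x * t\<bar> \<le> \<bar>l + (Q x)\<^sup>2\<bar> * \<bar>s\<bar> + \<bar>Q x\<bar> * \<bar>t\<bar>"
      using abs_triangle_ineq4[of "- (l + (Q x)\<^sup>2) * s" "Q x * t"] by (simp only: abs_mult abs_minus_cancel)
    also have "\<dots> \<le> (\<bar>l\<bar> + B\<^sup>2) * norm (u - v) + B * norm (u - v)"
    proof -
      have "\<bar>l + (Q x)\<^sup>2\<bar> \<le> \<bar>l\<bar> + B\<^sup>2" using abs_triangle_ineq[of l "(Q x)\<^sup>2"] q2 by simp
      then show ?thesis using st q B0 by (intro add_mono mult_mono) auto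
    qed
    finally show ?thesis by (simp add: K_def algebra_simps)
  qed
  have "continuous_on {0..pi} (\<lambda>x. G x (Y x))" if "continuous_on {0..pi} Y" for Y
    unfolding G_def by (intro continuous_intros that Q)
  moreover have "K \<ge> 0" using B0 by (simp add: K_def)
  ultimately obtain Y where Y: "Y 0 = (a, b)"
    "\<And>x. x \<in> {0..pi} \<Longrightarrow> (Y has_vector_derivative G x (Y x)) (at x within {0..pi})"
    using global_picard[of K 0 pi G "(a, b)"] lip by blast
  have "qsys Q l (\<lambda>x. fst (Y x)) (\<lambda>x. snd (Y x))"
    unfolding qsys_def has_real_derivative_iff_has_vector_derivative
  proof (intro ballI conjI)
    fix x assume "x \<in> {0..pi}"
    note D = Y(2)[OF this]
    show "((\<lambda>x. fst (Y x)) has_vector_derivative snd (Y x) + Q x * fst (Y x)) (at x within {0..pi})"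
      using bounded_linear.has_vector_derivative[OF bounded_linear_fst D] by (simp add: G_def)
    show "((\<lambda>x. snd (Y x)) has_vector_derivative - (l + (Q x)\<^sup>2) * fst (Y x) - Q x * snd (Y x)) (at x within {0..pi})"
      using bounded_linear.has_vector_derivative[OF bounded_linear_snd D] by (simp add: G_def)
  qed
  then show thesis using that Y(1) by simp
qed

text \<open>With quasi-derivatives this is still the classical Wronskian, because the terms with Q
  cancel. Here \<open>y'\<close> and \<open>z'\<close> belong to the second solution and are not
  derivatives.\<close>

lemma qsys_wronskian:
  assumes "qsys Q l y z" "qsys Q m y' z'" "x \<in> {0..pi}"
  shows "((\<lambda>x. z x * y' x - y x * z' x) has_real_derivative (m - l) * (y x * y' x)) (at x within {0..pi})"
  by (rule DERIV_cong[OF DERIV_diff[OF DERIV_mult[OF qsysD(2)[OF assms(1,3)] qsysD(1)[OF assms(2,3)]]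
        DERIV_mult[OF qsysD(1)[OF assms(1,3)] qsysD(2)[OF assms(2,3)]]]])
    (simp add: algebra_simps power2_eq_square)

section \<open>Monotonicity, uniqueness and dependence on the parameter\<close>

lemma mvt_within:
  fixes f :: "real \<Rightarrow> real"
  assumes f: "\<And>x. x \<in> {a..b} \<Longrightarrow> (f has_real_derivative f' x) (at x within {a..b})"
    and xy: "a \<le> x" "x < y" "y \<le> b"
  obtains z where "x < z" "z < y" "f y - f x = f' z * (y - x)"
proof -
  have "\<exists>z\<in>{x<..<y}. f y - f x = (\<lambda>h. f' z * h) (y - x)"
  proof (rule mvt_simple[OF xy(2)])
    fix z assume "x \<le> z" "z \<le> y"
    then have "(f has_real_derivative f' z) (at z within {x..y})"
      using xy by (intro DERIV_subset[OF f]) auto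
    then show "(f has_derivative (\<lambda>h. f' z * h)) (at z within {x..y})"
      by (simp add: has_field_derivative_def)
  qed
  then show thesis using that by auto
qed

lemma nonincreasing_on_interval:
  fixes f :: "real \<Rightarrow> real"
  assumes f: "\<And>x. x \<in> {a..b} \<Longrightarrow> (f has_real_derivative f' x) (at x within {a..b})"
    and le: "\<And>z. x < z \<Longrightarrow> z < y \<Longrightarrow> f' z \<le> 0" and xy: "a \<le> x" "x \<le> y" "y \<le> b"
  shows "f y \<le> f x"
proof (cases "x = y")
  case False
  then have "x < y" using xy by simp
  obtain z where z: "x < z" "z < y" "f y - f x = f' z * (y - x)"
    by (rule mvt_within[OF f xy(1) \<open>x < y\<close> xy(3)])
  then have "f' z * (y - x) \<le> 0" using le[of z] by (intro mult_nonpos_nonneg) auto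
  then show ?thesis using z(3) by simp
qed simp

lemma strict_increasing_on_interval:
  fixes f :: "real \<Rightarrow> real"
  assumes f: "\<And>x. x \<in> {a..b} \<Longrightarrow> (f has_real_derivative f' x) (at x within {a..b})"
    and pos: "\<And>z. x < z \<Longrightarrow> z < y \<Longrightarrow> f' z > 0" and xy: "a \<le> x" "x < y" "y \<le> b"
  shows "f x < f y"
proof -
  obtain z where z: "x < z" "z < y" "f y - f x = f' z * (y - x)"
    by (rule mvt_within[OF f xy])
  then have "f' z * (y - x) > 0" using pos[of z] by (intro mult_pos_pos) auto
  then show ?thesis using z(3) by simp
qed

lemma constant_on_interval:
  fixes f :: "real \<Rightarrow> real"
  assumes "\<And>x. x \<in> {a..b} \<Longrightarrow> (f has_real_derivative 0) (at x within {a..b})" "x \<in> {a..b}" "y \<in> {a..b}"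
  shows "f x = f y"
  using has_field_derivative_zero_constant[of "{a..b}" f] assms by (metis convex_real_interval(5))

text \<open>The data at \<open>x0\<close> fix the constant Wronskians of a solution with a
  fundamental pair C, S. As the Wronskian of C and S is 1, these two numbers determine the solution
  everywhere.\<close>

lemma qsys_unique:
  assumes Q: "continuous_on {0..pi} Q" and y: "qsys Q l y z" and y': "qsys Q l y' z'"
    and x0: "x0 \<in> {0..pi}" "y x0 = y' x0" "z x0 = z' x0" and x: "x \<in> {0..pi}"
  shows "y x = y' x" "z x = z' x"
proof -
  obtain C Cz where C: "qsys Q l C Cz" "C 0 = 1" "Cz 0 = 0" by (rule qsys_exists[OF Q])
  obtain S Sz where S: "qsys Q l S Sz" "S 0 = 0" "Sz 0 = 1" by (rule qsys_exists[OF Q])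
  have const: "z1 s * y2 s - y1 s * z2 s = z1 t * y2 t - y1 t * z2 t"
    if "qsys Q l y1 z1" "qsys Q l y2 z2" "s \<in> {0..pi}" "t \<in> {0..pi}" for y1 z1 y2 z2 s t
    using qsys_wronskian[OF that(1,2)] that(3,4)
    by (intro constant_on_interval[of 0 pi "\<lambda>x. z1 x * y2 x - y1 x * z2 x"]) auto
  have CS: "Sz x * C x - S x * Cz x = 1" using const[OF S(1) C(1) x, of 0] C S by simp
  have 1: "z x * C x - y x * Cz x = z' x * C x - y' x * Cz x"
    using const[OF y C(1) x x0(1)] const[OF y' C(1) x x0(1)] x0 by simp
  have 2: "z x * S x - y x * Sz x = z' x * S x - y' x * Sz x"
    using const[OF y S(1) x x0(1)] const[OF y' S(1) x x0(1)] x0 by simp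
  have "y x - y' x = (y x - y' x) * (Sz x * C x - S x * Cz x)" by (simp add: CS)
  also have "\<dots> = S x * (z x * C x - y x * Cz x - (z' x * C x - y' x * Cz x))
      - C x * (z x * S x - y x * Sz x - (z' x * S x - y' x * Sz x))" by (simp add: algebra_simps)
  finally show "y x = y' x" using 1 2 by simp
  have "z x - z' x = (z x - z' x) * (Sz x * C x - S x * Cz x)" by (simp add: CS)
  also have "\<dots> = Sz x * (z x * C x - y x * Cz x - (z' x * C x - y' x * Cz x))
      - Cz x * (z x * S x - y x * Sz x - (z' x * S x - y' x * Sz x))" by (simp add: algebra_simps)
  finally show "z x = z' x" using 1 2 by simp
qed

lemma qsys_comb:
  assumes "qsys Q l y z" "qsys Q l y' z'"
  shows "qsys Q l (\<lambda>x. a * y x + b * y' x) (\<lambda>x. a * z x + b * z' x)"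
  unfolding qsys_def
proof (intro ballI conjI)
  fix x assume x: "x \<in> {0..pi}"
  show "((\<lambda>x. a * y x + b * y' x) has_real_derivative a * z x + b * z' x + Q x * (a * y x + b * y' x)) (at x within {0..pi})"
    by (rule DERIV_cong[OF DERIV_add[OF DERIV_cmult[OF qsysD(1)[OF assms(1) x]] DERIV_cmult[OF qsysD(1)[OF assms(2) x]]]])
      (simp add: algebra_simps)
  show "((\<lambda>x. a * z x + b * z' x) has_real_derivative
     - (l + (Q x)\<^sup>2) * (a * y x + b * y' x) - Q x * (a * z x + b * z' x)) (at x within {0..pi})"
    by (rule DERIV_cong[OF DERIV_add[OF DERIV_cmult[OF qsysD(2)[OF assms(1) x]] DERIV_cmult[OF qsysD(2)[OF assms(2) x]]]])
      (simp add: algebra_simps)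
qed

lemma qsys_exists_at:
  assumes Q: "continuous_on {0..pi} Q" and x0: "x0 \<in> {0..pi}"
  obtains y z where "qsys Q l y z" "y x0 = a" "z x0 = b"
proof -
  obtain C Cz where C: "qsys Q l C Cz" "C 0 = 1" "Cz 0 = 0" by (rule qsys_exists[OF Q])
  obtain S Sz where S: "qsys Q l S Sz" "S 0 = 0" "Sz 0 = 1" by (rule qsys_exists[OF Q])
  have "Sz x0 * C x0 - S x0 * Cz x0 = Sz 0 * C 0 - S 0 * Cz 0"
    using qsys_wronskian[OF S(1) C(1)] x0
    by (intro constant_on_interval[of 0 pi "\<lambda>x. Sz x * C x - S x * Cz x"]) auto
  then have CS: "Sz x0 * C x0 - S x0 * Cz x0 = 1" using C S by simp
  \<comment> \<open>Cramer's rule for the coefficients in the basis C, S, whose determinant is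
    1.\<close>
  define p q where "p = a * Sz x0 - b * S x0" and "q = b * C x0 - a * Cz x0"
  have "p * C x0 + q * S x0 = a * (Sz x0 * C x0 - S x0 * Cz x0)" by (simp add: p_def q_def algebra_simps)
  moreover have "p * Cz x0 + q * Sz x0 = b * (Sz x0 * C x0 - S x0 * Cz x0)" by (simp add: p_def q_def algebra_simps)
  ultimately show thesis using that[OF qsys_comb[OF C(1) S(1), of p q]] by (simp add: CS)
qed


text \<open>Gronwall's inequality for the squared distance of two solutions.\<close>

lemma qsys_perturbation:
  assumes Q: "continuous_on {0..pi} Q" and y0: "qsys Q l0 y0 z0"
  obtains K where "K > 0" "\<And>l y z x. \<bar>l - l0\<bar> \<le> 1 \<Longrightarrow> qsys Q l y z \<Longrightarrow> x \<in> {0..pi} \<Longrightarrow>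
    (y x - y0 x)\<^sup>2 + (z x - z0 x)\<^sup>2 \<le> K * ((y 0 - y0 0)\<^sup>2 + (z 0 - z0 0)\<^sup>2 + (l - l0)\<^sup>2)"
proof -
  have y0c: "continuous_on {0..pi} y0"
    by (rule DERIV_continuous_on[OF qsysD(1)[OF y0]])
  obtain B where B0: "B > 0" and B: "\<And>x. x \<in> {0..pi} \<Longrightarrow> \<bar>Q x\<bar> \<le> B"
    using continuous_bound[OF Q] by blast
  obtain M where M0: "M > 0" and M: "\<And>x. x \<in> {0..pi} \<Longrightarrow> \<bar>y0 x\<bar> \<le> M"
    using continuous_bound[OF y0c] by blast
  \<comment> \<open>\<open>K1\<close> collects the bounds in E' \<le> K1 E + c for |l - l0| \<le> 1:
    2 + |l0| + B^2 from the mixed term, 2 B from the diagonal terms, and 1 from splitting off the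
    inhomogeneity (l - l0) y0.\<close>
  define K1 where "K1 = 3 + \<bar>l0\<bar> + B\<^sup>2 + 2 * B"
  define K where "K = (1 + M\<^sup>2 * pi) * exp (K1 * pi)"
  have K1: "K1 > 0" using B0 by (simp add: K1_def add_pos_nonneg)
  have K: "K > 0" by (simp add: K_def add_pos_nonneg)
  show thesis
  proof (rule that[OF K])
    fix l y z x
    assume l: "\<bar>l - l0\<bar> \<le> 1" and y: "qsys Q l y z" and x: "x \<in> {0..pi}"
    define u v where "u t = y t - y0 t" and "v t = z t - z0 t" for t
    define E where "E t = (u t)\<^sup>2 + (v t)\<^sup>2" for t
    define E' where "E' t = 2 * u t * (v t + Q t * u t) + 2 * v t * (- (l + (Q t)\<^sup>2) * u t - Q t * v t - (l - l0) * y0 t)" for t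
    define c where "c = (l - l0)\<^sup>2 * M\<^sup>2"
    have u': "(u has_real_derivative v t + Q t * u t) (at t within {0..pi})" if "t \<in> {0..pi}" for t
      unfolding u_def v_def
      by (rule DERIV_cong[OF DERIV_diff[OF qsysD(1)[OF y that] qsysD(1)[OF y0 that]]]) (simp add: algebra_simps)
    have v': "(v has_real_derivative - (l + (Q t)\<^sup>2) * u t - Q t * v t - (l - l0) * y0 t) (at t within {0..pi})" if "t \<in> {0..pi}" for t
      unfolding u_def v_def
      by (rule DERIV_cong[OF DERIV_diff[OF qsysD(2)[OF y that] qsysD(2)[OF y0 that]]]) (simp add: algebra_simps)
    have E'd: "(E has_real_derivative E' t) (at t within {0..pi})" if "t \<in> {0..pi}" for t
      unfolding E_def power2_eq_square
      by (rule DERIV_cong[OF DERIV_add[OF DERIV_mult[OF u'[OF that] u'[OF that]] DERIV_mult[OF v'[OF that] v'[OF that]]]])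
        (simp add: E'_def algebra_simps power2_eq_square)
    have E'le: "E' t \<le> K1 * E t + c" if t: "t \<in> {0..pi}" for t
    proof -
      have uv: "2 * \<bar>u t * v t\<bar> \<le> E t"
        using sum_squares_bound[of "\<bar>u t\<bar>" "\<bar>v t\<bar>"] by (simp add: E_def abs_mult)
      have q2: "(Q t)\<^sup>2 \<le> B\<^sup>2" using B[OF t] B0 by (metis abs_le_square_iff abs_of_pos)
      have "\<bar>1 - (l + (Q t)\<^sup>2)\<bar> \<le> 2 + \<bar>l0\<bar> + B\<^sup>2"
        using l q2 by (smt (verit) zero_le_power2)
      then have "2 * (u t * v t) * (1 - (l + (Q t)\<^sup>2)) \<le> E t * (2 + \<bar>l0\<bar> + B\<^sup>2)"
      proof -
        assume a: "\<bar>1 - (l + (Q t)\<^sup>2)\<bar> \<le> 2 + \<bar>l0\<bar> + B\<^sup>2"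
        have "2 * (u t * v t) * (1 - (l + (Q t)\<^sup>2)) \<le> \<bar>2 * (u t * v t) * (1 - (l + (Q t)\<^sup>2))\<bar>" by (rule abs_ge_self)
        also have "\<dots> = (2 * \<bar>u t * v t\<bar>) * \<bar>1 - (l + (Q t)\<^sup>2)\<bar>" by (simp add: abs_mult)
        also have "\<dots> \<le> E t * (2 + \<bar>l0\<bar> + B\<^sup>2)" using uv a by (intro mult_mono) (auto simp: E_def)
        finally show ?thesis .
      qed
      moreover have "2 * Q t * ((u t)\<^sup>2 - (v t)\<^sup>2) \<le> 2 * B * E t"
      proof -
        have "\<bar>(u t)\<^sup>2 - (v t)\<^sup>2\<bar> \<le> E t" by (simp add: E_def abs_le_iff)
        then have "\<bar>Q t\<bar> * \<bar>(u t)\<^sup>2 - (v t)\<^sup>2\<bar> \<le> B * E t" using B[OF t] B0 by (intro mult_mono) auto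
        then show ?thesis using abs_ge_self[of "Q t * ((u t)\<^sup>2 - (v t)\<^sup>2)"] by (simp add: abs_mult)
      qed
      moreover have "- 2 * v t * (l - l0) * y0 t \<le> E t + c"
      proof -
        have "(y0 t)\<^sup>2 \<le> M\<^sup>2" using M[OF t] M0 by (metis abs_le_square_iff abs_of_pos)
        then have "((l - l0) * y0 t)\<^sup>2 \<le> c" by (simp add: c_def power_mult_distrib mult_left_mono)
        moreover have "- 2 * v t * ((l - l0) * y0 t) \<le> (v t)\<^sup>2 + ((l - l0) * y0 t)\<^sup>2"
          using zero_le_power2[of "v t + (l - l0) * y0 t"] by (simp add: power2_sum)
        ultimately have "- 2 * v t * ((l - l0) * y0 t) \<le> (v t)\<^sup>2 + c" by linarith
        then show ?thesis using zero_le_power2[of "u t"] unfolding E_def mult.assoc by linarith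
      qed
      moreover have "E' t = 2 * (u t * v t) * (1 - (l + (Q t)\<^sup>2)) + 2 * Q t * ((u t)\<^sup>2 - (v t)\<^sup>2) + (- 2 * v t * (l - l0) * y0 t)"
        by (simp add: E'_def algebra_simps power2_eq_square)
      ultimately show ?thesis by (simp add: K1_def algebra_simps)
    qed
    have c0: "c \<ge> 0" by (simp add: c_def)
    \<comment> \<open>The factor exp (-K1 x) removes the linear term and is at most 1, so the
      inhomogeneity contributes no more than c x.\<close>
    have "E x * exp (- K1 * x) - c * x \<le> E 0 * exp (- K1 * 0) - c * 0"
    proof (rule nonincreasing_on_interval[where a = 0 and b = pi and x = 0 and y = x
          and f = "\<lambda>x. E x * exp (- K1 * x) - c * x"
          and f' = "\<lambda>t. (E' t * exp (- K1 * t) + exp (- K1 * t) * (- K1) * E t) - c"])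
      fix t assume "t \<in> {0..pi}"
      then show "((\<lambda>x. E x * exp (- K1 * x) - c * x) has_real_derivative
         (E' t * exp (- K1 * t) + exp (- K1 * t) * (- K1) * E t) - c) (at t within {0..pi})"
        by (intro DERIV_diff DERIV_mult E'd) (auto intro!: derivative_eq_intros)
    next
      fix t assume t: "0 < t" "t < x"
      then have "E' t - K1 * E t \<le> c" using E'le[of t] x by simp
      then have "(E' t - K1 * E t) * exp (- K1 * t) \<le> c * exp (- K1 * t)"
        by (rule mult_right_mono) simp
      also have "\<dots> \<le> c * 1" using t K1 c0 by (intro mult_left_mono) auto
      finally show "(E' t * exp (- K1 * t) + exp (- K1 * t) * (- K1) * E t) - c \<le> 0"
        by (simp add: algebra_simps)
    qed (use x in auto)
    then have "E x * exp (- K1 * x) \<le> E 0 + c * x" by simp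
    then have "E x * exp (- K1 * x) * exp (K1 * x) \<le> (E 0 + c * x) * exp (K1 * x)"
      by (rule mult_right_mono) simp
    then have "E x \<le> (E 0 + c * x) * exp (K1 * x)" by (simp add: mult.assoc flip: exp_add)
    also have "\<dots> \<le> (E 0 + c * pi) * exp (K1 * pi)"
      using x c0 K1 by (intro mult_mono add_mono mult_left_mono) (auto simp: E_def)
    also have "E 0 + c * pi \<le> (1 + M\<^sup>2 * pi) * (E 0 + (l - l0)\<^sup>2)"
      by (simp add: c_def E_def algebra_simps)
    finally show "(y x - y0 x)\<^sup>2 + (z x - z0 x)\<^sup>2 \<le> K * ((y 0 - y0 0)\<^sup>2 + (z 0 - z0 0)\<^sup>2 + (l - l0)\<^sup>2)"
      by (simp add: E_def u_def v_def K_def mult_ac mult_right_mono)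
  qed
qed

text \<open>\<open>Q\<close> is any antiderivative, not normalised at 0: the transformation by u
  turns it into Q - 2 u'/u, which need not vanish there.\<close>

definition potential :: "(real \<Rightarrow> real) \<Rightarrow> (real \<Rightarrow> real) \<Rightarrow> bool" where
  "potential q Q \<longleftrightarrow> q absolutely_integrable_on {0..pi} \<and> (\<forall>x\<in>{0..pi}. Q x = Q 0 + integral {0..x} q)"

lemma absolutely_integrable_Ioo_iff:
  fixes q :: "real \<Rightarrow> real"
  shows "q absolutely_integrable_on {a<..<b} \<longleftrightarrow> q absolutely_integrable_on {a..b}"
proof (rule absolutely_integrable_spike_set_eq)
  show "negligible {x \<in> {a<..<b} - {a..b}. q x \<noteq> 0}"
    by (rule negligible_subset[of "{}"]) auto
  show "negligible {x \<in> {a..b} - {a<..<b}. q x \<noteq> 0}"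
    by (rule negligible_subset[of "{a, b}"]) auto
qed

lemma potentialI:
  assumes "q absolutely_integrable_on {0<..<pi}"
  shows "potential q (\<lambda>x. integral {0..x} q)"
  using assms by (simp add: potential_def absolutely_integrable_Ioo_iff)

lemma potential_continuous:
  assumes "potential q Q"
  shows "continuous_on {0..pi} Q"
proof -
  have "continuous_on {0..pi} (\<lambda>x. Q 0 + integral {0..x} q)"
    using assms by (intro continuous_intros indefinite_integral_continuous_1)
      (auto simp: potential_def absolutely_integrable_on_def)
  then show ?thesis by (rule continuous_on_eq) (use assms in \<open>unfold potential_def, metis\<close>)
qed

text \<open>The equation says y' = y'(0) + \<integral> (q - l) y. Integrating q y + Q y' by parts
  moves q into Q, and y' - Q y becomes the integral of the continuous function -(l y + Q y'), hence
  continuously differentiable. Read backwards, this gives the converse.\<close>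

lemma is_solution_iff_qsys:
  assumes p: "potential q Q"
  shows "is_solution q l (y, dy) \<longleftrightarrow> qsys Q l y (\<lambda>x. dy x - Q x * y x)"
proof -
  have q: "q absolutely_integrable_on {0..pi}" and Q: "\<And>x. x \<in> {0..pi} \<Longrightarrow> Q x = Q 0 + integral {0..x} q"
    using p unfolding potential_def by blast+
  note Qc = potential_continuous[OF p]
  have sub: "f integrable_on {0..x}" if "f integrable_on {0..pi}" "x \<in> {0..pi}" for f :: "real \<Rightarrow> real" and x
    using that(2) by (intro integrable_on_subinterval[OF that(1)]) auto
  have parts: "integral {0..x} (\<lambda>t. q t * y t - l * y t) + integral {0..x} (\<lambda>t. l * y t + Q t * dy t) = Q x * y x - Q 0 * y 0"
    if y: "\<And>x. x \<in> {0..pi} \<Longrightarrow> (y has_real_derivative dy x) (at x within {0..pi})"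
      and dy: "continuous_on {0..pi} dy" and x: "x \<in> {0..pi}" for x
  proof -
    have yc: "continuous_on {0..pi} y" by (rule DERIV_continuous_on[OF y])
    have i0: "(\<lambda>t. q t * y t) integrable_on {0..pi}"
      using absolutely_integrable_mult_continuous[OF q yc] by (simp add: absolutely_integrable_on_def)
    have i1: "(\<lambda>t. l * y t) integrable_on {0..pi}" "(\<lambda>t. l * y t + Q t * dy t) integrable_on {0..pi}"
      by (intro integrable_continuous_real continuous_intros yc Qc dy)+
    have "integral {0..x} (\<lambda>t. q t * y t - l * y t) + integral {0..x} (\<lambda>t. l * y t + Q t * dy t)
      = integral {0..x} (\<lambda>t. (q t * y t - l * y t) + (l * y t + Q t * dy t))"
      by (rule Henstock_Kurzweil_Integration.integral_add[symmetric, OF sub[OF integrable_diff[OF i0 i1(1)] x] sub[OF i1(2) x]])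
    also have "\<dots> = integral {0..x} (\<lambda>t. q t * y t + Q t * dy t)" by simp
    also have "\<dots> = Q x * y x - Q 0 * y 0" by (rule integral_by_parts_C1[OF q y dy Q x])
    finally show ?thesis .
  qed
  show ?thesis
  proof
    assume s: "is_solution q l (y, dy)"
    then have y: "(y has_real_derivative dy x) (at x within {0..pi})" if "x \<in> {0..pi}" for x
      using that by (auto simp: is_solution_def)
    obtain ddy where ddy: "has_ac_derivative dy ddy" and ae: "AE x in lebesgue_on {0<..<pi}. - ddy x + q x * y x = l * y x"
      using s by (auto simp: is_solution_def)
    have di: "ddy absolutely_integrable_on {0..pi}" and dyi: "\<And>x. x \<in> {0..pi} \<Longrightarrow> dy x = dy 0 + integral {0..x} ddy"
      using ddy unfolding has_ac_derivative_def by blast+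
    have "continuous_on {0..pi} (\<lambda>x. dy 0 + integral {0..x} ddy)"
      using di by (intro continuous_intros indefinite_integral_continuous_1) (auto simp: absolutely_integrable_on_def)
    then have dyc: "continuous_on {0..pi} dy" by (rule continuous_on_eq) (rule dyi[symmetric])
    have yc: "continuous_on {0..pi} y" by (rule DERIV_continuous_on[OF y])
    obtain N where N: "negligible N" "\<And>x. x \<in> {0<..<pi} - N \<Longrightarrow> - ddy x + q x * y x = l * y x"
      using ae by (auto simp: AE_lebesgue_on_iff_negligible)
    have z: "dy x - Q x * y x = (dy 0 - Q 0 * y 0) - integral {0..x} (\<lambda>t. l * y t + Q t * dy t)" if x: "x \<in> {0..pi}" for x
    proof -
      have "integral {0..x} ddy = integral {0..x} (\<lambda>t. q t * y t - l * y t)"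
      proof (rule integral_spike[of "N \<union> {0, pi}"])
        show "negligible (N \<union> {0, pi})" using N(1) by simp
        fix t assume "t \<in> {0..x} - (N \<union> {0, pi})"
        then show "q t * y t - l * y t = ddy t" using N(2)[of t] x by auto
      qed
      then show ?thesis using parts[OF y dyc x] dyi[OF x] by linarith
    qed
    show "qsys Q l y (\<lambda>x. dy x - Q x * y x)"
      unfolding qsys_def
    proof (intro ballI conjI)
      fix x assume x: "x \<in> {0..pi}"
      show "(y has_real_derivative dy x - Q x * y x + Q x * y x) (at x within {0..pi})" using y[OF x] by simp
      have "((\<lambda>x. (dy 0 - Q 0 * y 0) - integral {0..x} (\<lambda>t. l * y t + Q t * dy t)) has_real_derivative
          0 - (l * y x + Q x * dy x)) (at x within {0..pi})"
        by (intro DERIV_diff DERIV_const integral_has_real_derivative continuous_intros yc dyc Qc x)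
      then have "((\<lambda>x. dy x - Q x * y x) has_real_derivative 0 - (l * y x + Q x * dy x)) (at x within {0..pi})"
        by (rule has_field_derivative_transform_within[OF _ zero_less_one x]) (rule z[symmetric])
      then show "((\<lambda>x. dy x - Q x * y x) has_real_derivative - (l + (Q x)\<^sup>2) * y x - Q x * (dy x - Q x * y x)) (at x within {0..pi})"
        by (rule DERIV_cong) (simp add: algebra_simps power2_eq_square)
    qed
  next
    assume s: "qsys Q l y (\<lambda>x. dy x - Q x * y x)"
    have y: "(y has_real_derivative dy x) (at x within {0..pi})" if "x \<in> {0..pi}" for x
      using qsysD(1)[OF s that] by simp
    have z': "((\<lambda>x. dy x - Q x * y x) has_real_derivative - (l * y x + Q x * dy x)) (at x within {0..pi})" if "x \<in> {0..pi}" for x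
      by (rule DERIV_cong[OF qsysD(2)[OF s that]]) (simp add: algebra_simps power2_eq_square)
    have yc: "continuous_on {0..pi} y" by (rule DERIV_continuous_on[OF y])
    have "continuous_on {0..pi} (\<lambda>x. (dy x - Q x * y x) + Q x * y x)"
      by (intro continuous_on_add continuous_on_mult Qc yc DERIV_continuous_on[OF z'])
    then have dyc: "continuous_on {0..pi} dy" by simp
    define ddy where "ddy x = q x * y x - l * y x" for x
    have "has_ac_derivative dy ddy"
      unfolding has_ac_derivative_def
    proof (intro conjI ballI)
      show "ddy absolutely_integrable_on {0..pi}"
        unfolding ddy_def
        by (intro set_integral_diff absolutely_integrable_mult_continuous[OF q yc] absolutely_integrable_continuous_real continuous_intros yc)
      fix x assume x: "x \<in> {0..pi}"
      have "((\<lambda>t. - (l * y t + Q t * dy t)) has_integral (dy x - Q x * y x) - (dy 0 - Q 0 * y 0)) {0..x}"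
      proof (rule fundamental_theorem_of_calculus)
        fix t assume t: "t \<in> {0..x}"
        then have "((\<lambda>x. dy x - Q x * y x) has_real_derivative - (l * y t + Q t * dy t)) (at t within {0..x})"
          using x by (intro DERIV_subset[OF z']) auto
        then show "((\<lambda>x. dy x - Q x * y x) has_vector_derivative - (l * y t + Q t * dy t)) (at t within {0..x})"
          by (simp only: has_real_derivative_iff_has_vector_derivative)
      qed (use x in auto)
      from integral_unique[OF this]
      have "- integral {0..x} (\<lambda>t. l * y t + Q t * dy t) = (dy x - Q x * y x) - (dy 0 - Q 0 * y 0)"
        by (simp only: Henstock_Kurzweil_Integration.integral_neg)
      then show "dy x = dy 0 + integral {0..x} ddy"
        using parts[OF y dyc x] unfolding ddy_def by linarith
    qed
    then show "is_solution q l (y, dy)"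
      using y unfolding is_solution_def prod.case
      by (intro conjI ballI exI[of _ ddy]) (auto simp: ddy_def)
  qed
qed

section \<open>Solutions and their Darboux transforms\<close>

lemma qsys_cong:
  assumes "qsys Q l y z" "\<And>x. x \<in> {0..pi} \<Longrightarrow> Q' x = Q x" "\<And>x. x \<in> {0..pi} \<Longrightarrow> y' x = y x"
    "\<And>x. x \<in> {0..pi} \<Longrightarrow> z' x = z x"
  shows "qsys Q' l y' z'"
  unfolding qsys_def
proof (intro ballI conjI)
  fix x assume x: "x \<in> {0..pi}"
  show "(y' has_real_derivative z' x + Q' x * y' x) (at x within {0..pi})"
    unfolding assms(2-4)[OF x]
    by (rule has_field_derivative_transform_within[OF qsysD(1)[OF assms(1) x] zero_less_one x]) (rule assms(3)[symmetric])
  show "(z' has_real_derivative - (l + (Q' x)\<^sup>2) * y' x - Q' x * z' x) (at x within {0..pi})"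
    unfolding assms(2-4)[OF x]
    by (rule has_field_derivative_transform_within[OF qsysD(2)[OF assms(1) x] zero_less_one x]) (rule assms(4)[symmetric])
qed

section \<open>Solutions with prescribed initial values\<close>

lemma solution_derivative:
  "is_solution q l (y, dy) \<Longrightarrow> x \<in> {0..pi} \<Longrightarrow> (y has_real_derivative dy x) (at x within {0..pi})"
  unfolding is_solution_def by blast

lemma solution_continuous: "is_solution q l (y, dy) \<Longrightarrow> continuous_on {0..pi} y"
  by (rule DERIV_continuous_on[OF solution_derivative])

lemma solution_derivative_continuous:
  assumes "is_solution q l (y, dy)"
  shows "continuous_on {0..pi} dy"
proof -
  obtain ddy where "has_ac_derivative dy ddy" using assms by (auto simp: is_solution_def)
  then have d: "ddy absolutely_integrable_on {0..pi}" "\<And>x. x \<in> {0..pi} \<Longrightarrow> dy x = dy 0 + integral {0..x} ddy"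
    unfolding has_ac_derivative_def by blast+
  have "continuous_on {0..pi} (\<lambda>x. dy 0 + integral {0..x} ddy)"
    using d(1) by (intro continuous_intros indefinite_integral_continuous_1) (auto simp: absolutely_integrable_on_def)
  then show ?thesis by (rule continuous_on_eq) (rule d(2)[symmetric])
qed

lemma solution_wronskian:
  assumes q: "q absolutely_integrable_on {0<..<pi}"
    and "is_solution q l (y, dy)" "is_solution q m (z, dz)" "x \<in> {0..pi}"
  shows "((\<lambda>x. dy x * z x - y x * dz x) has_real_derivative (m - l) * (y x * z x)) (at x within {0..pi})"
proof -
  note Q = potentialI[OF q]
  have eq: "(\<lambda>x. (dy x - integral {0..x} q * y x) * z x - y x * (dz x - integral {0..x} q * z x)) = (\<lambda>x. dy x * z x - y x * dz x)"
    by (simp add: algebra_simps)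
  show ?thesis
    using qsys_wronskian[OF assms(2,3)[unfolded is_solution_iff_qsys[OF Q]] assms(4)] unfolding eq .
qed

lemma solution_wronskian_const:
  assumes q: "q absolutely_integrable_on {0<..<pi}"
    and "is_solution q l (y, dy)" "is_solution q l (z, dz)" "x \<in> {0..pi}" "x' \<in> {0..pi}"
  shows "dy x * z x - y x * dz x = dy x' * z x' - y x' * dz x'"
  using solution_wronskian[OF assms(1-3)] assms(4,5)
  by (intro constant_on_interval[of 0 pi "\<lambda>x. dy x * z x - y x * dz x"]) auto

lemma solution_exists:
  assumes q: "q absolutely_integrable_on {0<..<pi}" and x0: "x0 \<in> {0..pi}"
  obtains y dy where "is_solution q l (y, dy)" "y x0 = a" "dy x0 = b"
proof -
  note Q = potentialI[OF q]
  obtain y z where y: "qsys (\<lambda>x. integral {0..x} q) l y z" "y x0 = a" "z x0 = b - integral {0..x0} q * a"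
    by (rule qsys_exists_at[OF potential_continuous[OF Q] x0])
  have "is_solution q l (y, \<lambda>x. z x + integral {0..x} q * y x)"
    unfolding is_solution_iff_qsys[OF Q] using y(1) by simp
  then show thesis using that y(2,3) by simp
qed

lemma solution_unique:
  assumes q: "q absolutely_integrable_on {0<..<pi}"
    and y: "is_solution q l (y, dy)" and z: "is_solution q l (z, dz)"
    and x0: "x0 \<in> {0..pi}" "y x0 = z x0" "dy x0 = dz x0" and x: "x \<in> {0..pi}"
  shows "y x = z x" "dy x = dz x"
proof -
  note Q = potentialI[OF q]
  note u = qsys_unique[OF potential_continuous[OF Q] y[unfolded is_solution_iff_qsys[OF Q]]
      z[unfolded is_solution_iff_qsys[OF Q]] x0(1,2) _ x]
  show "y x = z x" by (rule u) (simp add: x0)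
  moreover have "dy x - integral {0..x} q * y x = dz x - integral {0..x} q * z x"
    by (rule u) (simp add: x0)
  ultimately show "dy x = dz x" by simp
qed

lemma solution_comb:
  assumes q: "q absolutely_integrable_on {0<..<pi}"
    and y: "is_solution q l (y, dy)" and z: "is_solution q l (z, dz)"
  shows "is_solution q l (\<lambda>x. a * y x + b * z x, \<lambda>x. a * dy x + b * dz x)"
proof -
  note Q = potentialI[OF q]
  show ?thesis
    unfolding is_solution_iff_qsys[OF Q]
    by (rule qsys_cong[OF qsys_comb[OF y[unfolded is_solution_iff_qsys[OF Q]] z[unfolded is_solution_iff_qsys[OF Q]], of a b]])
      (simp_all add: algebra_simps)
qed

lemma solution_scale:
  assumes "q absolutely_integrable_on {0<..<pi}" "is_solution q l (y, dy)"
  shows "is_solution q l (\<lambda>x. a * y x, \<lambda>x. a * dy x)"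
  using solution_comb[OF assms assms(2), of a 0] by simp

text \<open>Used in contrapositive form: a solution that is nonzero somewhere cannot vanish together
  with its derivative.\<close>

lemma solution_nontrivial:
  assumes "q absolutely_integrable_on {0<..<pi}" "is_solution q l (y, dy)"
    "x0 \<in> {0..pi}" "y x0 = 0" "dy x0 = 0" "x \<in> {0..pi}"
  shows "y x = 0" "dy x = 0"
  using solution_unique[OF assms(1,2) solution_scale[OF assms(1,2), of 0] assms(3)] assms(4-6) by auto

lemma solution_proportional:
  assumes q: "q absolutely_integrable_on {0<..<pi}"
    and y: "is_solution q l (y, dy)" and z: "is_solution q l (z, dz)"
    and x0: "x0 \<in> {0..pi}" "dy x0 * z x0 = y x0 * dz x0" "z x0 \<noteq> 0 \<or> dz x0 \<noteq> 0"
  obtains k where "\<And>x. x \<in> {0..pi} \<Longrightarrow> y x = k * z x" "\<And>x. x \<in> {0..pi} \<Longrightarrow> dy x = k * dz x"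
proof -
  define k where "k = (if z x0 \<noteq> 0 then y x0 / z x0 else dy x0 / dz x0)"
  have k: "y x0 = k * z x0" "dy x0 = k * dz x0"
    using x0(2,3) by (auto simp: k_def field_simps)
  show thesis
    using that[of k] solution_unique[OF q y solution_scale[OF q z, of k] x0(1) k] by blast
qed

lemma solution_at:
  assumes q: "q absolutely_integrable_on {0<..<pi}" and x0: "x0 \<in> {0..pi}"
  shows "is_solution q l (solution_at x0 a b q l)" "fst (solution_at x0 a b q l) x0 = a"
    "snd (solution_at x0 a b q l) x0 = b"
proof -
  obtain y dy where "is_solution q l (y, dy)" "y x0 = a" "dy x0 = b" by (rule solution_exists[OF q x0])
  then have "\<exists>s. is_solution q l s \<and> fst s x0 = a \<and> snd s x0 = b" by force
  from someI_ex[OF this]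
  show "is_solution q l (solution_at x0 a b q l)" "fst (solution_at x0 a b q l) x0 = a"
    "snd (solution_at x0 a b q l) x0 = b" by (auto simp: solution_at_def)
qed

lemma solution_perturbation:
  assumes q: "q absolutely_integrable_on {0<..<pi}" and y0: "is_solution q l0 (y0, dy0)" and e: "e > 0"
  obtains d where "d > 0" "\<And>l y dy x. \<bar>l - l0\<bar> < d \<Longrightarrow> is_solution q l (y, dy) \<Longrightarrow> \<bar>y 0 - y0 0\<bar> < d \<Longrightarrow>
    \<bar>dy 0 - dy0 0\<bar> < d \<Longrightarrow> x \<in> {0..pi} \<Longrightarrow> \<bar>y x - y0 x\<bar> < e \<and> \<bar>dy x - dy0 x\<bar> < e"
proof -
  note P = potentialI[OF q]
  define Q where "Q x = integral {0..x} q" for x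
  note Qc = potential_continuous[OF P, folded Q_def]
  have Q0: "Q 0 = 0" by (simp add: Q_def)
  obtain B where B0: "B > 0" and B: "\<And>x. x \<in> {0..pi} \<Longrightarrow> \<bar>Q x\<bar> \<le> B"
    using continuous_bound[OF Qc] by blast
  obtain K where K: "K > 0" "\<And>l y z x. \<bar>l - l0\<bar> \<le> 1 \<Longrightarrow> qsys Q l y z \<Longrightarrow> x \<in> {0..pi} \<Longrightarrow>
    (y x - y0 x)\<^sup>2 + (z x - (dy0 x - Q x * y0 x))\<^sup>2 \<le> K * ((y 0 - y0 0)\<^sup>2 + (z 0 - (dy0 0 - Q 0 * y0 0))\<^sup>2 + (l - l0)\<^sup>2)"
    using qsys_perturbation[OF Qc y0[unfolded is_solution_iff_qsys[OF P], folded Q_def]] by blast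
  \<comment> \<open>A bound c for the errors of y and of its quasi-derivative z gives c + B c = e
    for the error of y', since y' = z + Q y.\<close>
  define c where "c = e / (1 + B)"
  have "c * (1 + B) = e" using B0 by (simp add: c_def)
  then have "c + B * c = e" by (simp add: algebra_simps)
  moreover have "c > 0" using e B0 by (simp add: c_def)
  ultimately have c: "c > 0" "c + B * c = e" by auto
  define d where "d = min 1 (c / sqrt (3 * K))"
  have d: "d > 0" "d \<le> 1" "d \<le> c / sqrt (3 * K)" using c K by (auto simp: d_def)
  have Kd: "K * (3 * d\<^sup>2) \<le> c\<^sup>2"
  proof -
    have "d\<^sup>2 \<le> (c / sqrt (3 * K))\<^sup>2" using d by (intro power_mono) auto
    also have "\<dots> = c\<^sup>2 / (3 * K)" using K by (simp add: power_divide)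
    finally show ?thesis using K by (simp add: field_simps)
  qed
  show thesis
  proof (rule that[OF d(1)])
    fix l y dy x
    assume l: "\<bar>l - l0\<bar> < d" and y: "is_solution q l (y, dy)" and i: "\<bar>y 0 - y0 0\<bar> < d" "\<bar>dy 0 - dy0 0\<bar> < d"
      and x: "x \<in> {0..pi}"
    define u v where "u = y x - y0 x" and "v = (dy x - Q x * y x) - (dy0 x - Q x * y0 x)"
    have sq: "a\<^sup>2 < d\<^sup>2" if "\<bar>a\<bar> < d" for a using that d(1) by (metis abs_ge_zero power2_abs power_strict_mono zero_less_numeral)
    have "u\<^sup>2 + v\<^sup>2 \<le> K * ((y 0 - y0 0)\<^sup>2 + (dy 0 - dy0 0)\<^sup>2 + (l - l0)\<^sup>2)"
      using K(2)[OF _ y[unfolded is_solution_iff_qsys[OF P], folded Q_def] x] l d by (simp add: u_def v_def Q0)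
    also have "\<dots> < K * (3 * d\<^sup>2)"
      using sq[OF l] sq[OF i(1)] sq[OF i(2)] K(1) by (intro mult_strict_left_mono) auto
    also note Kd
    finally have uv: "u\<^sup>2 + v\<^sup>2 < c\<^sup>2" .
    have "u\<^sup>2 < c\<^sup>2" "v\<^sup>2 < c\<^sup>2" using uv zero_le_power2[of u] zero_le_power2[of v] by linarith+
    then have uc: "\<bar>u\<bar> < c" and vc: "\<bar>v\<bar> < c"
      using power2_less_imp_less[of "\<bar>u\<bar>" c] power2_less_imp_less[of "\<bar>v\<bar>" c] c by auto
    have "dy x - dy0 x = v + Q x * u" by (simp add: u_def v_def algebra_simps)
    then have "\<bar>dy x - dy0 x\<bar> \<le> \<bar>v\<bar> + \<bar>Q x\<bar> * \<bar>u\<bar>" by (simp flip: abs_mult)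
    also have "\<dots> < c + B * c" using vc uc B[OF x] B0 by (intro add_less_le_mono mult_mono) auto
    finally have "\<bar>dy x - dy0 x\<bar> < e" using c by simp
    moreover have "c \<le> e" using c B0 by (smt (verit) mult_pos_pos)
    ultimately show "\<bar>y x - y0 x\<bar> < e \<and> \<bar>dy x - dy0 x\<bar> < e" using uc by (simp add: u_def)
  qed
qed

definition darboux_potential :: "(real \<Rightarrow> real) \<Rightarrow> (real \<Rightarrow> real) \<Rightarrow> (real \<Rightarrow> real) \<Rightarrow> real \<Rightarrow> real" where
  "darboux_potential q u du x = q x - 2 * deriv (\<lambda>t. du t / u t) x"

text \<open>With \<open>\<rho> = z / u\<close> formed from the quasi-derivative of \<open>u\<close>, the transformation replaces the
  antiderivative \<open>Q\<close> by \<open>- Q - 2 \<rho> = Q - 2 u' / u\<close>, so it stays within the class of classical systems.\<close>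

context
  fixes q u du L Q
  assumes P: "potential q Q" and u: "is_solution q L (u, du)" and nz: "\<And>x. x \<in> {0..pi} \<Longrightarrow> u x \<noteq> 0"
begin

private definition "\<rho> x = (du x - Q x * u x) / u x"

private lemma uq: "qsys Q L u (\<lambda>x. du x - Q x * u x)"
  using u is_solution_iff_qsys[OF P] by simp

private lemma rho: "x \<in> {0..pi} \<Longrightarrow> du x / u x = \<rho> x + Q x" "x \<in> {0..pi} \<Longrightarrow> du x = (\<rho> x + Q x) * u x"
  using nz by (simp_all add: \<rho>_def field_simps)

text \<open>A Riccati equation in which \<open>q\<close> no longer occurs: in u'/u = \<rho> + Q the
  rough part is Q, while \<rho> is continuously differentiable.\<close>

private lemma rho_deriv:
  assumes x: "x \<in> {0..pi}"
  shows "(\<rho> has_real_derivative - L - (Q x + \<rho> x)\<^sup>2) (at x within {0..pi})"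
proof -
  define z where "z x = du x - Q x * u x" for x
  have z: "z x = \<rho> x * u x" using nz[OF x] by (simp add: \<rho>_def z_def)
  have "((\<lambda>x. z x / u x) has_real_derivative ((- (L + (Q x)\<^sup>2) * u x - Q x * z x) * u x - z x * (z x + Q x * u x)) / (u x * u x)) (at x within {0..pi})"
    by (rule DERIV_divide[OF qsysD(2)[OF uq x, folded z_def] qsysD(1)[OF uq x, folded z_def] nz[OF x]])
  moreover have "((- (L + (Q x)\<^sup>2) * u x - Q x * z x) * u x - z x * (z x + Q x * u x)) = (- L - (Q x + \<rho> x)\<^sup>2) * (u x * u x)"
    by (simp add: z power2_eq_square algebra_simps)
  ultimately show ?thesis using nz[OF x] by (simp add: \<rho>_def[abs_def] z_def)
qed

private lemma rho_cont: "continuous_on {0..pi} \<rho>"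
  by (rule DERIV_continuous_on[OF rho_deriv])

text \<open>Where Q' = q holds, (u'/u)' = \<rho>' + q, so subtracting it twice reverses the sign of
  \<open>q\<close> and leaves a continuous remainder.\<close>

private lemma darboux_ae:
  obtains N where "negligible N"
    "\<And>x. x \<in> {0<..<pi} - N \<Longrightarrow> darboux_potential q u du x = - q x - 2 * (- L - (Q x + \<rho> x)\<^sup>2)"
proof -
  have qi: "q absolutely_integrable_on {0..pi}" and Q: "\<And>x. x \<in> {0..pi} \<Longrightarrow> Q x = Q 0 + integral {0..x} q"
    using P unfolding potential_def by blast+
  obtain N where N: "negligible N" "\<And>x. x \<in> {0<..<pi} - N \<Longrightarrow> ((\<lambda>t. integral {0..t} q) has_real_derivative q x) (at x)"
    using lebesgue_differentiation_interval[OF qi] by blast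
  have "darboux_potential q u du x = - q x - 2 * (- L - (Q x + \<rho> x)\<^sup>2)" if x: "x \<in> {0<..<pi} - N" for x
  proof -
    have "at x within {0..pi} = at x" using x by (intro at_within_interior) (auto simp: interior_atLeastAtMost_real)
    then have \<rho>': "(\<rho> has_real_derivative - L - (Q x + \<rho> x)\<^sup>2) (at x)" using rho_deriv[of x] x by simp
    have "((\<lambda>t. \<rho> t + (Q 0 + integral {0..t} q)) has_real_derivative (- L - (Q x + \<rho> x)\<^sup>2) + (0 + q x)) (at x)"
      by (intro DERIV_add DERIV_const \<rho>' N(2)[OF x])
    then have "((\<lambda>t. du t / u t) has_real_derivative (- L - (Q x + \<rho> x)\<^sup>2) + (0 + q x)) (at x)"
    proof (rule has_field_derivative_transform_within_open)
      show "\<rho> t + (Q 0 + integral {0..t} q) = du t / u t" if "t \<in> {0<..<pi}" for t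
        using rho(1)[of t] Q[of t] that by simp
    qed (use x in auto)
    from DERIV_imp_deriv[OF this] show ?thesis by (simp add: darboux_potential_def)
  qed
  then show thesis using that N(1) by blast
qed

private lemma rho'_cont: "continuous_on {0..pi} (\<lambda>x. - L - (Q x + \<rho> x)\<^sup>2)"
  by (intro continuous_intros rho_cont potential_continuous[OF P])

lemma darboux_potential_AE:
  "AE x in lebesgue_on {0<..<pi}. darboux_potential q u du x = 2 * L - q x + 2 * (du x / u x)\<^sup>2"
proof -
  obtain N where N: "negligible N"
    "\<And>x. x \<in> {0<..<pi} - N \<Longrightarrow> darboux_potential q u du x = - q x - 2 * (- L - (Q x + \<rho> x)\<^sup>2)"
    using darboux_ae by blast
  have "darboux_potential q u du x = 2 * L - q x + 2 * (du x / u x)\<^sup>2" if "x \<in> {0<..<pi} - N" for x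
    using N(2)[OF that] rho(1)[of x] that by (simp add: add.commute)
  then show ?thesis using N(1) by (subst AE_lebesgue_on_iff_negligible) auto
qed

lemma potential_darboux: "potential (darboux_potential q u du) (\<lambda>x. Q x - 2 * (du x / u x))"
proof -
  define g where "g x = - q x - 2 * (- L - (Q x + \<rho> x)\<^sup>2)" for x
  have qi: "q absolutely_integrable_on {0..pi}" and Q: "\<And>x. x \<in> {0..pi} \<Longrightarrow> Q x = Q 0 + integral {0..x} q"
    using P unfolding potential_def by blast+
  obtain N where N: "negligible N"
    "\<And>x. x \<in> {0<..<pi} - N \<Longrightarrow> darboux_potential q u du x = g x"
    unfolding g_def using darboux_ae by blast
  have N': "negligible (N \<union> {0, pi})" using N(1) by simp
  have gi: "g absolutely_integrable_on {0..pi}"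
    unfolding g_def
  proof (rule set_integral_diff(1))
    show "(\<lambda>x. - q x) absolutely_integrable_on {0..pi}"
      using absolutely_integrable_mult_continuous[OF qi continuous_on_const, of "- 1"] by simp
    show "(\<lambda>x. 2 * (- L - (Q x + \<rho> x)\<^sup>2)) absolutely_integrable_on {0..pi}"
      by (intro absolutely_integrable_continuous_real continuous_on_mult_left rho'_cont)
  qed
  show ?thesis unfolding potential_def
  proof (intro conjI ballI)
    show "darboux_potential q u du absolutely_integrable_on {0..pi}"
      by (rule absolutely_integrable_spike[OF gi N']) (use N(2) in auto)
    fix x assume x: "x \<in> {0..pi}"
    have "integral {0..x} (darboux_potential q u du) = integral {0..x} g"
      by (rule integral_spike[OF N', symmetric]) (use N(2) x in auto)
    also have "\<dots> = - integral {0..x} q - 2 * (\<rho> x - \<rho> 0)"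
    proof -
      have rI: "((\<lambda>x. - L - (Q x + \<rho> x)\<^sup>2) has_integral \<rho> x - \<rho> 0) {0..x}"
      proof (rule fundamental_theorem_of_calculus)
        fix t assume t: "t \<in> {0..x}"
        then have "(\<rho> has_real_derivative - L - (Q t + \<rho> t)\<^sup>2) (at t within {0..x})"
          using x by (intro DERIV_subset[OF rho_deriv]) auto
        then show "(\<rho> has_vector_derivative - L - (Q t + \<rho> t)\<^sup>2) (at t within {0..x})"
          by (simp only: has_real_derivative_iff_has_vector_derivative)
      qed (use x in auto)
      have "q integrable_on {0..x}"
        by (rule integrable_on_subinterval[of q "{0..pi}"]) (use qi x in \<open>auto simp: absolutely_integrable_on_def\<close>)
      then have qI: "(q has_integral integral {0..x} q) {0..x}" by (rule integrable_integral)
      have "(g has_integral - integral {0..x} q - 2 * (\<rho> x - \<rho> 0)) {0..x}"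
        unfolding g_def by (rule has_integral_diff[OF has_integral_neg[OF qI] has_integral_mult_right[OF rI]])
      then show ?thesis by (rule integral_unique)
    qed
    also have "integral {0..x} q = Q x - Q 0" using Q[OF x] by linarith
    finally show "Q x - 2 * (du x / u x) = Q 0 - 2 * (du 0 / u 0) + integral {0..x} (darboux_potential q u du)"
      using rho(1)[OF x] rho(1)[of 0] by simp
  qed
qed

lemma darboux_integrable: "darboux_potential q u du absolutely_integrable_on {0<..<pi}"
  using potential_darboux by (simp add: potential_def absolutely_integrable_Ioo_iff)

text \<open>The image equals z - \<rho> y, where z is the quasi-derivative of y, so it can be
  differentiated without touching \<open>q\<close>. At l = L the map annihilates u, so that
  parameter has a construction of its own.\<close>

lemma darboux_solution:
  assumes y: "is_solution q l (y, dy)"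
  shows "is_solution (darboux_potential q u du) l
    (\<lambda>x. dy x - du x / u x * y x, \<lambda>x. (L - l) * y x - du x / u x * (dy x - du x / u x * y x))"
proof -
  define z where "z x = dy x - Q x * y x" for x
  define Y where "Y x = z x - \<rho> x * y x" for x
  define Z where "Z x = (L - l) * y x + \<rho> x * Y x" for x
  have yq: "qsys Q l y z" using y is_solution_iff_qsys[OF P] by (simp add: z_def[abs_def])
  have Y': "(Y has_real_derivative (L - l) * y x - (\<rho> x + Q x) * Y x) (at x within {0..pi})" if x: "x \<in> {0..pi}" for x
    unfolding Y_def
    by (rule DERIV_cong[OF DERIV_diff[OF qsysD(2)[OF yq x] DERIV_mult[OF rho_deriv[OF x] qsysD(1)[OF yq x]]]])
      (simp add: power2_eq_square algebra_simps)
  have Yz: "z x = Y x + \<rho> x * y x" for x by (simp add: Y_def)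
  have "qsys (\<lambda>x. - Q x - 2 * \<rho> x) l Y Z"
    unfolding qsys_def
  proof (intro ballI conjI)
    fix x assume x: "x \<in> {0..pi}"
    show "(Y has_real_derivative Z x + (- Q x - 2 * \<rho> x) * Y x) (at x within {0..pi})"
      by (rule DERIV_cong[OF Y'[OF x]]) (simp add: Z_def algebra_simps)
    have "(Z has_real_derivative (L - l) * (z x + Q x * y x) + ((- L - (Q x + \<rho> x)\<^sup>2) * Y x + ((L - l) * y x - (\<rho> x + Q x) * Y x) * \<rho> x)) (at x within {0..pi})"
      unfolding Z_def by (intro DERIV_add DERIV_mult DERIV_cmult rho_deriv[OF x] Y'[OF x] qsysD(1)[OF yq x])
    then show "(Z has_real_derivative - (l + (- Q x - 2 * \<rho> x)\<^sup>2) * Y x - (- Q x - 2 * \<rho> x) * Z x) (at x within {0..pi})"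
      by (rule DERIV_cong) (simp add: Yz Z_def power2_eq_square algebra_simps)
  qed
  then show ?thesis unfolding is_solution_iff_qsys[OF potential_darboux]
    by (rule qsys_cong) (simp_all add: rho(1) Y_def Z_def z_def algebra_simps)
qed

text \<open>Reduction of order at l = L: a constant \<open>G\<close> (k = 0) gives the multiples of
  1/u, while k = 1 with G a tail integral of u^2 plus a constant gives the solution from which
  \<kappa> is computed.\<close>

lemma darboux_solution_inverse:
  assumes G: "\<And>x. x \<in> {0..pi} \<Longrightarrow> (G has_real_derivative - k * (u x)\<^sup>2) (at x within {0..pi})"
  shows "is_solution (darboux_potential q u du) L (\<lambda>x. G x / u x, \<lambda>x. - k * u x - du x / u x * (G x / u x))"
proof -
  define w where "w x = G x / u x" for x
  define Z where "Z x = \<rho> x * w x - k * u x" for x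
  have u': "(u has_real_derivative (\<rho> x + Q x) * u x) (at x within {0..pi})" if x: "x \<in> {0..pi}" for x
    by (rule DERIV_cong[OF qsysD(1)[OF uq x]]) (simp add: rho(2)[OF x])
  have w': "(w has_real_derivative - k * u x - (\<rho> x + Q x) * w x) (at x within {0..pi})" if x: "x \<in> {0..pi}" for x
  proof -
    have "(w has_real_derivative (- k * (u x)\<^sup>2 * u x - G x * ((\<rho> x + Q x) * u x)) / (u x * u x)) (at x within {0..pi})"
      unfolding w_def by (rule DERIV_divide[OF G[OF x] u'[OF x] nz[OF x]])
    then show ?thesis
      by (rule DERIV_cong) (use nz[OF x] in \<open>simp add: w_def field_simps power2_eq_square\<close>)
  qed
  have "qsys (\<lambda>x. - Q x - 2 * \<rho> x) L w Z"
    unfolding qsys_def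
  proof (intro ballI conjI)
    fix x assume x: "x \<in> {0..pi}"
    show "(w has_real_derivative Z x + (- Q x - 2 * \<rho> x) * w x) (at x within {0..pi})"
      by (rule DERIV_cong[OF w'[OF x]]) (simp add: Z_def algebra_simps)
    have "(Z has_real_derivative ((- L - (Q x + \<rho> x)\<^sup>2) * w x + (- k * u x - (\<rho> x + Q x) * w x) * \<rho> x) - k * ((\<rho> x + Q x) * u x)) (at x within {0..pi})"
      unfolding Z_def by (intro DERIV_diff DERIV_mult DERIV_cmult rho_deriv[OF x] w'[OF x] u'[OF x])
    then show "(Z has_real_derivative - (L + (- Q x - 2 * \<rho> x)\<^sup>2) * w x - (- Q x - 2 * \<rho> x) * Z x) (at x within {0..pi})"
      by (rule DERIV_cong) (simp add: Z_def power2_eq_square algebra_simps)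
  qed
  then show ?thesis unfolding is_solution_iff_qsys[OF potential_darboux]
    by (rule qsys_cong) (simp_all add: rho(1) w_def Z_def algebra_simps)
qed

end

text \<open>The matching logarithmic derivative at one point makes w a multiple of 1/u, so w'/w =
  -u'/u throughout. Each step has the form q \<mapsto> 2 L - q + 2 (u'/u)^2 almost everywhere, and
  the squares agree, so the second step undoes the first.\<close>

lemma darboux_inverse:
  assumes q: "q absolutely_integrable_on {0<..<pi}" and u: "is_solution q L (u, du)"
    and nz: "\<And>x. x \<in> {0..pi} \<Longrightarrow> u x \<noteq> 0"
    and w: "is_solution (darboux_potential q u du) L (w, dw)"
    and x0: "x0 \<in> {0..pi}" "w x0 \<noteq> 0" "dw x0 / w x0 = - du x0 / u x0"
  shows "\<And>x. x \<in> {0..pi} \<Longrightarrow> w x \<noteq> 0" "\<And>x. x \<in> {0..pi} \<Longrightarrow> dw x / w x = - (du x / u x)"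
    "AE x in lebesgue_on {0<..<pi}. darboux_potential (darboux_potential q u du) w dw x = q x"
proof -
  note P = potentialI[OF q]
  define q' where "q' = darboux_potential q u du"
  have q': "q' absolutely_integrable_on {0<..<pi}" unfolding q'_def by (rule darboux_integrable[OF P u nz])
  define k where "k = w x0 * u x0"
  have i: "is_solution q' L (\<lambda>x. k / u x, \<lambda>x. - 0 * u x - du x / u x * (k / u x))"
    unfolding q'_def by (rule darboux_solution_inverse[OF P u nz]) auto
  have k: "k \<noteq> 0" using x0(2) nz[OF x0(1)] by (simp add: k_def)
  have e: "w x0 = k / u x0" "dw x0 = - 0 * u x0 - du x0 / u x0 * (k / u x0)"
    using x0 nz[OF x0(1)] by (simp_all add: k_def field_simps)
  note eq = solution_unique[OF q' w[folded q'_def] i x0(1) e]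
  show nz': "w x \<noteq> 0" if "x \<in> {0..pi}" for x using eq(1)[OF that] nz[OF that] k by simp
  show r: "dw x / w x = - (du x / u x)" if "x \<in> {0..pi}" for x
    using eq[OF that] nz[OF that] k by simp
  have "AE x in lebesgue_on {0<..<pi}. darboux_potential q' w dw x = 2 * L - q' x + 2 * (dw x / w x)\<^sup>2"
    using darboux_potential_AE[OF potentialI[OF q'] w[folded q'_def] nz'] .
  moreover have "AE x in lebesgue_on {0<..<pi}. q' x = 2 * L - q x + 2 * (du x / u x)\<^sup>2"
    unfolding q'_def by (rule darboux_potential_AE[OF P u nz])
  moreover have "AE x in lebesgue_on {0<..<pi}. x \<in> {0..pi}"
    by (rule AE_I2) auto
  ultimately show "AE x in lebesgue_on {0<..<pi}. darboux_potential (darboux_potential q u du) w dw x = q x"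
    unfolding q'_def[symmetric]
  proof eventually_elim
    case (elim x)
    then show ?case using r[of x] by simp
  qed
qed

section \<open>The lowest eigenvalue\<close>

text \<open>Positivity is assumed only to the right of 0 because \<open>w\<close> may start from 0
  under a Dirichlet condition; the first zero is found by compactness on an interval that stays away
  from 0.\<close>

lemma first_zero:
  fixes w :: "real \<Rightarrow> real"
  assumes cont: "continuous_on {0..b} w" and e: "e > 0" "\<And>x. 0 < x \<Longrightarrow> x < e \<Longrightarrow> x \<le> b \<Longrightarrow> w x > 0"
    and x: "0 < x" "x \<le> b" "w x \<le> 0"
  shows "\<exists>t. 0 < t \<and> t \<le> b \<and> w t = 0 \<and> (\<forall>s. 0 < s \<longrightarrow> s < t \<longrightarrow> w s > 0)"
proof -
  define d where "d = min e x / 2"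
  have d: "0 < d" "d < e" "d < x" using e x by (auto simp: d_def)
  define A where "A = {d..b} \<inter> {s \<in> {0..b}. w s \<le> 0}"
  have "closed {s \<in> {0..b}. w s \<le> 0}"
    using continuous_closed_preimage[OF cont closed_atLeastAtMost, of "{..0}"]
    by (auto simp: vimage_def Int_def conj_commute)
  then have "compact A" unfolding A_def by (intro compact_Int_closed compact_Icc)
  moreover have "x \<in> A" using x d by (simp add: A_def)
  ultimately obtain t where t: "t \<in> A" "\<And>s. s \<in> A \<Longrightarrow> t \<le> s"
    using compact_attains_inf[of A] by blast
  have pos: "w s > 0" if s: "0 < s" "s < t" for s
  proof (cases "s < d")
    case True then show ?thesis using e(2)[of s] s d x by simp
  next
    case False
    then have "s \<notin> A" using t(2)[of s] s by auto
    then show ?thesis using False s t(1) d by (auto simp: A_def)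
  qed
  have t0: "0 < t" "t \<le> b" "w t \<le> 0" using t(1) d by (auto simp: A_def)
  have "w t \<ge> 0"
  proof (rule tendsto_lowerbound)
    have "(w \<longlongrightarrow> w t) (at t within {0..t})"
      by (rule tendsto_within_subset[of _ _ _ "{0..b}"]) (use cont t0 in \<open>auto simp: continuous_on_def\<close>)
    then show "(w \<longlongrightarrow> w t) (at_left t)"
      using t0 by (subst (asm) at_within_Icc_at_left) auto
    show "\<forall>\<^sub>F s in at_left t. 0 \<le> w s"
      using pos t0(1) by (intro eventually_at_leftI[of 0]) (auto intro: less_imp_le)
  qed auto
  then show ?thesis using t0 pos by (intro exI[of _ t]) auto
qed

text \<open>Sturm comparison: at a first zero of \<open>w\<close> the Wronskian would be nonpositive, while it increases.\<close>

lemma positive_forward: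
  fixes w dw y dy c :: "real \<Rightarrow> real"
  assumes b: "0 < b"
    and w: "\<And>x. x \<in> {0..b} \<Longrightarrow> (w has_real_derivative dw x) (at x within {0..b})"
    and W: "\<And>x. x \<in> {0..b} \<Longrightarrow> ((\<lambda>x. dw x * y x - w x * dy x) has_real_derivative c x * (w x * y x)) (at x within {0..b})"
    and y: "\<And>x. 0 < x \<Longrightarrow> x < b \<Longrightarrow> y x > 0" "y b \<ge> 0"
    and c: "\<And>x. 0 < x \<Longrightarrow> x < b \<Longrightarrow> c x \<ge> 0"
    and W0: "dw 0 * y 0 - w 0 * dy 0 \<ge> 0"
    and start: "w 0 > 0 \<or> w 0 = 0 \<and> dw 0 > 0"
    and strict: "dw 0 * y 0 - w 0 * dy 0 > 0 \<or> (\<forall>x. 0 < x \<longrightarrow> x < b \<longrightarrow> c x > 0)"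
  shows "\<And>x. 0 < x \<Longrightarrow> x \<le> b \<Longrightarrow> w x > 0" "dw b * y b - w b * dy b > 0"
proof -
  have cont: "continuous_on {0..b} w" by (rule DERIV_continuous_on[OF w])
  \<comment> \<open>The Wronskian cannot decrease while w > 0, and \<open>strict\<close> makes it
    positive either from the start or through its derivative.\<close>
  have Wpos: "dw t * y t - w t * dy t > 0" if t: "0 < t" "t \<le> b" "\<And>s. 0 < s \<Longrightarrow> s < t \<Longrightarrow> w s > 0" for t
  proof -
    obtain z where z: "0 < z" "z < t" "(dw t * y t - w t * dy t) - (dw 0 * y 0 - w 0 * dy 0) = c z * (w z * y z) * (t - 0)"
      using mvt_within[OF W order_refl t(1,2)] by blast
    have "w z * y z > 0" using t y z by (intro mult_pos_pos) auto
    then have "c z * (w z * y z) * (t - 0) \<ge> 0" "c z > 0 \<Longrightarrow> c z * (w z * y z) * (t - 0) > 0"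
      using c[of z] t z by auto
    moreover have "dw 0 * y 0 - w 0 * dy 0 > 0 \<or> c z > 0" using strict z t by auto
    ultimately show ?thesis using W0 z(3) by linarith
  qed
  obtain e where e: "e > 0" "\<And>x. 0 < x \<Longrightarrow> x < e \<Longrightarrow> x \<le> b \<Longrightarrow> w x > 0"
  proof (cases "w 0 > 0")
    case True
    have "continuous (at 0 within {0..b}) w" using cont b by (simp add: continuous_on_eq_continuous_within)
    then obtain d where d: "d > 0" "\<And>x. x \<in> {0..b} \<Longrightarrow> dist x 0 < d \<Longrightarrow> dist (w x) (w 0) < w 0"
      using True unfolding continuous_within_eps_delta by blast
    have "w x > 0" if "0 < x" "x < d" "x \<le> b" for x
      using d(2)[of x] that by (simp add: dist_real_def)
    then show thesis using that[of d] d(1) by blast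
  next
    case False
    then have "w 0 = 0" "dw 0 > 0" using start by auto
    moreover have "(w has_real_derivative dw 0) (at 0 within {0..b})" using w b by simp
    ultimately obtain d where d: "d > 0" "\<forall>h>0. 0 + h \<in> {0..b} \<longrightarrow> h < d \<longrightarrow> w 0 < w (0 + h)"
      using has_real_derivative_pos_inc_right by blast
    then show thesis using that[of d] \<open>w 0 = 0\<close> by simp
  qed
  show pos: "w x > 0" if x: "0 < x" "x \<le> b" for x
  proof (rule ccontr)
    assume "\<not> w x > 0"
    then have wx: "w x \<le> 0" by simp
    obtain t where t: "0 < t" "t \<le> b" "w t = 0" "\<And>s. 0 < s \<Longrightarrow> s < t \<Longrightarrow> w s > 0"
      using first_zero[OF cont e x wx] by blast
    \<comment> \<open>At a first zero the Wronskian reduces to w' y, so w'(t) > 0 and w would be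
      negative just before t.\<close>
    have "dw t * y t > 0" using Wpos[OF t(1,2,4)] t(3) by simp
    moreover have "y t \<ge> 0" using y t by (cases "t = b") (auto intro: less_imp_le)
    ultimately have "dw t > 0" by (metis mult_nonpos_nonneg not_less)
    moreover have "(w has_real_derivative dw t) (at t within {0..b})" using w t by simp
    ultimately obtain d where d: "d > 0" "\<forall>h>0. t - h \<in> {0..b} \<longrightarrow> h < d \<longrightarrow> w (t - h) < w t"
      using has_real_derivative_pos_inc_left by blast
    define h where "h = min d t / 2"
    have "0 < h" "h < d" "h < t" using d t by (auto simp: h_def)
    then have "w (t - h) < 0" "w (t - h) > 0" using d t by auto
    then show False by simp
  qed
  show "dw b * y b - w b * dy b > 0" using pos b by (intro Wpos) auto
qed

lemma reflect_derivative:
  fixes f :: "real \<Rightarrow> real"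
  assumes "\<And>x. x \<in> {0..b} \<Longrightarrow> (f has_real_derivative f' x) (at x within {0..b})" "x \<in> {0..b}"
  shows "((\<lambda>x. f (b - x)) has_real_derivative - f' (b - x)) (at x within {0..b})"
proof -
  have im: "(\<lambda>x. b - x) ` {0..b} = {0..b}"
  proof (intro equalityI subsetI)
    fix x assume "x \<in> {0..b}"
    then show "x \<in> (\<lambda>x. b - x) ` {0..b}" by (intro image_eqI[of _ _ "b - x"]) auto
  qed auto
  have "(f has_real_derivative f' (b - x)) (at (b - x) within (\<lambda>x. b - x) ` {0..b})"
    unfolding im using assms(2) by (intro assms(1)) auto
  moreover have "((\<lambda>x. b - x) has_real_derivative - 1) (at x within {0..b})"
    by (auto intro!: derivative_eq_intros)
  ultimately have "(f \<circ> (\<lambda>x. b - x) has_real_derivative f' (b - x) * - 1) (at x within {0..b})"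
    by (rule DERIV_image_chain)
  then show ?thesis by (simp add: o_def)
qed

text \<open>Reflection x \<mapsto> b - x reduces this to \<open>positive_forward\<close>;
  derivatives and the Wronskian change sign.\<close>

lemma positive_backward:
  fixes w dw y dy c :: "real \<Rightarrow> real"
  assumes b: "0 < b"
    and w: "\<And>x. x \<in> {0..b} \<Longrightarrow> (w has_real_derivative dw x) (at x within {0..b})"
    and W: "\<And>x. x \<in> {0..b} \<Longrightarrow> ((\<lambda>x. dw x * y x - w x * dy x) has_real_derivative c x * (w x * y x)) (at x within {0..b})"
    and y: "\<And>x. 0 < x \<Longrightarrow> x < b \<Longrightarrow> y x > 0" "y 0 \<ge> 0"
    and c: "\<And>x. 0 < x \<Longrightarrow> x < b \<Longrightarrow> c x \<ge> 0"
    and Wb: "dw b * y b - w b * dy b \<le> 0"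
    and start: "w b > 0 \<or> w b = 0 \<and> dw b < 0"
    and strict: "dw b * y b - w b * dy b < 0 \<or> (\<forall>x. 0 < x \<longrightarrow> x < b \<longrightarrow> c x > 0)"
  shows "\<And>x. 0 \<le> x \<Longrightarrow> x < b \<Longrightarrow> w x > 0" "dw 0 * y 0 - w 0 * dy 0 < 0"
proof -
  have wr: "((\<lambda>x. w (b - x)) has_real_derivative - dw (b - x)) (at x within {0..b})" if "x \<in> {0..b}" for x
    by (rule reflect_derivative[OF w that])
  have Wr: "((\<lambda>x. (- dw (b - x)) * y (b - x) - w (b - x) * (- dy (b - x))) has_real_derivative
      c (b - x) * (w (b - x) * y (b - x))) (at x within {0..b})" if "x \<in> {0..b}" for x
    using DERIV_minus[OF reflect_derivative[OF W that]] by (simp add: algebra_simps)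
  note P = positive_forward[where w = "\<lambda>x. w (b - x)" and dw = "\<lambda>x. - dw (b - x)" and y = "\<lambda>x. y (b - x)"
      and dy = "\<lambda>x. - dy (b - x)" and c = "\<lambda>x. c (b - x)" and b = b, OF b wr Wr]
  show "w x > 0" if "0 \<le> x" "x < b" for x
  proof -
    have "w (b - (b - x)) > 0"
      by (rule P(1)) (use y c Wb start strict that in auto)
    then show ?thesis by simp
  qed
  have "(- dw (b - b)) * y (b - b) - w (b - b) * (- dy (b - b)) > 0"
    by (rule P(2)) (use y c Wb start strict in auto)
  then show "dw 0 * y 0 - w 0 * dy 0 < 0" by simp
qed

section \<open>Ground states and solutions at parameters below them\<close>

text \<open>A certificate for the lowest eigenvalue. The eigenfunction is normalised like \<phi> at
  0 so that the norming constant can be computed from it.\<close>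

definition ground :: "(real \<Rightarrow> real) \<Rightarrow> coeff \<Rightarrow> coeff \<Rightarrow> real \<Rightarrow> (real \<Rightarrow> real) \<Rightarrow> (real \<Rightarrow> real) \<Rightarrow> bool" where
  "ground q f F l y dy \<longleftrightarrow> below l f \<and> below l F \<and> is_solution q l (y, dy) \<and> (\<forall>x\<in>{0<..<pi}. y x > 0) \<and>
     y 0 = poly (down f) l \<and> dy 0 = - poly (up f) l \<and>
     poly (down F) l * dy pi = poly (up F) l * y pi"

lemma negative_end_derivative:
  assumes q: "q absolutely_integrable_on {0<..<pi}" and y: "is_solution q l (y, dy)"
    and pos: "\<And>x. x \<in> {0<..<pi} \<Longrightarrow> y x > 0" and y0: "y pi = 0"
  shows "dy pi < 0"
proof (rule ccontr)
  assume "\<not> dy pi < 0"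
  moreover have "dy pi \<noteq> 0"
    using solution_nontrivial(1)[OF q y, of pi "pi / 2"] pos[of "pi / 2"] y0 by auto
  ultimately have "dy pi > 0" by simp
  moreover have "(y has_real_derivative dy pi) (at pi within {0..pi})"
    by (rule solution_derivative[OF y]) simp
  ultimately obtain d where d: "d > 0" "\<forall>h>0. pi - h \<in> {0..pi} \<longrightarrow> h < d \<longrightarrow> y (pi - h) < y pi"
    using has_real_derivative_pos_inc_left by blast
  define h where "h = min d pi / 2"
  have h: "0 < h" "h < d" "h < pi" using d pi_gt_zero by (auto simp: h_def min_def)
  then have "y (pi - h) < 0" using d y0 by auto
  moreover have "y (pi - h) > 0" using h by (intro pos) auto
  ultimately show False by simp
qed

text \<open>\<open>k\<close> is the reciprocal of the number \<beta> in \<psi> = \<beta> \<phi>. It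
  is positive because in the Dirichlet case, where \<open>up\<close> is -1, y has negative slope at
  its zero \<pi>, and because otherwise both y(\<pi>) and \<open>down\<close> are positive.\<close>

lemma ground_end:
  assumes q: "q absolutely_integrable_on {0<..<pi}" and F: "F \<in> RR" and g: "ground q f F l y dy"
  obtains k where "k > 0" "y pi = k * poly (down F) l" "dy pi = k * poly (up F) l"
proof -
  have y: "is_solution q l (y, dy)" "\<And>x. x \<in> {0<..<pi} \<Longrightarrow> y x > 0" "below l F"
    "poly (down F) l * dy pi = poly (up F) l * y pi" using g by (auto simp: ground_def)
  have nt: "\<not> (y pi = 0 \<and> dy pi = 0)"
    using solution_nontrivial(1)[OF q y(1), of pi "pi / 2"] y(2)[of "pi / 2"] by auto
  have "y pi \<ge> 0"
  proof (rule tendsto_lowerbound)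
    have "(y \<longlongrightarrow> y pi) (at pi within {0..pi})"
      using solution_continuous[OF y(1)] by (auto simp: continuous_on_def)
    then show "(y \<longlongrightarrow> y pi) (at_left pi)" by (subst (asm) at_within_Icc_at_left) auto
    show "\<forall>\<^sub>F s in at_left pi. 0 \<le> y s"
      using y(2) by (intro eventually_at_leftI[of 0]) (auto intro: less_imp_le)
  qed auto
  show thesis
  proof (cases "F = None")
    case True
    then have y0: "y pi = 0" using y(4) by simp
    have "dy pi < 0" by (rule negative_end_derivative[OF q y(1,2) y0])
    then show thesis using that[of "- dy pi"] y0 True by simp
  next
    case False
    then have D: "poly (down F) l > 0" using down_pos[OF F y(3)] by simp
    have "y pi \<noteq> 0" using nt y(4) D by auto
    then show thesis using that[of "y pi / poly (down F) l"] \<open>y pi \<ge> 0\<close> D y(4) by (simp add: field_simps)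
  qed
qed

text \<open>Sturm comparison with the ground state gives positivity and a positive Wronskian at
  \<pi>, that is, a positive boundary form with F taken at l. Since F increases, replacing F(l) by
  F(m) preserves the sign.\<close>

lemma below_ground_forward:
  assumes q: "q absolutely_integrable_on {0<..<pi}" and f: "f \<in> RR" and F: "F \<in> RR" and g: "ground q f F l y dy"
    and m: "m < l" and w: "is_solution q m (w, dw)" and start: "w 0 > 0 \<or> w 0 = 0 \<and> dw 0 > 0"
    and W0: "dw 0 * y 0 - w 0 * dy 0 \<ge> 0"
  shows "\<And>x. 0 < x \<Longrightarrow> x \<le> pi \<Longrightarrow> w x > 0" "poly (down F) m * dw pi - poly (up F) m * w pi > 0"
proof -
  have y: "is_solution q l (y, dy)" "\<And>x. 0 < x \<Longrightarrow> x < pi \<Longrightarrow> y x > 0" "below l F" using g by (auto simp: ground_def)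
  obtain k where k: "k > 0" "y pi = k * poly (down F) l" "dy pi = k * poly (up F) l"
    by (rule ground_end[OF q F g])
  have ypi: "y pi \<ge> 0" using k down_nonneg[OF F y(3)] by simp
  have c: "\<And>x::real. 0 < x \<Longrightarrow> x < pi \<Longrightarrow> 0 \<le> l - m" and s: "dw 0 * y 0 - w 0 * dy 0 > 0 \<or> (\<forall>x. 0 < x \<longrightarrow> x < pi \<longrightarrow> l - m > 0)"
    using m by auto
  note P = positive_forward[where c = "\<lambda>_. l - m" and w = w and dw = dw and y = y and dy = dy, OF pi_gt_zero]
  show pos: "w x > 0" if "0 < x" "x \<le> pi" for x
    by (rule P(1)) (assumption | rule solution_derivative[OF w] solution_wronskian[OF q w y(1)] y(2) ypi c W0 start s that)+
  have "dw pi * y pi - w pi * dy pi > 0"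
    by (rule P(2)) (assumption | rule solution_derivative[OF w] solution_wronskian[OF q w y(1)] y(2) ypi c W0 start s)+
  then have "k * (dw pi * poly (down F) l - w pi * poly (up F) l) > 0" by (simp add: k algebra_simps)
  then have E: "dw pi * poly (down F) l - w pi * poly (up F) l > 0" using k(1) by (simp add: zero_less_mult_iff)
  show "poly (down F) m * dw pi - poly (up F) m * w pi > 0"
  proof (cases "F = None")
    case True then show ?thesis using pos[of pi] by simp
  next
    case False
    have bm: "below m F" using below_mono[OF y(3)] m by simp
    have D: "poly (down F) l > 0" "poly (down F) m > 0" using down_pos[OF F] y(3) bm False by auto
    have "poly (up F) m * poly (down F) l \<le> poly (up F) l * poly (down F) m"
      using up_down_mono[OF F y(3)] m by simp
    then have "poly (up F) m * poly (down F) l * w pi \<le> poly (up F) l * poly (down F) m * w pi"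
      using pos[of pi] by (intro mult_right_mono) auto
    moreover have "poly (down F) m * (dw pi * poly (down F) l - w pi * poly (up F) l) > 0" using D E by simp
    ultimately have "poly (down F) l * (poly (down F) m * dw pi - poly (up F) m * w pi) > 0"
      by (simp add: algebra_simps)
    then show ?thesis using D by (simp add: zero_less_mult_iff)
  qed
qed

lemma below_ground_backward:
  assumes q: "q absolutely_integrable_on {0<..<pi}" and f: "f \<in> RR" and F: "F \<in> RR" and g: "ground q f F l y dy"
    and m: "m < l" and w: "is_solution q m (w, dw)" and wpi: "w pi = poly (down F) m" "dw pi = poly (up F) m"
  shows "\<And>x. 0 \<le> x \<Longrightarrow> x < pi \<Longrightarrow> w x > 0" "poly (down f) m * dw 0 + poly (up f) m * w 0 < 0"
proof -
  have y: "is_solution q l (y, dy)" "\<And>x. 0 < x \<Longrightarrow> x < pi \<Longrightarrow> y x > 0" "below l F" "below l f"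
    "y 0 = poly (down f) l" "dy 0 = - poly (up f) l" using g by (auto simp: ground_def)
  have bm: "below m F" "below m f" using below_mono[OF y(3)] below_mono[OF y(4)] m by auto
  obtain k where k: "k > 0" "y pi = k * poly (down F) l" "dy pi = k * poly (up F) l"
    by (rule ground_end[OF q F g])
  have y0: "y 0 \<ge> 0" using y(5) down_nonneg[OF f y(4)] by simp
  have c: "\<And>x::real. 0 < x \<Longrightarrow> x < pi \<Longrightarrow> 0 \<le> l - m"
    and s: "dw pi * y pi - w pi * dy pi < 0 \<or> (\<forall>x. 0 < x \<longrightarrow> x < pi \<longrightarrow> l - m > 0)"
    using m by auto
  have "k * (poly (up F) m * poly (down F) l) \<le> k * (poly (up F) l * poly (down F) m)"
    using up_down_mono[OF F y(3), of m] m k by (intro mult_left_mono) auto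
  then have Wb: "dw pi * y pi - w pi * dy pi \<le> 0" by (simp add: wpi k algebra_simps)
  have start: "w pi > 0 \<or> w pi = 0 \<and> dw pi < 0"
    using down_pos[OF F bm(1)] by (cases "F = None") (auto simp: wpi)
  note P = positive_backward[where c = "\<lambda>_. l - m" and w = w and dw = dw and y = y and dy = dy, OF pi_gt_zero]
  show pos: "w x > 0" if "0 \<le> x" "x < pi" for x
    by (rule P(1)) (assumption | rule solution_derivative[OF w] solution_wronskian[OF q w y(1)] y(2) y0 c Wb start s that)+
  have "dw 0 * y 0 - w 0 * dy 0 < 0"
    by (rule P(2)) (assumption | rule solution_derivative[OF w] solution_wronskian[OF q w y(1)] y(2) y0 c Wb start s)+
  then have E: "dw 0 * poly (down f) l + w 0 * poly (up f) l < 0" by (simp add: y)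
  show "poly (down f) m * dw 0 + poly (up f) m * w 0 < 0"
  proof (cases "f = None")
    case True then show ?thesis using pos[of 0] by simp
  next
    case False
    have D: "poly (down f) l > 0" "poly (down f) m > 0" using down_pos[OF f] y(4) bm(2) False by auto
    have "poly (up f) m * poly (down f) l \<le> poly (up f) l * poly (down f) m"
      using up_down_mono[OF f y(4)] m by simp
    then have "poly (up f) m * poly (down f) l * w 0 \<le> poly (up f) l * poly (down f) m * w 0"
      using pos[of 0] by (intro mult_right_mono) auto
    moreover have "poly (down f) m * (dw 0 * poly (down f) l + w 0 * poly (up f) l) < 0" using D E by (simp add: mult_pos_neg)
    ultimately have "poly (down f) l * (poly (down f) m * dw 0 + poly (up f) m * w 0) < 0"
      by (simp add: algebra_simps)
    then show ?thesis using D by (simp add: mult_less_0_iff)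
  qed
qed

lemma phi_solution:
  assumes q: "q absolutely_integrable_on {0<..<pi}"
  shows "is_solution q l (fst (phi q f l), snd (phi q f l))" "fst (phi q f l) 0 = poly (down f) l"
    "snd (phi q f l) 0 = - poly (up f) l"
  unfolding phi_def using solution_at[OF q, of 0] by auto

lemma psi_solution:
  assumes q: "q absolutely_integrable_on {0<..<pi}"
  shows "is_solution q l (fst (psi q F l), snd (psi q F l))" "fst (psi q F l) pi = poly (down F) l"
    "snd (psi q F l) pi = poly (up F) l"
  unfolding psi_def using solution_at[OF q, of pi] by auto

lemma phi_below_ground:
  assumes q: "q absolutely_integrable_on {0<..<pi}" and f: "f \<in> RR" and F: "F \<in> RR" and g: "ground q f F l y dy"
    and m: "m < l" and w: "is_solution q m (w, dw)" "w 0 = poly (down f) m" "dw 0 = - poly (up f) m"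
  shows "\<And>x. 0 < x \<Longrightarrow> x \<le> pi \<Longrightarrow> w x > 0" "poly (down F) m * dw pi - poly (up F) m * w pi > 0"
proof -
  have y: "below l f" "y 0 = poly (down f) l" "dy 0 = - poly (up f) l" using g by (auto simp: ground_def)
  have bm: "below m f" using below_mono[OF y(1)] m by auto
  have s: "w 0 > 0 \<or> w 0 = 0 \<and> dw 0 > 0"
    using down_pos[OF f bm] by (cases "f = None") (auto simp: w)
  have W0: "dw 0 * y 0 - w 0 * dy 0 \<ge> 0"
    using up_down_mono[OF f y(1), of m] m by (simp add: w y algebra_simps)
  note P = below_ground_forward[OF q f F g m w(1) s W0]
  show "\<And>x. 0 < x \<Longrightarrow> x \<le> pi \<Longrightarrow> w x > 0" "poly (down F) m * dw pi - poly (up F) m * w pi > 0"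
    using P by blast+
qed

text \<open>An eigenfunction at m < l is a multiple of \<phi> at m, whose right boundary form is
  strictly positive by comparison, so it cannot satisfy the right condition.\<close>

lemma ground_lowest:
  assumes q: "q absolutely_integrable_on {0<..<pi}" and f: "f \<in> RR" and F: "F \<in> RR" and g: "ground q f F l y dy"
  shows "lowest_ev (q, f, F) = l"
  unfolding lowest_ev_def
proof (rule Least_equality)
  have y: "is_solution q l (y, dy)" "y (pi / 2) > 0" "y 0 = poly (down f) l" "dy 0 = - poly (up f) l"
    "poly (down F) l * dy pi = poly (up F) l * y pi" "below l f" using g by (auto simp: ground_def)
  have "\<exists>x\<in>{0..pi}. y x \<noteq> 0" using y(2) by (intro bexI[of _ "pi / 2"]) auto
  then show "eigenvalue (q, f, F) l"
    unfolding eigenvalue_def prod.case using y by (intro exI[of _ y] exI[of _ dy]) simp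
  fix m assume e: "eigenvalue (q, f, F) m"
  show "l \<le> m"
  proof (rule ccontr)
    assume "\<not> l \<le> m"
    then have m: "m < l" by simp
    obtain u du x where u: "is_solution q m (u, du)" "x \<in> {0..pi}" "u x \<noteq> 0"
      "poly (down f) m * du 0 + poly (up f) m * u 0 = 0" "poly (down F) m * du pi - poly (up F) m * u pi = 0"
      using e by (auto simp: eigenvalue_def)
    define w dw where "w = fst (phi q f m)" and "dw = snd (phi q f m)"
    note w = phi_solution[OF q, where f = f and l = m, folded w_def dw_def]
    have bm: "below m f" using below_mono[OF y(6)] m by auto
    have "w 0 \<noteq> 0 \<or> dw 0 \<noteq> 0" using down_pos[OF f bm] by (cases "f = None") (auto simp: w)
    moreover have "du 0 * w 0 = u 0 * dw 0" using u(4) by (simp add: w algebra_simps)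
    ultimately obtain k where k: "\<And>x. x \<in> {0..pi} \<Longrightarrow> u x = k * w x" "\<And>x. x \<in> {0..pi} \<Longrightarrow> du x = k * dw x"
      using solution_proportional[OF q u(1) w(1), of 0] by auto
    have "k \<noteq> 0" using k(1)[OF u(2)] u(3) by auto
    moreover have "k * (poly (down F) m * dw pi - poly (up F) m * w pi) = 0"
      using u(5) k[of pi] by (simp add: algebra_simps)
    ultimately show False using phi_below_ground(2)[OF q f F g m w] by simp
  qed
qed

text \<open>If l \<le> m, the Wronskian of y and u is nondecreasing, while the boundary inequalities
  and the monotonicity of f and F give W(0) \<ge> 0 \<ge> W(\<pi>). For l < m the increase is
  strict, a contradiction; for l = m both boundary forms of u would vanish, against
  \<open>strict\<close>.\<close>

lemma supersolution_below_ground: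
  assumes q: "q absolutely_integrable_on {0<..<pi}" and f: "f \<in> RR" and F: "F \<in> RR" and g: "ground q f F l y dy"
    and u: "is_solution q m (u, du)" "\<And>x. x \<in> {0..pi} \<Longrightarrow> u x > 0" "below m f" "below m F"
    and le: "poly (down f) m * du 0 + poly (up f) m * u 0 \<le> 0" "poly (down F) m * du pi - poly (up F) m * u pi \<ge> 0"
    and strict: "poly (down f) m * du 0 + poly (up f) m * u 0 < 0 \<or> poly (down F) m * du pi - poly (up F) m * u pi > 0"
  shows "m < l"
proof (rule ccontr)
  assume "\<not> m < l"
  then have lm: "l \<le> m" by simp
  have y: "is_solution q l (y, dy)" "\<And>x. x \<in> {0<..<pi} \<Longrightarrow> y x > 0" "y 0 = poly (down f) l" "dy 0 = - poly (up f) l" "below l f" "below l F"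
    using g by (auto simp: ground_def)
  obtain k where k: "k > 0" "y pi = k * poly (down F) l" "dy pi = k * poly (up F) l"
    by (rule ground_end[OF q F g])
  define W where "W x = dy x * u x - y x * du x" for x
  have W': "(W has_real_derivative (m - l) * (y x * u x)) (at x within {0..pi})" if "x \<in> {0..pi}" for x
    unfolding W_def by (rule solution_wronskian[OF q y(1) u(1) that])
  have u0: "u 0 > 0" "u pi > 0" using u(2) by auto
  have W0: "W 0 \<ge> 0"
  proof (cases "f = None")
    case True then show ?thesis using u0 by (simp add: W_def y)
  next
    case False
    have D: "poly (down f) m > 0" "poly (down f) l > 0" using down_pos[OF f] u(3) y(5) False by auto
    have "poly (down f) l * (poly (down f) m * du 0 + poly (up f) m * u 0) \<le> 0"
      using D le(1) by (simp add: mult_le_0_iff)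
    moreover have "poly (up f) l * poly (down f) m * u 0 \<le> poly (up f) m * poly (down f) l * u 0"
      using up_down_mono[OF f u(3) lm] u0 by (intro mult_right_mono) auto
    ultimately have "poly (down f) m * W 0 \<ge> 0" by (simp add: W_def y algebra_simps)
    then show ?thesis using D by (simp add: zero_le_mult_iff)
  qed
  have Wpi: "W pi \<le> 0"
  proof (cases "F = None")
    case True then show ?thesis using u0 k by (simp add: W_def)
  next
    case False
    have D: "poly (down F) m > 0" "poly (down F) l > 0" using down_pos[OF F] u(4) y(6) False by auto
    have "poly (down F) l * (poly (down F) m * du pi - poly (up F) m * u pi) \<ge> 0"
      using D le(2) by simp
    moreover have "poly (up F) l * poly (down F) m * u pi \<le> poly (up F) m * poly (down F) l * u pi"
      using up_down_mono[OF F u(4) lm] u0 by (intro mult_right_mono) auto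
    ultimately have "poly (down F) m * (poly (up F) l * u pi - poly (down F) l * du pi) \<le> 0" by (simp add: algebra_simps)
    then have "poly (up F) l * u pi - poly (down F) l * du pi \<le> 0" using D by (simp add: mult_le_0_iff)
    then have "k * (poly (up F) l * u pi - poly (down F) l * du pi) \<le> 0" using k(1) by (simp add: mult_le_0_iff)
    then show ?thesis by (simp add: W_def k algebra_simps)
  qed
  show False
  proof (cases "l = m")
    case False
    have "W 0 < W pi"
      by (rule strict_increasing_on_interval[OF W']) (use False lm y(2) u(2) in auto)
    then show False using W0 Wpi by simp
  next
    case True
    have "W 0 = W pi" using W' True by (intro constant_on_interval[of 0 pi W]) auto
    then have W00: "W 0 = 0" "W pi = 0" using W0 Wpi by auto
    then have "poly (down f) m * du 0 + poly (up f) m * u 0 = 0" using True by (simp add: W_def y algebra_simps)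
    moreover have "k * (poly (down F) m * du pi - poly (up F) m * u pi) = 0"
      using W00(2) True by (auto simp: W_def k algebra_simps)
    ultimately show False using strict k(1) by simp
  qed
qed


section \<open>Existence of a ground state\<close>

lemma isCont_close:
  fixes h :: "real \<Rightarrow> real"
  assumes "isCont h s" "e > 0"
  shows "\<exists>d>0. \<forall>l. \<bar>l - s\<bar> < d \<longrightarrow> \<bar>h l - h s\<bar> < e"
  using assms by (simp add: continuous_at_eps_delta dist_real_def)

lemma phi_perturbation:
  assumes q: "q absolutely_integrable_on {0<..<pi}" and e: "e > 0"
  obtains d where "d > 0" "\<And>l x. \<bar>l - l0\<bar> < d \<Longrightarrow> x \<in> {0..pi} \<Longrightarrow>
    \<bar>fst (phi q f l) x - fst (phi q f l0) x\<bar> < e \<and> \<bar>snd (phi q f l) x - snd (phi q f l0) x\<bar> < e"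
proof -
  obtain d where d: "d > 0" "\<And>l y dy x. \<bar>l - l0\<bar> < d \<Longrightarrow> is_solution q l (y, dy) \<Longrightarrow> \<bar>y 0 - fst (phi q f l0) 0\<bar> < d \<Longrightarrow>
    \<bar>dy 0 - snd (phi q f l0) 0\<bar> < d \<Longrightarrow> x \<in> {0..pi} \<Longrightarrow> \<bar>y x - fst (phi q f l0) x\<bar> < e \<and> \<bar>dy x - snd (phi q f l0) x\<bar> < e"
    using solution_perturbation[OF q phi_solution(1)[OF q, of l0 f] e] by blast
  from isCont_close[OF poly_isCont d(1), of l0 "down f"] isCont_close[OF poly_isCont d(1), of l0 "up f"] obtain d1 d2
    where d1: "d1 > 0" "\<And>l. \<bar>l - l0\<bar> < d1 \<Longrightarrow> \<bar>poly (down f) l - poly (down f) l0\<bar> < d"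
    and d2: "d2 > 0" "\<And>l. \<bar>l - l0\<bar> < d2 \<Longrightarrow> \<bar>poly (up f) l - poly (up f) l0\<bar> < d"
    by blast
  show thesis
  proof (rule that[of "min d (min d1 d2)"])
    fix l x assume l: "\<bar>l - l0\<bar> < min d (min d1 d2)" and x: "x \<in> {0..pi}"
    have "\<bar>- poly (up f) l + poly (up f) l0\<bar> < d" using d2(2)[of l] l by (simp add: abs_minus_commute)
    then show "\<bar>fst (phi q f l) x - fst (phi q f l0) x\<bar> < e \<and> \<bar>snd (phi q f l) x - snd (phi q f l0) x\<bar> < e"
      using l d1(2)[of l] by (intro d(2)[OF _ phi_solution(1)[OF q] _ _ x]) (simp_all add: phi_solution[OF q])
  qed (use d d1 d2 in auto)
qed

text \<open>The characteristic function: it vanishes exactly when \<phi> satisfies the right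
  boundary condition.\<close>

definition boundary_form :: "(real \<Rightarrow> real) \<Rightarrow> coeff \<Rightarrow> coeff \<Rightarrow> real \<Rightarrow> real" where
  "boundary_form q f F l = poly (down F) l * snd (phi q f l) pi - poly (up F) l * fst (phi q f l) pi"

text \<open>The parameters at which \<phi> behaves as below the lowest eigenvalue; their supremum
  will be that eigenvalue. The point x = 0 is left out because \<phi> vanishes there under a
  Dirichlet condition.\<close>

definition subcritical :: "(real \<Rightarrow> real) \<Rightarrow> coeff \<Rightarrow> coeff \<Rightarrow> real set" where
  "subcritical q f F = {l. below l f \<and> below l F \<and> (\<forall>x. 0 < x \<and> x \<le> pi \<longrightarrow> fst (phi q f l) x > 0) \<and> boundary_form q f F l > 0}"

lemma phi_isCont:
  assumes q: "q absolutely_integrable_on {0<..<pi}" and x: "x \<in> {0..pi}"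
  shows "isCont (\<lambda>l. fst (phi q f l) x) l0" "isCont (\<lambda>l. snd (phi q f l) x) l0"
proof -
  have "\<exists>d>0. \<forall>l. \<bar>l - l0\<bar> < d \<longrightarrow> \<bar>fst (phi q f l) x - fst (phi q f l0) x\<bar> < e \<and>
      \<bar>snd (phi q f l) x - snd (phi q f l0) x\<bar> < e" if e: "e > 0" for e
    using phi_perturbation[OF q e, of l0 f] x by metis
  then show "isCont (\<lambda>l. fst (phi q f l) x) l0" "isCont (\<lambda>l. snd (phi q f l) x) l0"
    unfolding continuous_at_eps_delta dist_real_def by blast+
qed

lemma boundary_form_isCont:
  assumes q: "q absolutely_integrable_on {0<..<pi}"
  shows "isCont (boundary_form q f F) l0"
  unfolding boundary_form_def[abs_def] using phi_isCont[OF q, where x = pi and f = f] by (intro continuous_intros) auto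

text \<open>Positivity of a solution makes \<open>\<integral> (\<eta>'\<^sup>2 + q \<eta>\<^sup>2 - l \<eta>\<^sup>2)\<close> nonnegative for test functions \<open>\<eta>\<close>; here
  \<open>\<eta>(x) = cos 2x\<close> on \<open>[\<pi>/4, 3\<pi>/4]\<close>.\<close>

lemma subcritical_bdd_above:
  assumes q: "q absolutely_integrable_on {0<..<pi}"
  shows "bdd_above (subcritical q f F)"
proof -
  note P = potentialI[OF q]
  define Q where "Q x = integral {0..x} q" for x
  note Qc = potential_continuous[OF P, folded Q_def]
  obtain B where B0: "B > 0" and B: "\<And>x. x \<in> {0..pi} \<Longrightarrow> \<bar>Q x\<bar> \<le> B"
    using continuous_bound[OF Qc] by blast
  \<comment> \<open>Bounds 4 sin^2(2x) + 4 cos(2x) sin(2x) Q, which is left over in H' after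
    completing the square.\<close>
  define C where "C = 4 + 4 * B"
  have "l \<le> 2 * C" if l: "l \<in> subcritical q f F" for l
  proof -
    define y dy where "y = fst (phi q f l)" and "dy = snd (phi q f l)"
    define z where "z x = dy x - Q x * y x" for x
    have y: "y x > 0" if "0 < x" "x \<le> pi" for x using l that by (simp add: subcritical_def y_def)
    have yz: "qsys Q l y z"
      using phi_solution(1)[OF q, of l f, folded y_def dy_def] is_solution_iff_qsys[OF P, folded Q_def]
      by (simp add: z_def[abs_def])
    define \<rho> where "\<rho> x = z x / y x" for x
    define a b where "a = pi / 4" and "b = 3 * pi / 4"
    have ab: "0 < a" "a < b" "b < pi" by (simp_all add: a_def b_def)
    have \<rho>: "(\<rho> has_real_derivative - l - (Q x + \<rho> x)\<^sup>2) (at x within {a..b})" if x: "x \<in> {a..b}" for x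
    proof -
      have xp: "x \<in> {0..pi}" and yx: "y x \<noteq> 0" using x ab y[of x] by auto
      have "(\<rho> has_real_derivative ((- (l + (Q x)\<^sup>2) * y x - Q x * z x) * y x - z x * (z x + Q x * y x)) / (y x * y x)) (at x within {0..pi})"
        unfolding \<rho>_def by (rule DERIV_divide[OF qsysD(2)[OF yz xp] qsysD(1)[OF yz xp] yx])
      moreover have "((- (l + (Q x)\<^sup>2) * y x - Q x * z x) * y x - z x * (z x + Q x * y x)) / (y x * y x) = - l - (Q x + \<rho> x)\<^sup>2"
        using yx by (simp add: \<rho>_def field_simps power2_eq_square)
      ultimately show ?thesis using DERIV_subset[of \<rho> _ x "{0..pi}" "{a..b}"] ab by auto
    qed
    \<comment> \<open>The summand with l is an antiderivative of l cos^2(2x), so l cancels in H' and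
      returns in H(b) - H(a) as l (b - a) / 2; the terms with \<rho> vanish at both ends together
      with cos(2x).\<close>
    define H where "H x = (cos (2 * x))\<^sup>2 * \<rho> x + l * (x / 2 + sin (4 * x) / 8) - C * x" for x
    define H' where "H' x = - 4 * cos (2 * x) * sin (2 * x) * \<rho> x + (cos (2 * x))\<^sup>2 * (- l - (Q x + \<rho> x)\<^sup>2)
      + l * (1 / 2 + cos (4 * x) / 2) - C" for x
    have "H b \<le> H a"
    proof (rule nonincreasing_on_interval[where a = a and b = b and f = H and f' = H'])
      fix x assume x: "x \<in> {a..b}"
      show "(H has_real_derivative H' x) (at x within {a..b})"
        unfolding H_def H'_def using \<rho>[OF x]
        by (auto intro!: derivative_eq_intros simp: power2_eq_square algebra_simps)
    next
      fix x assume x: "a < x" "x < b"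
      define c s R where "c = cos (2 * x)" and "s = sin (2 * x)" and "R = Q x + \<rho> x"
      have c2: "1 / 2 + cos (4 * x) / 2 = c\<^sup>2" using cos_double_cos[of "2 * x"] by (simp add: c_def field_simps)
      have cs: "\<bar>c\<bar> \<le> 1" "\<bar>s\<bar> \<le> 1" by (simp_all add: c_def s_def)
      have "H' x = - (c * R + 2 * s)\<^sup>2 + 4 * s\<^sup>2 + 4 * c * s * Q x - C"
        unfolding H'_def c2 c_def[symmetric] s_def[symmetric] R_def
        by (simp add: power2_eq_square algebra_simps)
      moreover have "s\<^sup>2 \<le> 1" using cs(2) by (metis abs_square_le_1)
      moreover have "4 * c * s * Q x \<le> 4 * B"
      proof -
        have "\<bar>c * s * Q x\<bar> \<le> 1 * 1 * B" unfolding abs_mult using cs B[of x] x ab by (intro mult_mono) auto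
        then show ?thesis by linarith
      qed
      moreover have "- (c * R + 2 * s)\<^sup>2 \<le> 0" by simp
      ultimately show "H' x \<le> 0" unfolding C_def by linarith
    qed (use ab in auto)
    moreover have "cos (2 * a) = 0" by (simp add: a_def)
    moreover have "cos (2 * b) = 0"
    proof -
      have "2 * b = pi + pi / 2" by (simp add: b_def field_simps)
      then show ?thesis by (simp only: cos_add) simp
    qed
    moreover have "sin (4 * a) = 0" by (simp add: a_def)
    moreover have "sin (4 * b) = 0"
    proof -
      have "4 * b = 3 * pi" by (simp add: b_def)
      then show ?thesis by (simp only: sin_npi_numeral)
    qed
    ultimately have "l * (b / 2) - C * b \<le> l * (a / 2) - C * a" by (simp add: H_def)
    then have "pi * l \<le> pi * (2 * C)" by (simp add: a_def b_def field_simps)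
    then show ?thesis by (metis mult_le_cancel_left_pos pi_gt_zero)
  qed
  then show ?thesis by (rule bdd_aboveI)
qed

text \<open>For very negative \<open>l\<close> the solution is compared with \<open>exp (\<integral> (Q + a))\<close>, \<open>a\<close> linear, which is a
  strict subsolution with prescribed logarithmic derivatives at both ends.\<close>

lemma subcritical_nonempty:
  assumes q: "q absolutely_integrable_on {0<..<pi}" and f: "f \<in> RR" and F: "F \<in> RR"
  shows "subcritical q f F \<noteq> {}"
proof -
  note P = potentialI[OF q]
  define Q where "Q x = integral {0..x} q" for x
  note Qc = potential_continuous[OF P, folded Q_def]
  obtain m1 where m1: "below m1 f" by (rule below_exists[OF f])
  obtain m2 where m2: "below m2 F" by (rule below_exists[OF F])
  \<comment> \<open>Upper bounds, by monotonicity, for f on (-\<infinity>, m1] and for F on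
    (-\<infinity>, m2] when these are finite coefficients. They do not depend on l, so l can be
    chosen last.\<close>
  define c0 c1 where "c0 = (if f = None then 0 else poly (up f) m1 / poly (down f) m1)"
    and "c1 = (if F = None then 0 else poly (up F) m2 / poly (down F) m2)"
  have bound: "poly (up G) l \<le> (if G = None then 0 else poly (up G) m / poly (down G) m) * poly (down G) l"
    if G: "G \<in> RR" "below m G" "l \<le> m" for G l m
  proof (cases "G = None")
    case False
    then show ?thesis using up_down_mono[OF G] down_pos[OF G(1,2) False] by (simp add: field_simps)
  qed simp
  \<comment> \<open>Chosen so that Q + a, the logarithmic derivative of the comparison function,
    equals -c0 at 0 and c1 at \<pi>.\<close>
  define d where "d = (c1 - Q pi + c0) / pi"
  define a where "a x = - c0 + d * x" for x
  have api: "a pi = c1 - Q pi" by (simp add: a_def d_def)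
  have ac: "continuous_on {0..pi} a" unfolding a_def by (intro continuous_intros)
  have "bounded ((\<lambda>x. (Q x + a x)\<^sup>2 + d) ` {0..pi})"
    by (intro compact_imp_bounded compact_continuous_image continuous_intros Qc ac) auto
  then obtain B where "\<forall>v\<in>(\<lambda>x. (Q x + a x)\<^sup>2 + d) ` {0..pi}. norm v \<le> B" unfolding bounded_iff by blast
  then have B: "(Q x + a x)\<^sup>2 + d \<le> B" if "x \<in> {0..pi}" for x using that by force
  \<comment> \<open>Makes the coefficient -l - (Q + a)^2 - d in the derivative of the Wronskian at
    least 1.\<close>
  define l where "l = min (min m1 m2) (- B - 1)"
  have l: "l \<le> m1" "l \<le> m2" "l \<le> - B - 1" by (auto simp: l_def)
  have bl: "below l f" "below l F" using below_mono m1 m2 l by blast+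
  define w dw where "w = fst (phi q f l)" and "dw = snd (phi q f l)"
  note w = phi_solution[OF q, where f = f and l = l, folded w_def dw_def]
  define z where "z x = dw x - Q x * w x" for x
  have wq: "qsys Q l w z" using w(1) is_solution_iff_qsys[OF P, folded Q_def] by (simp add: z_def[abs_def])
  define y where "y x = exp (integral {0..x} (\<lambda>t. Q t + a t))" for x
  define dy where "dy x = (Q x + a x) * y x" for x
  have ypos: "y x > 0" for x by (simp add: y_def)
  have y': "(y has_real_derivative dy x) (at x within {0..pi})" if x: "x \<in> {0..pi}" for x
  proof -
    have "((\<lambda>x. integral {0..x} (\<lambda>t. Q t + a t)) has_real_derivative Q x + a x) (at x within {0..pi})"
      by (intro integral_has_real_derivative continuous_intros Qc ac x)
    from DERIV_chain2[OF DERIV_exp this] show ?thesis by (simp add: y_def[abs_def] dy_def mult.commute)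
  qed
  have y0: "y 0 = 1" by (simp add: y_def)
  have a': "(a has_real_derivative d) (at x within {0..pi})" for x
    unfolding a_def by (auto intro!: derivative_eq_intros)
  define c where "c x = - l - (Q x + a x)\<^sup>2 - d" for x
  have W: "((\<lambda>x. dw x * y x - w x * dy x) has_real_derivative c x * (w x * y x)) (at x within {0..pi})" if x: "x \<in> {0..pi}" for x
  proof -
    have "((\<lambda>x. z x * y x - w x * (a x * y x)) has_real_derivative
      ((- (l + (Q x)\<^sup>2) * w x - Q x * z x) * y x + dy x * z x) - ((z x + Q x * w x) * (a x * y x) + (d * y x + dy x * a x) * w x)) (at x within {0..pi})"
      by (intro DERIV_diff DERIV_mult qsysD[OF wq x] y' a' x)
    also have "(\<lambda>x. z x * y x - w x * (a x * y x)) = (\<lambda>x. dw x * y x - w x * dy x)"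
      by (simp add: z_def dy_def algebra_simps)
    finally show ?thesis by (rule DERIV_cong) (simp add: c_def dy_def power2_eq_square algebra_simps)
  qed
  have cpos: "c x > 0" if "0 < x" "x < pi" for x using B[of x] that l(3) by (simp add: c_def)
  have start: "w 0 > 0 \<or> w 0 = 0 \<and> dw 0 > 0"
    using down_pos[OF f bl(1)] by (cases "f = None") (auto simp: w)
  have W0: "dw 0 * y 0 - w 0 * dy 0 \<ge> 0"
    using bound[OF f m1 l(1)] by (simp add: w y0 dy_def a_def c0_def Q_def mult.commute)
  note PF = positive_forward[where w = w and dw = dw and y = y and dy = dy and c = c, OF pi_gt_zero solution_derivative[OF w(1)] W]
  have pos: "w x > 0" if "0 < x" "x \<le> pi" for x
    by (rule PF(1)) (use ypos cpos start W0 that in \<open>auto intro: less_imp_le\<close>)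
  have "dw pi * y pi - w pi * dy pi > 0"
    by (rule PF(2)) (use ypos cpos start W0 in \<open>auto intro: less_imp_le\<close>)
  moreover have "dy pi = c1 * y pi" by (simp add: dy_def api)
  ultimately have "(dw pi - c1 * w pi) * y pi > 0" by (simp add: algebra_simps)
  then have ineq: "dw pi > c1 * w pi" using ypos[of pi] by (simp add: zero_less_mult_iff)
  have "poly (down F) l * dw pi - poly (up F) l * w pi > 0"
  proof (cases "F = None")
    case True then show ?thesis using pos[of pi] by simp
  next
    case False
    have D: "poly (down F) l > 0" by (rule down_pos[OF F bl(2) False])
    have "poly (up F) l * w pi \<le> c1 * poly (down F) l * w pi"
      using bound[OF F m2 l(2)] pos[of pi] unfolding c1_def by (intro mult_right_mono) auto
    also have "\<dots> < poly (down F) l * dw pi" using mult_strict_left_mono[OF ineq D] by (simp add: mult_ac)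
    finally show ?thesis by simp
  qed
  then have "l \<in> subcritical q f F" using bl pos by (simp add: subcritical_def boundary_form_def w_def dw_def)
  then show ?thesis by blast
qed


text \<open>At the supremum s of the subcritical parameters one of the defining conditions must
  fail, since together they persist under small changes of l. Poles and interior zeros at s are
  ruled out, so the boundary form vanishes and \<phi> is a ground state.\<close>

lemma ground_exists:
  assumes q: "q absolutely_integrable_on {0<..<pi}" and f: "f \<in> RR" and F: "F \<in> RR"
  obtains l where "ground q f F l (fst (phi q f l)) (snd (phi q f l))"
proof -
  define A where "A = subcritical q f F"
  define y dy where "y l = fst (phi q f l)" and "dy l = snd (phi q f l)" for l
  note sol = phi_solution[OF q, where f = f, folded y_def dy_def]
  have bdd: "bdd_above A" unfolding A_def by (rule subcritical_bdd_above[OF q])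
  have ne: "A \<noteq> {}" unfolding A_def by (rule subcritical_nonempty[OF q f F])
  have AD: "below l f" "below l F" "\<And>x. 0 < x \<Longrightarrow> x \<le> pi \<Longrightarrow> y l x > 0" "boundary_form q f F l > 0" if "l \<in> A" for l
    using that by (auto simp: A_def subcritical_def y_def)
  define s where "s = Sup A"
  have near: "\<exists>l\<in>A. s - e < l \<and> l \<le> s" if "e > 0" for e
    using less_cSupD[OF ne, of "s - e"] cSup_upper[OF _ bdd] that by (auto simp: s_def)
  have limit: "h s \<ge> 0" if h: "isCont h s" "\<And>l. l \<in> A \<Longrightarrow> h l > 0" for h :: "real \<Rightarrow> real"
  proof (rule ccontr)
    assume "\<not> h s \<ge> 0"
    then obtain d where d: "d > 0" "\<And>l. \<bar>l - s\<bar> < d \<Longrightarrow> \<bar>h l - h s\<bar> < - h s"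
      using isCont_close[OF h(1), of "- h s"] by force
    obtain l where l: "l \<in> A" "s - d < l" "l \<le> s" using near[OF d(1)] by blast
    then have "\<bar>h l - h s\<bar> < - h s" by (intro d(2)) auto
    then show False using h(2)[OF l(1)] by auto
  qed
  have bl: "below l f" "below l F" if ls: "l < s" for l
  proof -
    obtain l' where "l' \<in> A" "l < l'" using near[of "s - l"] ls by auto
    then show "below l f" "below l F" using AD(1,2) below_mono by (meson less_imp_le)+
  qed
  have y_nonneg: "y s x \<ge> 0" if x: "x \<in> {0<..pi}" for x
    by (rule limit) (use phi_isCont(1)[OF q, where x = x and f = f] AD(3) x in \<open>auto simp: y_def\<close>)
  \<comment> \<open>At the smallest pole \<phi> would start from 0 with derivative
    -\<open>up\<close> < 0, against its nonnegativity as a limit.\<close>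
  have bf: "below s f"
  proof (rule ccontr)
    assume nb: "\<not> below s f"
    from at_smallest_pole[OF f bl(1) nb] have y0: "y s 0 = 0" "- dy s 0 > 0" by (auto simp: sol)
    have "((\<lambda>x. - y s x) has_real_derivative - dy s 0) (at 0 within {0..pi})"
      by (intro DERIV_minus solution_derivative[OF sol(1)]) simp
    then obtain d where d: "d > 0" "\<forall>h>0. 0 + h \<in> {0..pi} \<longrightarrow> h < d \<longrightarrow> - y s 0 < - y s (0 + h)"
      using has_real_derivative_pos_inc_right y0(2) by blast
    define h where "h = min d pi / 2"
    have h: "0 < h" "h < d" "h < pi" using d pi_gt_zero by (auto simp: h_def min_def)
    then have "y s h < 0" using d(2) y0 by auto
    then show False using y_nonneg[of h] h by simp
  qed
  have nt: "y s 0 \<noteq> 0 \<or> dy s 0 \<noteq> 0"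
    using down_pos[OF f bf] by (cases "f = None") (auto simp: sol)
  have nontriv: "\<not> (y s x = 0 \<and> dy s x = 0)" if "x \<in> {0..pi}" for x
    using solution_nontrivial[OF q sol(1), of x s 0] that nt by auto
  \<comment> \<open>An interior zero would be a local minimum, so the derivative would vanish
    together with \<phi>.\<close>
  have y_pos: "y s x > 0" if x: "x \<in> {0<..<pi}" for x
  proof (rule ccontr)
    assume "\<not> y s x > 0"
    then have y0: "y s x = 0" using y_nonneg[of x] x by force
    have "at x within {0..pi} = at x" using x by (intro at_within_interior) (auto simp: interior_atLeastAtMost_real)
    then have "(y s has_real_derivative dy s x) (at x)" using solution_derivative[OF sol(1), of x s] x by simp
    moreover have "\<forall>t. \<bar>x - t\<bar> < min x (pi - x) \<longrightarrow> y s x \<le> y s t"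
    proof (intro allI impI)
      fix t assume "\<bar>x - t\<bar> < min x (pi - x)"
      then have "t \<in> {0<..pi}" by (auto simp: abs_less_iff)
      then show "y s x \<le> y s t" using y_nonneg[of t] y0 by simp
    qed
    ultimately have "dy s x = 0"
      using DERIV_local_min[of "y s" "dy s x" x "min x (pi - x)"] x by simp
    then show False using nontriv[of x] y0 x by simp
  qed
  have y_end: "dy s pi < 0" if "y s pi = 0"
    by (rule negative_end_derivative[OF q sol(1) y_pos that])
  have ypi: "y s pi \<ge> 0" using y_nonneg[of pi] by simp
  have chi0: "boundary_form q f F s \<ge> 0" by (rule limit[OF boundary_form_isCont[OF q]]) (rule AD(4))
  have chi_s: "boundary_form q f F s = poly (down F) s * dy s pi - poly (up F) s * y s pi"
    by (simp add: boundary_form_def y_def dy_def)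
  \<comment> \<open>At a pole \<open>down\<close> vanishes and \<open>up\<close> > 0, so a
    nonnegative boundary form forces \<phi>(\<pi>) = 0 and a negative derivative there. By
    continuity the boundary form is then negative for subcritical l close to s.\<close>
  have bF: "below s F"
  proof (rule ccontr)
    assume nb: "\<not> below s F"
    note pole = at_smallest_pole[OF F bl(2) nb]
    have y0: "y s pi = 0"
    proof (rule ccontr)
      assume "y s pi \<noteq> 0"
      then have "poly (up F) s * y s pi > 0" using pole ypi by simp
      then show False using chi0 pole by (simp add: chi_s)
    qed
    have "isCont (\<lambda>l. dy l pi) s" using phi_isCont(2)[OF q, where x = pi and f = f] by (simp add: dy_def)
    then obtain d1 where d1: "d1 > 0" "\<And>l. \<bar>l - s\<bar> < d1 \<Longrightarrow> \<bar>dy l pi - dy s pi\<bar> < - dy s pi"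
      using isCont_close[where h = "\<lambda>l. dy l pi" and s = s and e = "- dy s pi"] y_end[OF y0] by force
    have "isCont (poly (up F)) s" by (rule poly_isCont)
    then obtain d2 where d2: "d2 > 0" "\<And>l. \<bar>l - s\<bar> < d2 \<Longrightarrow> \<bar>poly (up F) l - poly (up F) s\<bar> < poly (up F) s"
      using isCont_close[OF _ pole(2)] by blast
    obtain l where l: "l \<in> A" "s - min d1 d2 < l" "l \<le> s" using near[of "min d1 d2"] d1 d2 by auto
    have "s - l < min d1 d2" using l by linarith
    then have "\<bar>l - s\<bar> < d1" "\<bar>l - s\<bar> < d2" using l by auto
    then have "\<bar>dy l pi - dy s pi\<bar> < - dy s pi" "\<bar>poly (up F) l - poly (up F) s\<bar> < poly (up F) s"
      by (auto intro: d1(2) d2(2))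
    then have "dy l pi < 0" "poly (up F) l > 0" by linarith+
    moreover have "poly (down F) l \<ge> 0" by (rule down_nonneg[OF F AD(2)[OF l(1)]])
    moreover have "y l pi > 0" using AD(3)[OF l(1), of pi] by simp
    ultimately have "poly (down F) l * dy l pi \<le> 0" "poly (up F) l * y l pi > 0"
      by (simp_all add: mult_nonneg_nonpos)
    then show False using AD(4)[OF l(1)] by (simp add: boundary_form_def y_def dy_def)
  qed
  have "boundary_form q f F s = 0"
  proof (rule ccontr)
    assume "boundary_form q f F s \<noteq> 0"
    then have cp: "boundary_form q f F s > 0" using chi0 by simp
    have ypi: "y s pi > 0"
    proof (rule ccontr)
      assume "\<not> y s pi > 0"
      then have y0: "y s pi = 0" using ypi by simp
      have "poly (down F) s * dy s pi \<le> 0"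
        using y_end[OF y0] down_nonneg[OF F bF] by (simp add: mult_nonneg_nonpos)
      then show False using cp y0 by (simp add: chi_s)
    qed
    have pos': "y s x > 0" if "0 < x" "x \<le> pi" for x using y_pos[of x] ypi that by (cases "x = pi") auto
    obtain e1 where e1: "e1 > 0" "\<And>l. l < s + e1 \<Longrightarrow> below l f" using below_open[OF f bf] by blast
    obtain e2 where e2: "e2 > 0" "\<And>l. l < s + e2 \<Longrightarrow> below l F" using below_open[OF F bF] by blast
    obtain e3 where e3: "e3 > 0" "\<And>l. \<bar>l - s\<bar> < e3 \<Longrightarrow> \<bar>boundary_form q f F l - boundary_form q f F s\<bar> < boundary_form q f F s"
      using isCont_close[OF boundary_form_isCont[OF q] cp] by blast
    have yc: "continuous_on {0..pi} (y s)" by (rule solution_continuous[OF sol(1)])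
    have "\<exists>e4>0. \<forall>l. \<bar>l - s\<bar> < e4 \<longrightarrow> below l f \<longrightarrow> (\<forall>x. 0 < x \<and> x \<le> pi \<longrightarrow> y l x > 0)"
    proof -
      \<comment> \<open>Uniform closeness preserves positivity on [b, \<pi>]; near 0 it comes from
        \<phi>(0) > 0, or in the Dirichlet case from \<phi>' being close to 1.\<close>
      obtain b where b: "0 < b" "b < pi" and bpos: "\<exists>e>0. \<forall>l. \<bar>l - s\<bar> < e \<longrightarrow> below l f \<longrightarrow> (\<forall>x. 0 < x \<and> x \<le> b \<longrightarrow> y l x > 0)"
      proof (cases "y s 0 > 0")
        case True
        have "continuous (at 0 within {0..pi}) (y s)" using yc by (simp add: continuous_on_eq_continuous_within)
        then obtain d where d: "d > 0" "\<And>x. x \<in> {0..pi} \<Longrightarrow> dist x 0 < d \<Longrightarrow> dist (y s x) (y s 0) < y s 0 / 2"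
          using True unfolding continuous_within_eps_delta by (meson half_gt_zero)
        obtain e where e: "e > 0" "\<And>l x. \<bar>l - s\<bar> < e \<Longrightarrow> x \<in> {0..pi} \<Longrightarrow> \<bar>y l x - y s x\<bar> < y s 0 / 2"
          using phi_perturbation[OF q half_gt_zero[OF True], of s f] unfolding y_def by metis
        define b where "b = min d pi / 2"
        have b: "0 < b" "b < pi" "b < d" using d pi_gt_zero by (auto simp: b_def min_def)
        have "y l x > 0" if "\<bar>l - s\<bar> < e" "0 < x" "x \<le> b" for l x
        proof -
          have "\<bar>y s x - y s 0\<bar> < y s 0 / 2" "\<bar>y l x - y s x\<bar> < y s 0 / 2"
            using d(2)[of x] e(2)[OF that(1), of x] that b unfolding dist_real_def by auto
          then show ?thesis by linarith
        qed
        then show thesis using that[OF b(1,2)] e(1) by blast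
      next
        case False
        then have "f = None" using down_pos[OF f bf] sol(2)[of s] by metis
        then have y0: "y l 0 = 0" "dy l 0 = 1" for l by (simp_all add: sol)
        have "continuous (at 0 within {0..pi}) (dy s)"
          using solution_derivative_continuous[OF sol(1), of s] by (simp add: continuous_on_eq_continuous_within)
        then obtain d where d: "d > 0" "\<And>x. x \<in> {0..pi} \<Longrightarrow> dist x 0 < d \<Longrightarrow> dist (dy s x) (dy s 0) < 1 / 2"
          unfolding continuous_within_eps_delta by (metis half_gt_zero zero_less_one)
        have h: "(1 / 2 :: real) > 0" by simp
        obtain e where e: "e > 0" "\<And>l x. \<bar>l - s\<bar> < e \<Longrightarrow> x \<in> {0..pi} \<Longrightarrow> \<bar>dy l x - dy s x\<bar> < 1 / 2"
          using phi_perturbation[OF q h, of s f] unfolding dy_def by metis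
        define b where "b = min d pi / 2"
        have b: "0 < b" "b < pi" "b < d" using d pi_gt_zero by (auto simp: b_def min_def)
        have "y l x > 0" if l: "\<bar>l - s\<bar> < e" and x: "0 < x" "x \<le> b" for l x
        proof -
          have "y l 0 < y l x"
          proof (rule strict_increasing_on_interval[OF solution_derivative[OF sol(1)]])
            fix t assume "0 < t" "t < x"
            then have "\<bar>dy s t - dy s 0\<bar> < 1 / 2" "\<bar>dy l t - dy s t\<bar> < 1 / 2"
              using d(2)[of t] e(2)[OF l, of t] x b unfolding dist_real_def by auto
            then show "dy l t > 0" unfolding y0 by linarith
          qed (use x b in auto)
          then show ?thesis by (simp add: y0)
        qed
        then show thesis using that[OF b(1,2)] e(1) by blast
      qed
      have "continuous_on {b..pi} (y s)" using b by (intro continuous_on_subset[OF yc]) auto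
      then obtain x0 where x0: "x0 \<in> {b..pi}" "\<And>x. x \<in> {b..pi} \<Longrightarrow> y s x0 \<le> y s x"
        using continuous_attains_inf[of "{b..pi}" "y s"] b by auto
      have yx0: "y s x0 > 0" using pos'[of x0] x0 b by auto
      obtain e5 where e5: "e5 > 0" "\<And>l x. \<bar>l - s\<bar> < e5 \<Longrightarrow> x \<in> {0..pi} \<Longrightarrow> \<bar>y l x - y s x\<bar> < y s x0"
        using phi_perturbation[OF q yx0, of s f] unfolding y_def by metis
      obtain e6 where e6: "e6 > 0" "\<And>l x. \<bar>l - s\<bar> < e6 \<Longrightarrow> below l f \<Longrightarrow> 0 < x \<Longrightarrow> x \<le> b \<Longrightarrow> y l x > 0"
        using bpos by blast
      have "y l x > 0" if l: "\<bar>l - s\<bar> < min e5 e6" "below l f" and x: "0 < x" "x \<le> pi" for l x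
      proof (cases "x \<le> b")
        case True then show ?thesis using e6(2)[of l x] l x by simp
      next
        case False
        then have "y s x0 \<le> y s x" using x by (intro x0(2)) auto
        moreover have "\<bar>y l x - y s x\<bar> < y s x0" using l x by (intro e5(2)) auto
        ultimately show ?thesis by linarith
      qed
      then show ?thesis using e5(1) e6(1) by (intro exI[of _ "min e5 e6"]) auto
    qed
    then obtain e4 where e4: "e4 > 0" "\<And>l x. \<bar>l - s\<bar> < e4 \<Longrightarrow> below l f \<Longrightarrow> 0 < x \<Longrightarrow> x \<le> pi \<Longrightarrow> y l x > 0"
      by blast
    define e where "e = min (min e1 e2) (min e3 e4) / 2"
    have e: "e > 0" "e < e1" "e < e2" "e < e3" "e < e4" using e1 e2 e3 e4 by (auto simp: e_def min_def)
    have "s + e \<in> A"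
      unfolding A_def subcritical_def y_def[symmetric]
    proof (intro CollectI conjI allI impI)
      show bf': "below (s + e) f" using e by (intro e1(2)) simp
      show "below (s + e) F" using e by (intro e2(2)) simp
      show "y (s + e) x > 0" if "0 < x \<and> x \<le> pi" for x using that e bf' by (intro e4(2)) auto
      have "\<bar>boundary_form q f F (s + e) - boundary_form q f F s\<bar> < boundary_form q f F s" using e by (intro e3(2)) auto
      then show "boundary_form q f F (s + e) > 0" by linarith
    qed
    then have "s + e \<le> s" unfolding s_def by (rule cSup_upper[OF _ bdd])
    then show False using e by simp
  qed
  then have "ground q f F s (y s) (dy s)"
    using bf bF sol[of s] y_pos by (simp add: ground_def chi_s)
  then show thesis using that by (simp add: y_def dy_def)
qed

lemma ground_phi:
  assumes "q absolutely_integrable_on {0<..<pi}" "f \<in> RR" "F \<in> RR"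
  defines "l \<equiv> lowest_ev (q, f, F)"
  shows "ground q f F l (fst (phi q f l)) (snd (phi q f l))"
  using ground_exists[OF assms(1-3)] ground_lowest[OF assms(1-3)] unfolding l_def by metis

section \<open>Transformed boundary value problems\<close>

lemma Theta_increasing_eval:
  assumes "f \<in> RR" "below m f" "poly (up f) m < t * poly (down f) m"
  shows "Theta m t f \<in> RR" "below m (Theta m t f)" "Theta m t f \<noteq> None"
    "poly (down (Theta m t f)) l = t * poly (down f) l - poly (up f) l"
    "poly (up (Theta m t f)) l = (l - m) * poly (down f) l - t * poly (down (Theta m t f)) l"
    "poly (deriv_down_sq (Theta m t f)) l = poly (down f) l * poly (down (Theta m t f)) l + (l - m) * poly (deriv_down_sq f) l"
proof -
  obtain g where g: "Theta m t f = Some g" "Some g \<in> RR" "below m (Some g)"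
    "down (Some g) = smult t (down f) - up f"
    "up (Some g) = [:-m, 1:] * down f - smult t (smult t (down f) - up f)"
    by (rule Theta_increasing[OF assms])
  show "Theta m t f \<in> RR" "below m (Theta m t f)" "Theta m t f \<noteq> None" using g by auto
  show d: "poly (down (Theta m t f)) l = t * poly (down f) l - poly (up f) l" for l using g by simp
  show u: "poly (up (Theta m t f)) l = (l - m) * poly (down f) l - t * poly (down (Theta m t f)) l" for l
    unfolding g(1) g(4,5) by (simp add: algebra_simps)
  have d': "poly (pderiv (down (Theta m t f))) l = t * poly (pderiv (down f)) l - poly (pderiv (up f)) l"
    unfolding g(1) g(4) by (simp add: pderiv_diff pderiv_smult)
  have u': "poly (pderiv (up (Theta m t f))) l = poly (down f) l + (l - m) * poly (pderiv (down f)) l - t * poly (pderiv (down (Theta m t f))) l"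
    unfolding g(1) g(4,5) pderiv_diff pderiv_mult by (simp add: pderiv_diff pderiv_smult pderiv_pCons algebra_simps)
  show "poly (deriv_down_sq (Theta m t f)) l = poly (down f) l * poly (down (Theta m t f)) l + (l - m) * poly (deriv_down_sq f) l"
    unfolding deriv_down_sq_def by (simp add: d d' u u' algebra_simps)
qed

text \<open>The last formula, obtained by differentiating the relations between the two pairs,
  transforms the boundary terms of the norming constant; the product of old and new
  \<open>down\<close> in it is matched by a boundary term of an integration by parts. At l = m it
  equates that product with \<open>deriv_down_sq f\<close>.\<close>

lemma Theta_decreasing_eval:
  assumes "f \<in> RR" "below m f" "f \<noteq> None" "poly (up f) m = t * poly (down f) m"
  shows "(l - m) * poly (down (Theta m t f)) l = poly (up f) l - t * poly (down f) l"
    "poly (up (Theta m t f)) l = - poly (down f) l - t * poly (down (Theta m t f)) l"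
    "(l - m) * poly (deriv_down_sq (Theta m t f)) l = poly (deriv_down_sq f) l - poly (down f) l * poly (down (Theta m t f)) l"
proof -
  define D where "D = down (Theta m t f)"
  have D: "[:-m, 1:] * D = up f - smult t (down f)" and U: "up (Theta m t f) = - down f - smult t D"
    unfolding D_def using Theta_decreasing[OF assms] by auto
  from arg_cong[OF D, of "\<lambda>p. poly p l"]
  have d: "(l - m) * poly D l = poly (up f) l - t * poly (down f) l" by (simp add: algebra_simps)
  then show "(l - m) * poly (down (Theta m t f)) l = poly (up f) l - t * poly (down f) l" by (simp add: D_def)
  have u: "poly (up (Theta m t f)) l = - poly (down f) l - t * poly D l" unfolding U by simp
  then show "poly (up (Theta m t f)) l = - poly (down f) l - t * poly (down (Theta m t f)) l" by (simp add: D_def)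
  have u': "poly (pderiv (up (Theta m t f))) l = - poly (pderiv (down f)) l - t * poly (pderiv D) l"
    unfolding U by (simp add: pderiv_diff pderiv_minus pderiv_smult)
  from arg_cong[OF D, of "\<lambda>p. poly (pderiv p) l"]
  have d': "(l - m) * poly (pderiv D) l = poly (pderiv (up f)) l - t * poly (pderiv (down f)) l - poly D l"
    unfolding pderiv_mult by (simp add: pderiv_diff pderiv_smult pderiv_pCons algebra_simps)
  have "(l - m) * poly (deriv_down_sq (Theta m t f)) l
    = poly (down f) l * ((l - m) * poly (pderiv D) l) - poly (pderiv (down f)) l * ((l - m) * poly D l)"
    unfolding deriv_down_sq_def by (simp add: u u' algebra_simps flip: D_def)
  also have "\<dots> = poly (deriv_down_sq f) l - poly (down f) l * poly D l"
    unfolding d d' deriv_down_sq_def by (simp add: algebra_simps)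
  finally show "(l - m) * poly (deriv_down_sq (Theta m t f)) l = poly (deriv_down_sq f) l - poly (down f) l * poly (down (Theta m t f)) l"
    by (simp add: D_def)
qed

text \<open>The ground state is \<phi>, and \<psi> = \<phi>/k; so \<beta> = 1/k and the weight
  1/\<beta>^2 becomes k^2.\<close>

lemma ground_norming_const:
  assumes q: "q absolutely_integrable_on {0<..<pi}" and f: "f \<in> RR" and F: "F \<in> RR" and g: "ground q f F l y dy"
    and k: "k > 0" "y pi = k * poly (down F) l" "dy pi = k * poly (up F) l"
  shows "lowest_nc (q, f, F) = integral {0..pi} (\<lambda>x. (y x)\<^sup>2) + poly (deriv_down_sq f) l + k\<^sup>2 * poly (deriv_down_sq F) l"
proof -
  have y: "is_solution q l (y, dy)" "\<And>x. x \<in> {0<..<pi} \<Longrightarrow> y x > 0" "y 0 = poly (down f) l" "dy 0 = - poly (up f) l"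
    using g by (auto simp: ground_def)
  have eq: "fst (phi q f l) x = y x" if "x \<in> {0..pi}" for x
    by (rule solution_unique(1)[OF q phi_solution(1)[OF q] y(1), of 0]) (use that in \<open>auto simp: phi_solution[OF q] y\<close>)
  have psi: "fst (psi q F l) x = (1 / k) * y x" if "x \<in> {0..pi}" for x
    by (rule solution_unique(1)[OF q psi_solution(1)[OF q] solution_scale[OF q y(1), of "1 / k"], of pi])
      (use that k in \<open>auto simp: psi_solution[OF q]\<close>)
  have "beta (q, f, F) l = 1 / k"
    unfolding beta_def prod.case
  proof (rule the_equality)
    show "1 / k \<noteq> 0 \<and> (\<forall>x\<in>{0..pi}. fst (psi q F l) x = 1 / k * fst (phi q f l) x)"
      using k(1) psi eq by simp
    fix b assume "b \<noteq> 0 \<and> (\<forall>x\<in>{0..pi}. fst (psi q F l) x = b * fst (phi q f l) x)"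
    then have "(1 / k) * y (pi / 2) = b * y (pi / 2)" using psi[of "pi / 2"] eq[of "pi / 2"] by simp
    then show "b = 1 / k" using y(2)[of "pi / 2"] by (simp only: mult_cancel_right) simp
  qed
  moreover have "integral {0..pi} (\<lambda>x. (fst (phi q f l) x)\<^sup>2) = integral {0..pi} (\<lambda>x. (y x)\<^sup>2)"
    by (rule Henstock_Kurzweil_Integration.integral_cong) (simp add: eq)
  ultimately show ?thesis
    using ground_lowest[OF q f F g] by (simp add: lowest_nc_def norming_const_def power_one_over)
qed

text \<open>Positivity puts \<nu> into the range of \<open>S_tilde1\<close> and keeps
  \<open>S_tilde2\<close> and \<open>S_tilde3\<close> apart, which ask for half and for twice the
  same number.\<close>

lemma lowest_nc_pos:
  assumes q: "q absolutely_integrable_on {0<..<pi}" and f: "f \<in> RR" and F: "F \<in> RR"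
  shows "lowest_nc (q, f, F) > 0"
proof -
  define l where "l = lowest_ev (q, f, F)"
  define y where "y = fst (phi q f l)"
  note g = ground_phi[OF q f F, folded l_def, folded y_def]
  then have yp: "\<And>x. x \<in> {0<..<pi} \<Longrightarrow> y x > 0" and sol: "is_solution q l (y, snd (phi q f l))" by (auto simp: ground_def)
  obtain k where k: "k > 0" "y pi = k * poly (down F) l" "snd (phi q f l) pi = k * poly (up F) l"
    by (rule ground_end[OF q F g])
  have c: "continuous_on {0..pi} (\<lambda>x. (y x)\<^sup>2)" by (intro continuous_intros solution_continuous[OF sol])
  have "integral {0..pi} (\<lambda>x. (y x)\<^sup>2) \<noteq> 0"
  proof
    assume "integral {0..pi} (\<lambda>x. (y x)\<^sup>2) = 0"
    then have "((\<lambda>x. (y x)\<^sup>2) has_integral 0) (cbox 0 pi)"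
      using integrable_integral[OF integrable_continuous_real[OF c]] by simp
    then have "(y (pi / 2))\<^sup>2 = 0" by (rule has_integral_0_cbox_imp_0[rotated 2]) (use c pi_gt_zero in \<open>auto simp: box_real not_le\<close>)
    then show False using yp[of "pi / 2"] by simp
  qed
  moreover have "integral {0..pi} (\<lambda>x. (y x)\<^sup>2) \<ge> 0"
    by (intro Henstock_Kurzweil_Integration.integral_nonneg integrable_continuous_real c) auto
  ultimately show ?thesis
    unfolding ground_norming_const[OF q f F g k]
    using deriv_down_sq_nonneg[OF f] deriv_down_sq_nonneg[OF F] by (intro add_pos_nonneg) auto
qed

lemma belowI:
  assumes "f \<in> RR" "\<And>x. f \<noteq> None \<Longrightarrow> x \<le> m \<Longrightarrow> poly (down f) x \<noteq> 0"
  shows "below m f"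
proof (cases f)
  case (Some g)
  show ?thesis using assms(1) unfolding Some
  proof (rule RR_SomeE)
    fix c h0 h P \<delta>
    assume "finite P" "poles g = P" "down (Some g) = smult c (node_poly P)"
    then have "poly (down f) p = 0" if "p \<in> poles g" for p
      using that by (simp add: Some poly_node_poly_eq_0_iff)
    then have "m < p" if "p \<in> poles g" for p
      using assms(2)[of p] Some that by (metis linorder_not_le option.distinct(1))
    then show "below m (Some g)" by (simp add: below_def)
  qed
qed simp

text \<open>The new poles are the zeros of t - f; as f increases up to l and f(l) < t, none of them
  is \<le> l.\<close>

lemma below_Theta_increasing:
  assumes f: "f \<in> RR" "below m f" "poly (up f) m < t * poly (down f) m"
    and l: "below l f" "poly (up f) l < t * poly (down f) l"
  shows "below l (Theta m t f)"
proof (rule belowI[OF Theta_increasing_eval(1)[OF f]])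
  fix x assume x: "x \<le> l"
  have "poly (up f) x < t * poly (down f) x"
  proof (cases "f = None")
    case False
    have D: "poly (down f) l > 0" "poly (down f) x > 0"
      using down_pos[OF f(1)] l(1) below_mono[OF l(1) x] False by auto
    have "poly (up f) x * poly (down f) l \<le> poly (up f) l * poly (down f) x" by (rule up_down_mono[OF f(1) l(1) x])
    also have "\<dots> < (t * poly (down f) l) * poly (down f) x" using l(2) D by simp
    finally have "poly (up f) x * poly (down f) l < (t * poly (down f) x) * poly (down f) l" by (simp add: mult_ac)
    then show ?thesis using D by simp
  qed simp
  then show "poly (down (Theta m t f)) x \<noteq> 0" unfolding Theta_increasing_eval(4)[OF f] by simp
qed

text \<open>A nonconstant f is strictly increasing up to l, so f - t can vanish there only at m.
  That zero has been cancelled: at m the product of old and new \<open>down\<close> is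
  \<open>deriv_down_sq f\<close>, which is positive.\<close>

lemma below_Theta_decreasing:
  assumes f: "f \<in> RR" "below m f" "f \<noteq> None" "poly (up f) m = t * poly (down f) m" and l: "below l f"
  shows "below l (Theta m t f)"
proof (cases "f = Some (ratc t)")
  case True then show ?thesis by (simp add: Theta_const)
next
  case False
  then have "f \<noteq> Some (ratc s)" for s using f(4) by (auto simp: ratc_RR)
  then have dds: "poly (deriv_down_sq f) x > 0" for x using deriv_down_sq_cases[OF f(1)] f(3) by blast
  define h where "h x = poly (up f) x / poly (down f) x" for x
  have h': "(h has_real_derivative poly (deriv_down_sq f) x / (poly (down f) x)\<^sup>2) (at x within S)" if "below x f" for x S
  proof -
    have "(h has_real_derivative (poly (pderiv (up f)) x * poly (down f) x - poly (up f) x * poly (pderiv (down f)) x) / (poly (down f) x * poly (down f) x)) (at x within S)"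
      unfolding h_def using down_pos[OF f(1) that f(3)]
      by (intro DERIV_divide DERIV_subset[OF poly_DERIV subset_UNIV]) auto
    then show ?thesis by (simp add: deriv_down_sq_def power2_eq_square)
  qed
  have mono: "h a < h b" if ab: "a < b" "below b f" for a b
  proof (rule strict_increasing_on_interval[where a = a and b = b and f = h
          and f' = "\<lambda>x. poly (deriv_down_sq f) x / (poly (down f) x)\<^sup>2"])
    fix x assume "x \<in> {a..b}"
    then have "below x f" using below_mono[OF ab(2)] by simp
    then show "(h has_real_derivative poly (deriv_down_sq f) x / (poly (down f) x)\<^sup>2) (at x within {a..b})" by (rule h')
  next
    fix x assume "a < x" "x < b"
    then have "below x f" using below_mono[OF ab(2)] by simp
    then show "poly (deriv_down_sq f) x / (poly (down f) x)\<^sup>2 > 0" by (intro divide_pos_pos zero_less_power dds down_pos[OF f(1) _ f(3)])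
  qed (use ab in auto)
  show ?thesis
  proof (rule belowI[OF Theta_decreasing(1)[OF f]], rule notI)
    fix x assume x: "x \<le> l" and z: "poly (down (Theta m t f)) x = 0"
    have bx: "below x f" using below_mono[OF l x] .
    show False
    proof (cases "x = m")
      case True
      then show False using Theta_decreasing_eval(3)[OF f, of m] dds[of m] z by simp
    next
      case False
      have "poly (up f) x = t * poly (down f) x" using Theta_decreasing_eval(1)[OF f, of x] z by simp
      then have "h x = t" using down_pos[OF f(1) bx f(3)] by (simp add: h_def)
      moreover have "h m = t" using down_pos[OF f(1,2,3)] f(4) by (simp add: h_def)
      ultimately show False using mono[of x m] mono[of m x] f(2) bx False by (cases "x < m") auto
    qed
  qed
qed

text \<open>The function \<open>y' - (u'/u) y\<close> is \<open>W / u\<close> with \<open>W\<close> the Wronskian of \<open>y\<close> and \<open>u\<close>, which is monotone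
  and hence sign-definite as soon as it has the right sign at one end point.\<close>

context
  fixes q f F l y dy L u du
  assumes q: "q absolutely_integrable_on {0<..<pi}" and f: "f \<in> RR" and F: "F \<in> RR"
    and g: "ground q f F l y dy" and L: "L < l" and u: "is_solution q L (u, du)"
    and upos: "\<And>x. x \<in> {0..pi} \<Longrightarrow> u x > 0"
begin

private lemma unz: "x \<in> {0..pi} \<Longrightarrow> u x \<noteq> 0" using upos by force

private lemma ysol: "is_solution q l (y, dy)" and ypos: "\<And>x. x \<in> {0<..<pi} \<Longrightarrow> y x > 0" and y0: "y 0 = poly (down f) l" "dy 0 = - poly (up f) l"
  and bl: "below l f" "below l F"
  using g by (auto simp: ground_def)

private lemma bL: "below L f" "below L F"
  using bl below_mono L by (meson less_imp_le)+

private definition "Y x = dy x - du x / u x * y x"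
private definition "dY x = (L - l) * y x - du x / u x * Y x"

private lemma Ysol: "is_solution (darboux_potential q u du) l (Y, dY)"
  unfolding Y_def[abs_def] dY_def[abs_def] by (rule darboux_solution[OF potentialI[OF q] u unz ysol])

private lemma q'int: "darboux_potential q u du absolutely_integrable_on {0<..<pi}"
  by (rule darboux_integrable[OF potentialI[OF q] u unz])

private lemma Y_wronskian: "x \<in> {0..pi} \<Longrightarrow> Y x = (dy x * u x - y x * du x) / u x"
  using unz by (simp add: Y_def field_simps)

private lemma wronskian_decreasing:
  assumes "0 \<le> a" "a < b" "b \<le> pi"
  shows "dy b * u b - y b * du b < dy a * u a - y a * du a"
proof -
  have "- (dy a * u a - y a * du a) < - (dy b * u b - y b * du b)"
  proof (rule strict_increasing_on_interval[OF DERIV_minus[OF solution_wronskian[OF q ysol u]] _ assms])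
    fix z assume z: "a < z" "z < b"
    then have "y z * u z > 0" using ypos[of z] upos[of z] assms by simp
    then show "- ((L - l) * (y z * u z)) > 0" using L by (simp add: mult_neg_pos)
  qed
  then show ?thesis by simp
qed

text \<open>Integrate (y Y)' = Y^2 + (L - l) y^2, which holds since Y' = (L - l) y - (u'/u) Y. The
  boundary terms are absorbed by the change of the terms with f and F in the norming
  constant.\<close>

private lemma Y_square_integral:
  "integral {0..pi} (\<lambda>x. (Y x)\<^sup>2) = y pi * Y pi - y 0 * Y 0 + (l - L) * integral {0..pi} (\<lambda>x. (y x)\<^sup>2)"
proof -
  have "((\<lambda>x. (Y x)\<^sup>2 + (L - l) * (y x)\<^sup>2) has_integral y pi * Y pi - y 0 * Y 0) {0..pi}"
  proof (rule fundamental_theorem_of_calculus)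
    fix x assume x: "x \<in> {0..pi}"
    have "((\<lambda>x. y x * Y x) has_real_derivative dy x * Y x + dY x * y x) (at x within {0..pi})"
      by (intro DERIV_mult solution_derivative[OF ysol x] solution_derivative[OF Ysol x])
    then have "((\<lambda>x. y x * Y x) has_real_derivative (Y x)\<^sup>2 + (L - l) * (y x)\<^sup>2) (at x within {0..pi})"
      by (rule DERIV_cong) (simp add: dY_def Y_def power2_eq_square algebra_simps)
    then show "((\<lambda>x. y x * Y x) has_vector_derivative (Y x)\<^sup>2 + (L - l) * (y x)\<^sup>2) (at x within {0..pi})"
      by (simp only: has_real_derivative_iff_has_vector_derivative)
  qed simp
  moreover have yI: "(\<lambda>x. (y x)\<^sup>2) integrable_on {0..pi}" and YI: "(\<lambda>x. (Y x)\<^sup>2) integrable_on {0..pi}"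
    by (intro integrable_continuous_real continuous_intros solution_continuous[OF ysol] solution_continuous[OF Ysol])+
  have "((\<lambda>x. (Y x)\<^sup>2 + (L - l) * (y x)\<^sup>2) has_integral integral {0..pi} (\<lambda>x. (Y x)\<^sup>2) + (L - l) * integral {0..pi} (\<lambda>x. (y x)\<^sup>2)) {0..pi}"
    by (rule has_integral_add[OF integrable_integral[OF YI] has_integral_mult_right[OF integrable_integral[OF yI]]])
  ultimately have "integral {0..pi} (\<lambda>x. (Y x)\<^sup>2) + (L - l) * integral {0..pi} (\<lambda>x. (y x)\<^sup>2) = y pi * Y pi - y 0 * Y 0"
    using has_integral_unique by blast
  then show ?thesis by (simp add: algebra_simps)
qed

text \<open>Here u satisfies the left condition at L and the right one with strict inequality, so f
  is lowered and F raised. The Wronskian is nonpositive at 0 and decreases, so Y < 0.\<close>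

lemma darboux_ground_decreasing_increasing:
  assumes nf: "f \<noteq> None" and left: "poly (down f) L * du 0 + poly (up f) L * u 0 = 0"
    and right: "poly (down F) L * du pi - poly (up F) L * u pi > 0"
  defines "f' \<equiv> Theta L (- du 0 / u 0) f" and "F' \<equiv> Theta L (du pi / u pi) F"
  shows "lowest_ev (darboux_potential q u du, f', F') = l"
    "lowest_nc (q, f, F) = (l - L) * lowest_nc (darboux_potential q u du, f', F')"
proof -
  define \<delta> where "\<delta> = l - L"
  have \<delta>: "\<delta> > 0" using L by (simp add: \<delta>_def)
  have u0: "u 0 > 0" "u pi > 0" using upos by auto
  define t T where "t = - du 0 / u 0" and "T = du pi / u pi"
  have f': "f' = Theta L t f" and F': "F' = Theta L T F" by (simp_all add: f'_def F'_def t_def T_def)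
  have t: "poly (up f) L = t * poly (down f) L" using left u0 by (simp add: t_def field_simps)
  have T: "poly (up F) L < T * poly (down F) L" using right u0 by (simp add: T_def field_simps)
  note dec = Theta_decreasing[OF f bL(1) nf t, folded f']
    and dev = Theta_decreasing_eval[OF f bL(1) nf t, of l, folded f' \<delta>_def]
  note inc = Theta_increasing_eval(1-3)[OF F bL(2) T, folded F']
    and iev = Theta_increasing_eval(4-6)[OF F bL(2) T, of l, folded F' \<delta>_def]
  obtain k where k: "k > 0" "y pi = k * poly (down F) l" "dy pi = k * poly (up F) l"
    by (rule ground_end[OF q F g])
  have r: "du 0 / u 0 = - t" by (simp add: t_def)
  have Y0: "Y 0 = - \<delta> * poly (down f') l"
    using dev(1) by (simp add: Y_def r y0)
  have dY0: "dY 0 = \<delta> * poly (up f') l"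
    unfolding dev(2) by (simp add: dY_def r y0 Y0 \<delta>_def algebra_simps)
  have Ypi: "Y pi = - k * poly (down F') l"
    unfolding iev(1) by (simp add: Y_def k algebra_simps flip: T_def)
  then have dYpi: "dY pi = - k * poly (up F') l"
    unfolding iev(2) by (simp add: dY_def k \<delta>_def algebra_simps flip: T_def)
  have W0: "dy 0 * u 0 - y 0 * du 0 \<le> 0"
  proof -
    have D: "poly (down f) L > 0" by (rule down_pos[OF f bL(1) nf])
    have "(poly (up f) L * poly (down f) l) * u 0 \<le> (poly (up f) l * poly (down f) L) * u 0"
      using up_down_mono[OF f bl(1)] L u0 by (intro mult_right_mono) auto
    moreover have e: "poly (down f) L * du 0 = - (poly (up f) L * u 0)" using left by linarith
    have "poly (down f) L * (dy 0 * u 0 - y 0 * du 0)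
      = - poly (up f) l * poly (down f) L * u 0 - poly (down f) l * (poly (down f) L * du 0)"
      by (simp add: y0 algebra_simps)
    then have "poly (down f) L * (dy 0 * u 0 - y 0 * du 0)
      = (poly (up f) L * poly (down f) l) * u 0 - (poly (up f) l * poly (down f) L) * u 0"
      unfolding e by (simp add: algebra_simps)
    ultimately have "poly (down f) L * (dy 0 * u 0 - y 0 * du 0) \<le> 0" by linarith
    then show ?thesis using D by (simp add: mult_le_0_iff)
  qed
  have Yneg: "Y x < 0" if x: "x \<in> {0<..pi}" for x
    using wronskian_decreasing[of 0 x] W0 upos[of x] x by (simp add: Y_wronskian divide_neg_pos)
  have "poly (down F') l > 0" using Yneg[of pi] k(1) unfolding Ypi by (simp add: zero_less_mult_iff)
  then have "poly (up F) l < T * poly (down F) l" unfolding iev(1) by simp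
  then have b: "below l f'" "below l F'"
    using below_Theta_decreasing[OF f bL(1) nf t bl(1)] below_Theta_increasing[OF F bL(2) T bl(2)] by (simp_all add: f' F')
  \<comment> \<open>Y(0) is -(l - L) times the new \<open>down\<close>, so this multiple of Y has
    the initial values of the transformed \<phi>; accordingly \<open>k\<close> becomes k / (l -
    L).\<close>
  define w dw where "w x = - 1 / \<delta> * Y x" and "dw x = - 1 / \<delta> * dY x" for x
  have wpi: "w pi = k / \<delta> * poly (down F') l" "dw pi = k / \<delta> * poly (up F') l"
    by (simp_all add: w_def dw_def Ypi dYpi)
  have ws: "is_solution (darboux_potential q u du) l (w, dw)"
    unfolding w_def[abs_def] dw_def[abs_def] by (rule solution_scale[OF q'int Ysol])
  have g': "ground (darboux_potential q u du) f' F' l w dw"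
    unfolding ground_def
  proof (intro conjI ballI b ws)
    show "w x > 0" if "x \<in> {0<..<pi}" for x
      using Yneg[of x] that \<delta> by (simp add: w_def divide_neg_pos)
    show "w 0 = poly (down f') l" "dw 0 = - poly (up f') l" using \<delta> by (simp_all add: w_def dw_def Y0 dY0)
    show "poly (down F') l * dw pi = poly (up F') l * w pi" by (simp add: wpi)
  qed
  show "lowest_ev (darboux_potential q u du, f', F') = l"
    by (rule ground_lowest[OF q'int dec(1) inc(1) g'])
  have kd: "k / \<delta> > 0" using k(1) \<delta> by simp
  have nc': "lowest_nc (darboux_potential q u du, f', F') = integral {0..pi} (\<lambda>x. (w x)\<^sup>2) + poly (deriv_down_sq f') l + (k / \<delta>)\<^sup>2 * poly (deriv_down_sq F') l"
    by (rule ground_norming_const[OF q'int dec(1) inc(1) g' kd wpi])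
  have "integral {0..pi} (\<lambda>x. (w x)\<^sup>2) = integral {0..pi} (\<lambda>x. (1 / \<delta>\<^sup>2) * (Y x)\<^sup>2)"
    by (simp add: w_def power_mult_distrib power_divide)
  also have "\<dots> = (1 / \<delta>\<^sup>2) * integral {0..pi} (\<lambda>x. (Y x)\<^sup>2)" by (rule Henstock_Kurzweil_Integration.integral_mult_right)
  finally have wI: "\<delta>\<^sup>2 * integral {0..pi} (\<lambda>x. (w x)\<^sup>2) = integral {0..pi} (\<lambda>x. (Y x)\<^sup>2)" using \<delta> by simp
  have "\<delta> * (\<delta> * lowest_nc (darboux_potential q u du, f', F')) = integral {0..pi} (\<lambda>x. (Y x)\<^sup>2) + \<delta> * (\<delta> * poly (deriv_down_sq f') l) + k\<^sup>2 * poly (deriv_down_sq F') l"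
    unfolding nc' wI[symmetric] using \<delta> by (simp add: power2_eq_square field_simps)
  also have "\<dots> = \<delta> * (integral {0..pi} (\<lambda>x. (y x)\<^sup>2) + poly (deriv_down_sq f) l + k\<^sup>2 * poly (deriv_down_sq F) l)"
    unfolding Y_square_integral dev(3) iev(3) Y0 Ypi
    by (simp add: y0 k \<delta>_def[symmetric] power2_eq_square algebra_simps)
  also have "\<dots> = \<delta> * lowest_nc (q, f, F)" using ground_norming_const[OF q f F g k] by simp
  finally show "lowest_nc (q, f, F) = (l - L) * lowest_nc (darboux_potential q u du, f', F')"
    using \<delta> by (simp add: \<delta>_def)
qed

text \<open>The ends exchange their roles. Now Y is positive and already has the initial values of
  the transformed \<phi>, while \<open>k\<close> is multiplied by l - L; this is why the norming
  constant is multiplied instead of divided.\<close>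

lemma darboux_ground_increasing_decreasing:
  assumes nF: "F \<noteq> None" and left: "poly (down f) L * du 0 + poly (up f) L * u 0 < 0"
    and right: "poly (down F) L * du pi - poly (up F) L * u pi = 0"
  defines "f' \<equiv> Theta L (- du 0 / u 0) f" and "F' \<equiv> Theta L (du pi / u pi) F"
  shows "lowest_ev (darboux_potential q u du, f', F') = l"
    "lowest_nc (darboux_potential q u du, f', F') = (l - L) * lowest_nc (q, f, F)"
proof -
  define \<delta> where "\<delta> = l - L"
  have \<delta>: "\<delta> > 0" using L by (simp add: \<delta>_def)
  have u0: "u 0 > 0" "u pi > 0" using upos by auto
  define t T where "t = - du 0 / u 0" and "T = du pi / u pi"
  have f': "f' = Theta L t f" and F': "F' = Theta L T F" by (simp_all add: f'_def F'_def t_def T_def)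
  have t: "poly (up f) L < t * poly (down f) L" using left u0 by (simp add: t_def field_simps)
  have T: "poly (up F) L = T * poly (down F) L" using right u0 by (simp add: T_def field_simps)
  note dec = Theta_decreasing[OF F bL(2) nF T, folded F']
    and dev = Theta_decreasing_eval[OF F bL(2) nF T, of l, folded F' \<delta>_def]
  note inc = Theta_increasing_eval(1-3)[OF f bL(1) t, folded f']
    and iev = Theta_increasing_eval(4-6)[OF f bL(1) t, of l, folded f' \<delta>_def]
  obtain k where k: "k > 0" "y pi = k * poly (down F) l" "dy pi = k * poly (up F) l"
    by (rule ground_end[OF q F g])
  have r: "du 0 / u 0 = - t" by (simp add: t_def)
  have Y0: "Y 0 = poly (down f') l"
    unfolding iev(1) by (simp add: Y_def r y0)
  then have dY0: "dY 0 = - poly (up f') l"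
    unfolding iev(2) by (simp add: dY_def r y0 \<delta>_def algebra_simps)
  have "Y pi = k * (poly (up F) l - T * poly (down F) l)"
    by (simp add: Y_def k algebra_simps flip: T_def)
  then have Ypi: "Y pi = k * \<delta> * poly (down F') l" using dev(1) by simp
  have dYpi: "dY pi = k * \<delta> * poly (up F') l"
    unfolding dev(2) by (simp add: dY_def k Ypi \<delta>_def algebra_simps flip: T_def)
  have Wpi: "dy pi * u pi - y pi * du pi \<ge> 0"
  proof -
    have D: "poly (down F) L > 0" by (rule down_pos[OF F bL(2) nF])
    have "(poly (up F) L * poly (down F) l) * (k * u pi) \<le> (poly (up F) l * poly (down F) L) * (k * u pi)"
      using up_down_mono[OF F bl(2)] L u0 k(1) by (intro mult_right_mono) auto
    moreover have e: "poly (down F) L * du pi = poly (up F) L * u pi" using right by simp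
    have "poly (down F) L * (dy pi * u pi - y pi * du pi)
      = (poly (up F) l * poly (down F) L) * (k * u pi) - k * poly (down F) l * (poly (down F) L * du pi)"
      by (simp add: k algebra_simps)
    then have "poly (down F) L * (dy pi * u pi - y pi * du pi)
      = (poly (up F) l * poly (down F) L) * (k * u pi) - (poly (up F) L * poly (down F) l) * (k * u pi)"
      unfolding e by (simp add: algebra_simps)
    ultimately have "poly (down F) L * (dy pi * u pi - y pi * du pi) \<ge> 0" by linarith
    then show ?thesis using D by (simp add: zero_le_mult_iff)
  qed
  have Ypos: "Y x > 0" if x: "x \<in> {0..<pi}" for x
    using wronskian_decreasing[of x pi] Wpi upos[of x] x by (simp add: Y_wronskian)
  have "poly (down f') l > 0" using Ypos[of 0] unfolding Y0 by simp
  then have "poly (up f) l < t * poly (down f) l" unfolding iev(1) by simp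
  then have b: "below l f'" "below l F'"
    using below_Theta_decreasing[OF F bL(2) nF T bl(2)] below_Theta_increasing[OF f bL(1) t bl(1)] by (simp_all add: f' F')
  have g': "ground (darboux_potential q u du) f' F' l Y dY"
    unfolding ground_def
  proof (intro conjI ballI b Ysol Y0 dY0)
    show "Y x > 0" if "x \<in> {0<..<pi}" for x using Ypos[of x] that by simp
    show "poly (down F') l * dY pi = poly (up F') l * Y pi" by (simp add: Ypi dYpi)
  qed
  show "lowest_ev (darboux_potential q u du, f', F') = l"
    by (rule ground_lowest[OF q'int inc(1) dec(1) g'])
  have kd: "k * \<delta> > 0" using k(1) \<delta> by simp
  have nc': "lowest_nc (darboux_potential q u du, f', F') = integral {0..pi} (\<lambda>x. (Y x)\<^sup>2) + poly (deriv_down_sq f') l + (k * \<delta>)\<^sup>2 * poly (deriv_down_sq F') l"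
    by (rule ground_norming_const[OF q'int inc(1) dec(1) g' kd Ypi dYpi])
  also have "(k * \<delta>)\<^sup>2 * poly (deriv_down_sq F') l = k\<^sup>2 * \<delta> * (\<delta> * poly (deriv_down_sq F') l)"
    by (simp add: power2_eq_square algebra_simps)
  finally have "lowest_nc (darboux_potential q u du, f', F') = \<delta> * (integral {0..pi} (\<lambda>x. (y x)\<^sup>2) + poly (deriv_down_sq f) l + k\<^sup>2 * poly (deriv_down_sq F) l)"
    unfolding Y_square_integral dev(3) iev(3) Y0 Ypi
    by (simp add: y0 k \<delta>_def[symmetric] power2_eq_square algebra_simps)
  then show "lowest_nc (darboux_potential q u du, f', F') = (l - L) * lowest_nc (q, f, F)"
    using ground_norming_const[OF q f F g k] by (simp add: \<delta>_def)
qed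

end

section \<open>The numbers \<kappa> and \<tau>\<close>

text \<open>Expanding p in the basis C, S turns the right boundary condition into a linear relation
  between p(0) and p'(0). Its coefficient of p'(0) is nonzero: otherwise both coefficients would
  vanish, against the Wronskian 1 of C and S.\<close>

lemma kappa_eq:
  assumes q: "q absolutely_integrable_on {0<..<pi}" and F: "F \<in> RR" "below m F"
    and p: "is_solution q m (p, dp)" "poly (down F) m * dp pi = poly (up F) m * p pi" and p0: "p 0 \<noteq> 0"
  shows "kappa m q F = - dp 0 / p 0"
proof -
  define C dC S dS where "C = fst (solution_at 0 1 0 q m)" and "dC = snd (solution_at 0 1 0 q m)"
    and "S = fst (solution_at 0 0 1 q m)" and "dS = snd (solution_at 0 0 1 q m)"
  have C: "is_solution q m (C, dC)" "C 0 = 1" "dC 0 = 0" and S: "is_solution q m (S, dS)" "S 0 = 0" "dS 0 = 1"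
    using solution_at[OF q, of 0] by (simp_all add: C_def dC_def S_def dS_def)
  have W: "dS pi * C pi - S pi * dC pi = 1"
    using solution_wronskian_const[OF q S(1) C(1), of pi 0] C S by simp
  have pe: "p pi = p 0 * C pi + dp 0 * S pi" "dp pi = p 0 * dC pi + dp 0 * dS pi"
    using solution_unique[OF q p(1) solution_comb[OF q C(1) S(1), of "p 0" "dp 0"], of 0 pi] C S by simp_all
  have k: "kappa m q F = (case F of None \<Rightarrow> C pi / S pi | Some G \<Rightarrow> (dC pi - C pi * val G m) / (dS pi - S pi * val G m))"
    unfolding kappa_def C_def dC_def S_def dS_def Let_def by (simp add: case_prod_beta)
  show ?thesis
  proof (cases F)
    case None
    then have e: "p 0 * C pi + dp 0 * S pi = 0" using p(2) pe by simp
    have "S pi \<noteq> 0" using e W p0 by auto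
    then show ?thesis unfolding k using e p0 by (simp add: None field_simps eq_neg_iff_add_eq_0)
  next
    case (Some G)
    have D: "poly (down F) m > 0" using down_pos[OF F] Some by simp
    have v: "val G m = poly (up F) m / poly (down F) m" by (simp add: val_def Some)
    have "dp pi = val G m * p pi" using p(2) D by (simp add: v field_simps)
    then have e: "p 0 * (dC pi - C pi * val G m) + dp 0 * (dS pi - S pi * val G m) = 0"
      unfolding pe by (simp add: algebra_simps)
    have "dS pi - S pi * val G m \<noteq> 0"
    proof
      assume z: "dS pi - S pi * val G m = 0"
      then have "dC pi = C pi * val G m" "dS pi = S pi * val G m" using e p0 by auto
      then show False using W by simp
    qed
    then show ?thesis unfolding k using e p0 by (simp add: Some field_simps eq_neg_iff_add_eq_0)
  qed
qed

text \<open>In the variable s = K + t the equation becomes linear, E (E + s D) = n s with E = A - K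
  D, and n - D E > 0. The explicit root meets both interval conditions, so existence and uniqueness
  come together.\<close>

lemma tau_equation:
  fixes A D K n t :: real
  assumes D: "D \<ge> 0" and E: "A - K * D < 0" and n: "n > 0"
  shows "- K < t \<and> A + t * D < 0 \<and> (A - K * D) * ((A + t * D) / (K + t)) = n \<longleftrightarrow>
    t = (A - K * D)\<^sup>2 / (n - D * (A - K * D)) - K"
proof -
  define E s where "E = A - K * D" and "s = K + t"
  have E0: "E < 0" using E by (simp add: E_def)
  have d: "n - D * E > 0" using D E0 n by (smt (verit) mult_nonneg_nonpos)
  have A: "A + t * D = E + s * D" by (simp add: E_def s_def algebra_simps)
  have "- K < t \<and> A + t * D < 0 \<and> E * ((A + t * D) / (K + t)) = n \<longleftrightarrow> s > 0 \<and> E + s * D < 0 \<and> E * (E + s * D) = n * s"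
  proof -
    have "- K < t \<longleftrightarrow> s > 0" by (auto simp: s_def)
    then show ?thesis unfolding A s_def[symmetric] by (auto simp: field_simps)
  qed
  also have "\<dots> \<longleftrightarrow> s = E\<^sup>2 / (n - D * E)"
  proof
    assume "s > 0 \<and> E + s * D < 0 \<and> E * (E + s * D) = n * s"
    then have "s * (n - D * E) = E\<^sup>2" by (simp add: power2_eq_square algebra_simps)
    then show "s = E\<^sup>2 / (n - D * E)" using d by (simp add: field_simps)
  next
    assume s: "s = E\<^sup>2 / (n - D * E)"
    then have s0: "s > 0" using d E0 by simp
    have "s * (n - D * E) = E\<^sup>2" using s d by simp
    then have e: "E * (E + s * D) = n * s" by (simp add: power2_eq_square algebra_simps)
    then have "E * (E + s * D) > 0" using n s0 by simp
    then have "E + s * D < 0" using E0 by (simp add: zero_less_mult_iff)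
    then show "s > 0 \<and> E + s * D < 0 \<and> E * (E + s * D) = n * s" using s0 e by simp
  qed
  also have "\<dots> \<longleftrightarrow> t = E\<^sup>2 / (n - D * E) - K" by (auto simp: s_def)
  finally show ?thesis unfolding E_def .
qed

lemma tau_iff:
  assumes f: "f \<in> RR" "below m f" and E: "poly (up f) m - kappa m q F * poly (down f) m < 0" and n: "n > 0"
  shows "tau m n (q, f, F) = t \<longleftrightarrow> - kappa m q F < t \<and> poly (up f) m + t * poly (down f) m < 0 \<and> gamma_fun m (q, f, F) t = n"
proof -
  \<comment> \<open>For \<open>None\<close> the interval is unbounded above, and the inequality
    reads -1 < 0.\<close>
  have c: "(case f of None \<Rightarrow> True | Some g \<Rightarrow> t < - val g m) \<longleftrightarrow> poly (up f) m + t * poly (down f) m < 0" for t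
  proof (cases f)
    case (Some g)
    then have "poly (down f) m > 0" using down_pos[OF f] by simp
    then show ?thesis using Some by (simp add: val_def field_simps) linarith
  qed simp
  have "tau m n (q, f, F) = (THE t. t = (poly (up f) m - kappa m q F * poly (down f) m)\<^sup>2 /
      (n - poly (down f) m * (poly (up f) m - kappa m q F * poly (down f) m)) - kappa m q F)"
    unfolding tau_def prod.case c gamma_fun_def tau_equation[OF down_nonneg[OF f] E n] ..
  then show ?thesis unfolding gamma_fun_def prod.case tau_equation[OF down_nonneg[OF f] E n] by auto
qed

section \<open>The two compositions\<close>

lemma darboux_eq: "darboux L s (q, f, F) =
    (darboux_potential q (fst s) (snd s), Theta L (- snd s 0 / fst s 0) f, Theta L (snd s pi / fst s pi) F)"
  by (cases s) (simp add: darboux_def darboux_potential_def[abs_def])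

lemma darboux_darboux:
  assumes q: "q absolutely_integrable_on {0<..<pi}" and u: "is_solution q L (u, du)"
    and nz: "\<And>x. x \<in> {0..pi} \<Longrightarrow> u x \<noteq> 0"
    and w: "is_solution (darboux_potential q u du) L (w, dw)"
    and x0: "x0 \<in> {0..pi}" "w x0 \<noteq> 0" "dw x0 / w x0 = - du x0 / u x0"
  shows "same_problem (darboux L (w, dw) (darboux L (u, du) (q, f, F))) (q, f, F)"
proof -
  note d = darboux_inverse[OF q u nz w x0]
  have "- dw 0 / w 0 = - (- du 0 / u 0)" "dw pi / w pi = - (du pi / u pi)"
    using d(2)[of 0] d(2)[of pi] by simp_all
  then show ?thesis
    unfolding darboux_eq same_problem_def prod.case fst_conv snd_conv using d(3) by (simp only: Theta_inverse simp_thms)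
qed

lemma darboux_reciprocal_solution:
  assumes "q absolutely_integrable_on {0<..<pi}" "is_solution q L (u, du)" "\<And>x. x \<in> {0..pi} \<Longrightarrow> u x > 0"
  shows "is_solution (darboux_potential q u du) L (\<lambda>x. c / u x, \<lambda>x. - (du x / u x * (c / u x)))"
  using darboux_solution_inverse[OF potentialI[OF assms(1)] assms(2), where G = "\<lambda>_. c" and k = 0] assms(3)
  by force

text \<open>The generating function u is the eigenfunction itself, so both coefficients are lowered
  and the lowest eigenvalue moves up. The work lies in \<tau>: it must be the logarithmic derivative
  \<open>t\<close> of 1/u at 0.\<close>

lemma T_hat_roundtrip_both_finite:
  assumes q: "q absolutely_integrable_on {0<..<pi}" and f: "f \<in> RR" "f \<noteq> None" and F: "F \<in> RR" "F \<noteq> None"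
  defines "l \<equiv> lowest_ev (q, f, F)" and "P \<equiv> T_hat (q, f, F)"
  shows "(l, lowest_nc (q, f, F), P) \<in> S_tilde1" "same_problem (T_tilde (l, lowest_nc (q, f, F), P)) (q, f, F)"
proof -
  define u du where "u = fst (phi q f l)" and "du = snd (phi q f l)"
  note g = ground_phi[OF q f(1) F(1), folded l_def, folded u_def du_def]
  have u: "is_solution q l (u, du)" "u 0 = poly (down f) l" "du 0 = - poly (up f) l" and b: "below l f" "below l F"
    and bc: "poly (down F) l * du pi = poly (up F) l * u pi" and ui: "\<And>x. x \<in> {0<..<pi} \<Longrightarrow> u x > 0"
    using g by (auto simp: ground_def)
  have D: "poly (down f) l > 0" "poly (down F) l > 0" using down_pos f F b by auto
  obtain k where k: "k > 0" "u pi = k * poly (down F) l" "du pi = k * poly (up F) l"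
    by (rule ground_end[OF q F(1) g])
  have upos: "u x > 0" if "x \<in> {0..pi}" for x
    using ui[of x] that D k u(2) by (cases "x = 0"; cases "x = pi") auto
  have unz: "\<And>x. x \<in> {0..pi} \<Longrightarrow> u x \<noteq> 0" using upos by force
  define t T where "t = - du 0 / u 0" and "T = du pi / u pi"
  define q' f' F' where "q' = darboux_potential q u du" and "f' = Theta l t f" and "F' = Theta l T F"
  have P: "P = (q', f', F')"
    using f F by (simp add: P_def T_hat_def Let_def darboux_eq q'_def f'_def F'_def t_def T_def u_def du_def flip: l_def)
  have u0: "u 0 > 0" "u pi > 0" using upos by auto
  have t: "poly (up f) l = t * poly (down f) l" using u0 u by (simp add: t_def)
  have T: "poly (up F) l = T * poly (down F) l" using u0 bc by (simp add: T_def field_simps)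
  note df = Theta_decreasing[OF f(1) b(1) f(2) t, folded f'_def] and ef = Theta_decreasing_eval[OF f(1) b(1) f(2) t, of l, folded f'_def]
  note dF = Theta_decreasing[OF F(1) b(2) F(2) T, folded F'_def] and eF = Theta_decreasing_eval[OF F(1) b(2) F(2) T, of l, folded F'_def]
  have q': "q' absolutely_integrable_on {0<..<pi}" unfolding q'_def by (rule darboux_integrable[OF potentialI[OF q] u(1) unz])
  define w dw where "w x = 1 / u x" and "dw x = - (du x / u x * (1 / u x))" for x
  have w: "is_solution q' l (w, dw)"
    unfolding q'_def w_def[abs_def] dw_def[abs_def] by (rule darboux_reciprocal_solution[OF q u(1) upos])
  have w0: "w 0 > 0" "w pi > 0" "\<And>x. x \<in> {0..pi} \<Longrightarrow> w x > 0" using upos by (auto simp: w_def)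
  have dw0: "dw 0 = t * w 0" "dw pi = - T * w pi" by (simp_all add: dw_def w_def t_def T_def)
  have "poly (down f') l * dw 0 + poly (up f') l * w 0 = - (poly (down f) l * w 0)"
    unfolding dw0 ef(2) by (simp add: algebra_simps)
  then have left: "poly (down f') l * dw 0 + poly (up f') l * w 0 < 0" using D w0 by simp
  have "poly (down F') l * dw pi - poly (up F') l * w pi = poly (down F) l * w pi"
    unfolding dw0 eF(2) by (simp add: algebra_simps)
  then have right: "poly (down F') l * dw pi - poly (up F') l * w pi > 0" using D w0 by simp
  \<comment> \<open>1/u is positive and satisfies both boundary inequalities of the new problem
    strictly, so it is a strict supersolution at l.\<close>
  have less: "l < lowest_ev (q', f', F')"
    by (rule supersolution_below_ground[OF q' df(1) dF(1) ground_phi[OF q' df(1) dF(1)] w w0(3) df(2) dF(2)])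
      (use left right in auto)
  define n where "n = lowest_nc (q, f, F)"
  have n: "n > 0" unfolding n_def by (rule lowest_nc_pos[OF q f(1) F(1)])
  show S1: "(l, lowest_nc (q, f, F), P) \<in> S_tilde1"
    using q' df(1) dF(1) less n by (simp add: S_tilde1_def P n_def)
  \<comment> \<open>The constant of integration for which G/u satisfies the transformed right
    condition. It is also the share of F in the norming constant, so G(0) is the norming constant
    without the share of f.\<close>
  define c where "c = k\<^sup>2 * poly (deriv_down_sq F) l"
  have c: "c \<ge> 0" unfolding c_def using deriv_down_sq_nonneg[OF F(1)] by simp
  have uc: "continuous_on {0..pi} (\<lambda>x. (u x)\<^sup>2)" by (intro continuous_intros solution_continuous[OF u(1)])
  define G where "G x = c + integral {x..pi} (\<lambda>x. (u x)\<^sup>2)" for x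
  have G': "(G has_real_derivative - 1 * (u x)\<^sup>2) (at x within {0..pi})" if x: "x \<in> {0..pi}" for x
  proof -
    have "(G has_real_derivative 0 + - (u x)\<^sup>2) (at x within {0..pi})"
      unfolding G_def by (intro DERIV_add DERIV_const integral_has_real_derivative'[OF uc x])
    then show ?thesis by simp
  qed
  have nG: "n = G 0 + poly (deriv_down_sq f) l"
    using ground_norming_const[OF q f(1) F(1) g k] by (simp add: n_def G_def c_def)
  have G0: "G 0 > 0"
  proof -
    have "G pi < G 0"
    proof -
      have "- G 0 < - G pi"
      proof (rule strict_increasing_on_interval[where f = "\<lambda>x. - G x" and f' = "\<lambda>x. - (- 1 * (u x)\<^sup>2)" and a = 0 and b = pi])
        show "((\<lambda>x. - G x) has_real_derivative - (- 1 * (u x)\<^sup>2)) (at x within {0..pi})" if "x \<in> {0..pi}" for x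
          by (rule DERIV_minus[OF G'[OF that]])
        show "- (- 1 * (u z)\<^sup>2) > 0" if "0 < z" "z < pi" for z using upos[of z] that by simp
      qed auto
      then show ?thesis by simp
    qed
    then show ?thesis using c by (simp add: G_def)
  qed
  define p dp where "p x = G x / u x" and "dp x = - 1 * u x - du x / u x * (G x / u x)" for x
  have p: "is_solution q' l (p, dp)"
    unfolding q'_def p_def[abs_def] dp_def[abs_def] by (rule darboux_solution_inverse[OF potentialI[OF q] u(1) unz G'])
  have Gpi: "G pi = c" by (simp add: G_def)
  have "poly (down F) l * poly (down F') l = poly (deriv_down_sq F) l" using eF(3) by simp
  then have cD: "poly (down F') l * (u pi)\<^sup>2 = poly (down F) l * c"
    by (simp add: k c_def power2_eq_square algebra_simps)
  have "poly (down F') l * dp pi = poly (up F') l * p pi"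
  proof -
    have "poly (down F') l * u pi = poly (down F) l * (c / u pi)"
      using cD u0 by (simp add: field_simps power2_eq_square)
    then show ?thesis unfolding eF(2) p_def dp_def Gpi T_def[symmetric] by (simp add: algebra_simps)
  qed
  moreover have p0: "p 0 \<noteq> 0" using G0 u0 by (simp add: p_def)
  ultimately have "kappa l q' F' = - dp 0 / p 0" by (rule kappa_eq[OF q' dF(1,2) p])
  also have "\<dots> = (u 0)\<^sup>2 / G 0 - t" using u0 G0 by (simp add: p_def dp_def t_def field_simps power2_eq_square)
  finally have kap: "kappa l q' F' = (poly (down f) l)\<^sup>2 / G 0 - t" using u(2) by simp
  \<comment> \<open>This is \<kappa> + t, the distance of \<open>t\<close> from the left end of its
    interval. The value of \<open>gamma_fun\<close> at t splits into the square of
    \<open>down\<close> divided by r, which is G(0), and the product of old and new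
    \<open>down\<close>, which is the share of f.\<close>
  define r where "r = (poly (down f) l)\<^sup>2 / G 0"
  have r: "r > 0" using D G0 by (simp add: r_def)
  have At: "poly (up f') l + t * poly (down f') l = - poly (down f) l" unfolding ef(2) by simp
  have E: "poly (up f') l - kappa l q' F' * poly (down f') l = - poly (down f) l - r * poly (down f') l"
    unfolding kap ef(2) r_def[symmetric] by (simp add: algebra_simps)
  have Dn: "poly (down f') l \<ge> 0" by (rule down_nonneg[OF df(1,2)])
  have E0: "poly (up f') l - kappa l q' F' * poly (down f') l < 0"
    unfolding E using D r Dn by (smt (verit) mult_nonneg_nonneg)
  have tau: "tau l n (q', f', F') = t"
    unfolding tau_iff[OF df(1,2) E0 n]
  proof (intro conjI)
    show "- kappa l q' F' < t" using r by (simp add: kap flip: r_def)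
    show "poly (up f') l + t * poly (down f') l < 0" unfolding At using D by simp
    have "poly (down f) l * poly (down f') l = poly (deriv_down_sq f) l" using ef(3) by simp
    moreover have "gamma_fun l (q', f', F') t = (- poly (down f) l - r * poly (down f') l) * (- poly (down f) l / r)"
      unfolding gamma_fun_def prod.case E At by (simp add: kap flip: r_def)
    moreover have "(- poly (down f) l - r * poly (down f') l) * (- poly (down f) l / r) = (poly (down f) l)\<^sup>2 / r + poly (down f) l * poly (down f') l"
      using r by (simp add: field_simps power2_eq_square)
    moreover have "(poly (down f) l)\<^sup>2 / r = G 0" using D G0 by (simp add: r_def)
    ultimately show "gamma_fun l (q', f', F') t = n" unfolding nG by simp
  qed
  define v dv where "v = fst (solution_at 0 1 t q' l)" and "dv = snd (solution_at 0 1 t q' l)"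
  have v: "is_solution q' l (v, dv)" "v 0 = 1" "dv 0 = t"
    unfolding v_def dv_def using solution_at[OF q', of 0] by auto
  have "T_tilde (l, n, P) = darboux l (v, dv) (q', f', F')"
    using S1 by (simp add: T_tilde_def P tau v_def dv_def flip: n_def)
  also have "(q', f', F') = darboux l (u, du) (q, f, F)"
    by (simp add: darboux_eq q'_def f'_def F'_def t_def T_def)
  finally show "same_problem (T_tilde (l, lowest_nc (q, f, F), P)) (q, f, F)"
    using darboux_darboux[OF q u(1) unz v(1)[unfolded q'_def], of 0 f F] v by (simp add: n_def t_def)
qed

text \<open>The left Dirichlet condition becomes a constant and the norming constant doubles, so the
  old one is half of the new one, as \<open>S_tilde2\<close> demands. On the way back \<phi> of the
  new problem at \<lambda>_0 - 2 has the logarithmic derivative of 1/u at 0.\<close>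

lemma T_hat_roundtrip_left_infinite:
  assumes q: "q absolutely_integrable_on {0<..<pi}" and F: "F \<in> RR" "F \<noteq> None"
  defines "l \<equiv> lowest_ev (q, None, F)" and "P \<equiv> T_hat (q, None, F)"
  shows "(l, lowest_nc (q, None, F), P) \<in> S_tilde" "same_problem (T_tilde (l, lowest_nc (q, None, F), P)) (q, None, F)"
proof -
  have N: "None \<in> RR" by (simp add: RR_def)
  define L where "L = l - 2"
  define u du where "u = fst (psi q F L)" and "du = snd (psi q F L)"
  note g = ground_phi[OF q N F(1), folded l_def]
  have bl: "below l F" and Ll: "L < l" using g by (auto simp: ground_def L_def)
  then have bL: "below L F" using below_mono by (meson less_imp_le)
  note u = psi_solution[OF q, where F = F and l = L, folded u_def du_def]
  note M = below_ground_backward[OF q N F(1) g Ll u]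
  have D: "poly (down F) L > 0" using down_pos[OF F(1) bL F(2)] .
  have upos: "u x > 0" if "x \<in> {0..pi}" for x using M(1)[of x] that D u(2) by (cases "x = pi") auto
  have unz: "\<And>x. x \<in> {0..pi} \<Longrightarrow> u x \<noteq> 0" using upos by force
  have right: "poly (down F) L * du pi - poly (up F) L * u pi = 0" by (simp add: u)
  define q' f' F' where "q' = darboux_potential q u du" and "f' = Theta L (- du 0 / u 0) None" and "F' = Theta L (du pi / u pi) F"
  have P: "P = (q', f', F')"
    by (simp add: P_def T_hat_def Let_def darboux_eq q'_def f'_def F'_def u_def du_def flip: l_def L_def)
  have q': "q' absolutely_integrable_on {0<..<pi}" unfolding q'_def by (rule darboux_integrable[OF potentialI[OF q] u(1) unz])
  note tr = darboux_ground_increasing_decreasing[OF q N F(1) g Ll u(1) upos F(2) M(2) right, folded q'_def f'_def F'_def]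
  have T: "poly (up F) L = du pi / u pi * poly (down F) L" using D by (simp add: u)
  have F': "F' \<in> RR" unfolding F'_def by (rule Theta_decreasing(1)[OF F(1) bL F(2) T])
  have f'r: "f' = Some (ratc (du 0 / u 0))" by (simp add: f'_def Theta_def)
  have f': "f' \<in> RR" by (simp add: f'r ratc_RR)
  have S2: "(l, lowest_nc (q, None, F), P) \<in> S_tilde2"
    using q' f' F' tr by (simp add: S_tilde2_def P f'r ratc_RR_ind_0 L_def)
  then show "(l, lowest_nc (q, None, F), P) \<in> S_tilde" by (simp add: S_tilde_def)
  have S1: "(l, lowest_nc (q, None, F), P) \<notin> S_tilde1" using tr(1) by (simp add: S_tilde1_def P)
  define v dv where "v = fst (phi q' f' L)" and "dv = snd (phi q' f' L)"
  note v = phi_solution[OF q', where f = f' and l = L, folded v_def dv_def]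
  have v0: "v 0 = 1" "dv 0 = - du 0 / u 0" using v by (simp_all add: f'r ratc_RR)
  have "T_tilde (l, lowest_nc (q, None, F), P) = darboux L (v, dv) (q', f', F')"
    using S1 S2 by (simp add: T_tilde_def P v_def dv_def L_def)
  also have "(q', f', F') = darboux L (u, du) (q, None, F)"
    by (simp add: darboux_eq q'_def f'_def F'_def)
  finally show "same_problem (T_tilde (l, lowest_nc (q, None, F), P)) (q, None, F)"
    using darboux_darboux[OF q u(1) unz v(1)[unfolded q'_def], of 0 None F] v0 by simp
qed

text \<open>The counterpart at \<pi>: the norming constant is halved, which leads to
  \<open>S_tilde3\<close>, and the function for the way back is \<psi>, matched with 1/u at
  \<pi>.\<close>

lemma T_hat_roundtrip_right_infinite:
  assumes q: "q absolutely_integrable_on {0<..<pi}" and f: "f \<in> RR" "f \<noteq> None"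
  defines "l \<equiv> lowest_ev (q, f, None)" and "P \<equiv> T_hat (q, f, None)"
  shows "(l, lowest_nc (q, f, None), P) \<in> S_tilde" "same_problem (T_tilde (l, lowest_nc (q, f, None), P)) (q, f, None)"
proof -
  have N: "None \<in> RR" by (simp add: RR_def)
  define L where "L = l - 2"
  define u du where "u = fst (phi q f L)" and "du = snd (phi q f L)"
  note g = ground_phi[OF q f(1) N, folded l_def]
  have bl: "below l f" and Ll: "L < l" using g by (auto simp: ground_def L_def)
  then have bL: "below L f" using below_mono by (meson less_imp_le)
  note u = phi_solution[OF q, where f = f and l = L, folded u_def du_def]
  note M = phi_below_ground[OF q f(1) N g Ll u]
  have D: "poly (down f) L > 0" using down_pos[OF f(1) bL f(2)] .
  have upos: "u x > 0" if "x \<in> {0..pi}" for x using M(1)[of x] that D u(2) by (cases "x = 0") auto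
  have unz: "\<And>x. x \<in> {0..pi} \<Longrightarrow> u x \<noteq> 0" using upos by force
  have left: "poly (down f) L * du 0 + poly (up f) L * u 0 = 0" by (simp add: u)
  define q' f' F' where "q' = darboux_potential q u du" and "f' = Theta L (- du 0 / u 0) f" and "F' = Theta L (du pi / u pi) None"
  have P: "P = (q', f', F')"
    using f(2) by (simp add: P_def T_hat_def Let_def darboux_eq q'_def f'_def F'_def u_def du_def flip: l_def L_def)
  have q': "q' absolutely_integrable_on {0<..<pi}" unfolding q'_def by (rule darboux_integrable[OF potentialI[OF q] u(1) unz])
  note tr = darboux_ground_decreasing_increasing[OF q f(1) N g Ll u(1) upos f(2) left M(2), folded q'_def f'_def F'_def]
  have t: "poly (up f) L = - du 0 / u 0 * poly (down f) L" using D by (simp add: u)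
  have f': "f' \<in> RR" unfolding f'_def by (rule Theta_decreasing(1)[OF f(1) bL f(2) t])
  have F'r: "F' = Some (ratc (- (du pi / u pi)))" by (simp add: F'_def Theta_def)
  have F': "F' \<in> RR" by (simp add: F'r ratc_RR)
  have S3: "(l, lowest_nc (q, f, None), P) \<in> S_tilde3"
    using q' f' F' tr by (simp add: S_tilde3_def P F'r ratc_RR_ind_0 L_def)
  then show "(l, lowest_nc (q, f, None), P) \<in> S_tilde" by (simp add: S_tilde_def)
  have S1: "(l, lowest_nc (q, f, None), P) \<notin> S_tilde1" using tr(1) by (simp add: S_tilde1_def P)
  \<comment> \<open>Half and twice a positive number differ, so the case distinction in
    \<open>T_tilde\<close> reaches its last branch.\<close>
  have S2: "(l, lowest_nc (q, f, None), P) \<notin> S_tilde2"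
    using tr(2) lowest_nc_pos[OF q' f' F'] by (simp add: S_tilde2_def P L_def)
  define v dv where "v = fst (psi q' F' L)" and "dv = snd (psi q' F' L)"
  note v = psi_solution[OF q', where F = F' and l = L, folded v_def dv_def]
  have v0: "v pi = 1" "dv pi = - du pi / u pi" using v by (simp_all add: F'r ratc_RR)
  have "T_tilde (l, lowest_nc (q, f, None), P) = darboux L (v, dv) (q', f', F')"
    using S1 S2 by (simp add: T_tilde_def P v_def dv_def L_def)
  also have "(q', f', F') = darboux L (u, du) (q, f, None)"
    by (simp add: darboux_eq q'_def f'_def F'_def)
  finally show "same_problem (T_tilde (l, lowest_nc (q, f, None), P)) (q, f, None)"
    using darboux_darboux[OF q u(1) unz v(1)[unfolded q'_def], of pi f None] v0 by simp
qed

text \<open>Both ends of the interval for \<tau> have a meaning: \<tau> > -\<kappa> makes the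
  Wronskian of u and \<psi> positive and hence u positive up to \<pi>, and \<tau> < -f(\<mu>) makes
  \<Theta> raise f. A multiple of 1/u is then the ground state of the new problem at \<mu>, so
  \<open>T_hat\<close> works at this very parameter.\<close>

lemma T_tilde_roundtrip1:
  assumes S: "(m, n, q, f, F) \<in> S_tilde1"
  shows "T_tilde (m, n, q, f, F) \<in> S_hat" "same_problem (T_hat (T_tilde (m, n, q, f, F))) (q, f, F)"
proof -
  have q: "q absolutely_integrable_on {0<..<pi}" and f: "f \<in> RR" and F: "F \<in> RR"
    and m: "m < lowest_ev (q, f, F)" and n: "n > 0" using S by (auto simp: S_tilde1_def)
  note g = ground_phi[OF q f F]
  have b: "below m f" "below m F" using g m below_mono unfolding ground_def by (meson less_imp_le)+
  define p dp where "p = fst (psi q F m)" and "dp = snd (psi q F m)"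
  note p = psi_solution[OF q, where F = F and l = m, folded p_def dp_def]
  note M = below_ground_backward[OF q f F g m p]
  have p0: "p 0 > 0" using M(1)[of 0] by simp
  have K: "kappa m q F = - dp 0 / p 0"
    by (rule kappa_eq[OF q F b(2) p(1)]) (use p p0 in auto)
  have "p 0 * (poly (up f) m - kappa m q F * poly (down f) m) = poly (down f) m * dp 0 + poly (up f) m * p 0"
    unfolding K using p0 by (simp add: field_simps)
  then have E: "poly (up f) m - kappa m q F * poly (down f) m < 0" using M(2) p0 by (metis mult_less_0_iff not_less_iff_gr_or_eq)
  define t where "t = tau m n (q, f, F)"
  have t: "- kappa m q F < t" "poly (up f) m + t * poly (down f) m < 0"
    using tau_iff[OF f b(1) E n, of t] by (auto simp: t_def)
  define u du where "u = fst (solution_at 0 1 t q m)" and "du = snd (solution_at 0 1 t q m)"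
  have u: "is_solution q m (u, du)" "u 0 = 1" "du 0 = t"
    unfolding u_def du_def using solution_at[OF q, of 0] by auto
  have W0: "du 0 * p 0 - u 0 * dp 0 > 0"
  proof -
    have "- dp 0 / p 0 > - t" using t(1) unfolding K by simp
    then show ?thesis using p0 by (simp add: u field_simps)
  qed
  have ppi: "p pi \<ge> 0" using down_nonneg[OF F b(2)] by (simp add: p)
  have W: "((\<lambda>x. du x * p x - u x * dp x) has_real_derivative 0 * (u x * p x)) (at x within {0..pi})" if "x \<in> {0..pi}" for x
    using solution_wronskian[OF q u(1) p(1) that] by simp
  note PF = positive_forward[where w = u and dw = du and y = p and dy = dp and c = "\<lambda>_. 0", OF pi_gt_zero solution_derivative[OF u(1)] W]
  have up: "u x > 0" if "0 < x" "x \<le> pi" for x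
    by (rule PF(1)) (use M(1) ppi W0 u that in auto)
  have upos: "u x > 0" if "x \<in> {0..pi}" for x using up[of x] that u(2) by (cases "x = 0") auto
  have unz: "\<And>x. x \<in> {0..pi} \<Longrightarrow> u x \<noteq> 0" using upos by force
  \<comment> \<open>The same positive Wronskian at \<pi>, where \<psi> has the data
    \<open>down\<close> and \<open>up\<close> of F: \<Theta> raises F as well.\<close>
  have "du pi * p pi - u pi * dp pi > 0"
    by (rule PF(2)) (use M(1) ppi W0 u in auto)
  then have right: "poly (up F) m < du pi / u pi * poly (down F) m" using upos[of pi] by (simp add: p field_simps)
  have left: "poly (up f) m < - du 0 / u 0 * poly (down f) m" using t(2) by (simp add: u)
  define q' f' F' where "q' = darboux_potential q u du" and "f' = Theta m (- du 0 / u 0) f" and "F' = Theta m (du pi / u pi) F"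
  note df = Theta_increasing_eval(1-3)[OF f b(1) left, folded f'_def] and ef = Theta_increasing_eval(4,5)[OF f b(1) left, of m, folded f'_def]
  note dF = Theta_increasing_eval(1-3)[OF F b(2) right, folded F'_def] and eF = Theta_increasing_eval(4,5)[OF F b(2) right, of m, folded F'_def]
  have q': "q' absolutely_integrable_on {0<..<pi}" unfolding q'_def by (rule darboux_integrable[OF potentialI[OF q] u(1) unz])
  have T: "T_tilde (m, n, q, f, F) = darboux m (u, du) (q, f, F)"
    using S by (simp add: T_tilde_def u_def du_def t_def)
  have T': "T_tilde (m, n, q, f, F) = (q', f', F')" unfolding T by (simp add: darboux_eq q'_def f'_def F'_def)
  show "T_tilde (m, n, q, f, F) \<in> S_hat" unfolding T' using q' df dF by (simp add: S_hat_def)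
  define c where "c = poly (down f') m * u 0"
  have D: "poly (down f') m > 0" using down_pos[OF df] .
  then have c: "c > 0" by (simp add: c_def u)
  define w dw where "w x = c / u x" and "dw x = - (du x / u x * (c / u x))" for x
  have w: "is_solution q' m (w, dw)"
    unfolding q'_def w_def[abs_def] dw_def[abs_def] by (rule darboux_reciprocal_solution[OF q u(1) upos])
  have g': "ground q' f' F' m w dw"
    unfolding ground_def
  proof (intro conjI ballI df dF w)
    show "w x > 0" if "x \<in> {0<..<pi}" for x using upos[of x] c that by (simp add: w_def)
    show "w 0 = poly (down f') m" by (simp add: w_def c_def u)
    show "dw 0 = - poly (up f') m" unfolding ef(2) by (simp add: dw_def c_def u)
    show "poly (down F') m * dw pi = poly (up F') m * w pi" unfolding eF(2) by (simp add: dw_def w_def)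
  qed
  have lo: "lowest_ev (q', f', F') = m" by (rule ground_lowest[OF q' df(1) dF(1) g'])
  define v dv where "v = fst (phi q' f' m)" and "dv = snd (phi q' f' m)"
  note v = phi_solution[OF q', where f = f' and l = m, folded v_def dv_def]
  have v0: "v 0 \<noteq> 0" "dv 0 / v 0 = - du 0 / u 0" using D by (simp_all add: v ef(2))
  have "T_hat (q', f', F') = darboux m (v, dv) (q', f', F')"
    using df(3) dF(3) by (simp add: T_hat_def lo v_def dv_def)
  then have "T_hat (T_tilde (m, n, q, f, F)) = darboux m (v, dv) (darboux m (u, du) (q, f, F))"
    unfolding T' by (simp add: darboux_eq q'_def f'_def F'_def)
  then show "same_problem (T_hat (T_tilde (m, n, q, f, F))) (q, f, F)"
    using darboux_darboux[OF q u(1) unz v(1)[unfolded q'_def], of 0 f F] v0 by simp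
qed

text \<open>A constant f equals the parameter of \<Theta> at 0, so it becomes \<open>None\<close>.
  The lowest eigenvalue is unchanged, so \<open>T_hat\<close> returns to the same \<Lambda> = \<mu>
  - 2; its generating function \<psi> is a multiple of 1/u, as seen at \<pi>.\<close>

lemma T_tilde_roundtrip2:
  assumes S: "(m, n, q, f, F) \<in> S_tilde2"
  shows "T_tilde (m, n, q, f, F) \<in> S_hat" "same_problem (T_hat (T_tilde (m, n, q, f, F))) (q, f, F)"
proof -
  have q: "q absolutely_integrable_on {0<..<pi}" and f: "f \<in> RR" and F: "F \<in> RR"
    and m: "m = lowest_ev (q, f, F)" and f0: "f \<in> RR_ind 0" using S by (auto simp: S_tilde2_def)
  obtain a where a: "f = Some (ratc a)" by (rule RR_ind_0E[OF f0])
  have nf: "f \<noteq> None" by (simp add: a)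
  define L where "L = m - 2"
  define u du where "u = fst (phi q f L)" and "du = snd (phi q f L)"
  note g = ground_phi[OF q f F, folded m]
  have bl: "below m f" "below m F" and Ll: "L < m" using g by (auto simp: ground_def L_def)
  then have bL: "below L f" "below L F" using below_mono by (meson less_imp_le)+
  note u = phi_solution[OF q, where f = f and l = L, folded u_def du_def]
  note M = phi_below_ground[OF q f F g Ll u]
  have D: "poly (down f) L > 0" using down_pos[OF f bL(1) nf] .
  have upos: "u x > 0" if "x \<in> {0..pi}" for x using M(1)[of x] that D u(2) by (cases "x = 0") auto
  have unz: "\<And>x. x \<in> {0..pi} \<Longrightarrow> u x \<noteq> 0" using upos by force
  have left: "poly (down f) L * du 0 + poly (up f) L * u 0 = 0" by (simp add: u)
  have right: "poly (up F) L < du pi / u pi * poly (down F) L" using M(2) upos[of pi] by (simp add: field_simps)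
  define q' f' F' where "q' = darboux_potential q u du" and "f' = Theta L (- du 0 / u 0) f" and "F' = Theta L (du pi / u pi) F"
  have q': "q' absolutely_integrable_on {0<..<pi}" unfolding q'_def by (rule darboux_integrable[OF potentialI[OF q] u(1) unz])
  note dF = Theta_increasing_eval(1-3)[OF F bL(2) right, folded F'_def] and eF = Theta_increasing_eval(4,5)[OF F bL(2) right, of L, folded F'_def]
  note tr = darboux_ground_decreasing_increasing[OF q f F g Ll u(1) upos nf left M(2), folded q'_def f'_def F'_def]
  have f': "f' = None" by (simp add: f'_def u a ratc_RR Theta_const)
  have T: "T_tilde (m, n, q, f, F) = darboux L (u, du) (q, f, F)"
  proof -
    have "(m, n, q, f, F) \<notin> S_tilde1" by (simp add: S_tilde1_def m)
    then show ?thesis using S by (simp add: T_tilde_def u_def du_def L_def)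
  qed
  have T': "T_tilde (m, n, q, f, F) = (q', f', F')" unfolding T by (simp add: darboux_eq q'_def f'_def F'_def)
  show "T_tilde (m, n, q, f, F) \<in> S_hat" unfolding T' using q' dF by (simp add: S_hat_def f' RR_def)
  define v dv where "v = fst (psi q' F' L)" and "dv = snd (psi q' F' L)"
  note v = psi_solution[OF q', where F = F' and l = L, folded v_def dv_def]
  have D': "poly (down F') L > 0" using down_pos[OF dF] .
  have v0: "v pi \<noteq> 0" "dv pi / v pi = - du pi / u pi" using D' by (simp_all add: v eF(2))
  have "T_hat (q', f', F') = darboux L (v, dv) (q', f', F')"
    using tr(1) by (simp add: T_hat_def f' v_def dv_def L_def Let_def)
  then have "T_hat (T_tilde (m, n, q, f, F)) = darboux L (v, dv) (darboux L (u, du) (q, f, F))"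
    unfolding T' by (simp add: darboux_eq q'_def f'_def F'_def)
  then show "same_problem (T_hat (T_tilde (m, n, q, f, F))) (q, f, F)"
    using darboux_darboux[OF q u(1) unz v(1)[unfolded q'_def], of pi f F] v0 by simp
qed

text \<open>As with a constant f, but now a constant F turns into \<open>None\<close>, and the
  function for the way back is \<phi>, compared with 1/u at 0.\<close>

lemma T_tilde_roundtrip3:
  assumes S: "(m, n, q, f, F) \<in> S_tilde3"
  shows "T_tilde (m, n, q, f, F) \<in> S_hat" "same_problem (T_hat (T_tilde (m, n, q, f, F))) (q, f, F)"
proof -
  have q: "q absolutely_integrable_on {0<..<pi}" and f: "f \<in> RR" and F: "F \<in> RR"
    and m: "m = lowest_ev (q, f, F)" and F0: "F \<in> RR_ind 0" and n: "n = 2 * lowest_nc (q, f, F)"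
    using S by (auto simp: S_tilde3_def)
  obtain a where a: "F = Some (ratc a)" by (rule RR_ind_0E[OF F0])
  have nF: "F \<noteq> None" by (simp add: a)
  define L where "L = m - 2"
  define u du where "u = fst (psi q F L)" and "du = snd (psi q F L)"
  note g = ground_phi[OF q f F, folded m]
  have bl: "below m f" "below m F" and Ll: "L < m" using g by (auto simp: ground_def L_def)
  then have bL: "below L f" "below L F" using below_mono by (meson less_imp_le)+
  note u = psi_solution[OF q, where F = F and l = L, folded u_def du_def]
  note M = below_ground_backward[OF q f F g Ll u]
  have D: "poly (down F) L > 0" using down_pos[OF F bL(2) nF] .
  have upos: "u x > 0" if "x \<in> {0..pi}" for x using M(1)[of x] that D u(2) by (cases "x = pi") auto
  have unz: "\<And>x. x \<in> {0..pi} \<Longrightarrow> u x \<noteq> 0" using upos by force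
  have right: "poly (down F) L * du pi - poly (up F) L * u pi = 0" by (simp add: u)
  have left: "poly (up f) L < - du 0 / u 0 * poly (down f) L" using M(2) upos[of 0] by (simp add: field_simps)
  define q' f' F' where "q' = darboux_potential q u du" and "f' = Theta L (- du 0 / u 0) f" and "F' = Theta L (du pi / u pi) F"
  have q': "q' absolutely_integrable_on {0<..<pi}" unfolding q'_def by (rule darboux_integrable[OF potentialI[OF q] u(1) unz])
  note df = Theta_increasing_eval(1-3)[OF f bL(1) left, folded f'_def] and ef = Theta_increasing_eval(4,5)[OF f bL(1) left, of L, folded f'_def]
  note tr = darboux_ground_increasing_decreasing[OF q f F g Ll u(1) upos nF M(2) right, folded q'_def f'_def F'_def]
  have F': "F' = None" by (simp add: F'_def u a ratc_RR Theta_const)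
  have T: "T_tilde (m, n, q, f, F) = darboux L (u, du) (q, f, F)"
  proof -
    have "(m, n, q, f, F) \<notin> S_tilde1" by (simp add: S_tilde1_def m)
    moreover have "(m, n, q, f, F) \<notin> S_tilde2"
      using lowest_nc_pos[OF q f F] by (simp add: S_tilde2_def n)
    ultimately show ?thesis by (simp add: T_tilde_def u_def du_def L_def)
  qed
  have T': "T_tilde (m, n, q, f, F) = (q', f', F')" unfolding T by (simp add: darboux_eq q'_def f'_def F'_def)
  show "T_tilde (m, n, q, f, F) \<in> S_hat" unfolding T' using q' df by (simp add: S_hat_def F' RR_def)
  define v dv where "v = fst (phi q' f' L)" and "dv = snd (phi q' f' L)"
  note v = phi_solution[OF q', where f = f' and l = L, folded v_def dv_def]
  have D': "poly (down f') L > 0" using down_pos[OF df] .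
  have v0: "v 0 \<noteq> 0" "dv 0 / v 0 = - du 0 / u 0" using D' by (simp_all add: v ef(2))
  have "T_hat (q', f', F') = darboux L (v, dv) (q', f', F')"
    using tr(1) df(3) by (simp add: T_hat_def F' v_def dv_def L_def Let_def)
  then have "T_hat (T_tilde (m, n, q, f, F)) = darboux L (v, dv) (darboux L (u, du) (q, f, F))"
    unfolding T' by (simp add: darboux_eq q'_def f'_def F'_def)
  then show "same_problem (T_hat (T_tilde (m, n, q, f, F))) (q, f, F)"
    using darboux_darboux[OF q u(1) unz v(1)[unfolded q'_def], of 0 f F] v0 by simp
qed

theorem theorem3p5:
  shows "(\<forall>q f F q' f' F'.
            (q, f, F) \<in> S_hat \<longrightarrow> (q', f', F') = T_hat (q, f, F) \<longrightarrow>
            (lowest_ev (q, f, F), lowest_nc (q, f, F), q', f', F') \<in> S_tilde \<and>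
            same_problem
              (T_tilde (lowest_ev (q, f, F), lowest_nc (q, f, F), q', f', F')) (q, f, F)) \<and>
         (\<forall>\<mu> \<nu> q f F.
            (\<mu>, \<nu>, q, f, F) \<in> S_tilde \<longrightarrow>
            T_tilde (\<mu>, \<nu>, q, f, F) \<in> S_hat \<and>
            same_problem (T_hat (T_tilde (\<mu>, \<nu>, q, f, F))) (q, f, F))"
proof (intro conjI allI impI)
  fix q f F q' f' F'
  assume "(q, f, F) \<in> S_hat" and P: "(q', f', F') = T_hat (q, f, F)"
  then have h: "q absolutely_integrable_on {0<..<pi}" "f \<in> RR" "F \<in> RR" "\<not> (f = None \<and> F = None)"
    by (auto simp: S_hat_def)
  have "(lowest_ev (q, f, F), lowest_nc (q, f, F), T_hat (q, f, F)) \<in> S_tilde \<and>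
    same_problem (T_tilde (lowest_ev (q, f, F), lowest_nc (q, f, F), T_hat (q, f, F))) (q, f, F)"
  proof (cases "f = None \<or> F = None")
    case True
    then show ?thesis using T_hat_roundtrip_left_infinite[OF h(1,3)] T_hat_roundtrip_right_infinite[OF h(1,2)] h(4) by blast
  next
    case False
    then show ?thesis using T_hat_roundtrip_both_finite[OF h(1,2) _ h(3)] by (auto simp: S_tilde_def)
  qed
  then show "(lowest_ev (q, f, F), lowest_nc (q, f, F), q', f', F') \<in> S_tilde"
    and "same_problem (T_tilde (lowest_ev (q, f, F), lowest_nc (q, f, F), q', f', F')) (q, f, F)"
    unfolding P by auto
next
  fix \<mu> \<nu> q f F
  assume "(\<mu>, \<nu>, q, f, F) \<in> S_tilde"
  then show "T_tilde (\<mu>, \<nu>, q, f, F) \<in> S_hat"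
    and "same_problem (T_hat (T_tilde (\<mu>, \<nu>, q, f, F))) (q, f, F)"
    using T_tilde_roundtrip1 T_tilde_roundtrip2 T_tilde_roundtrip3 by (auto simp: S_tilde_def)
qed

end
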